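(* Let $E$ be a real separable Banach space, let $(T_t,t\ge 0)$ be a $C_0$-semigroup of bounded linear operators on $E$, and let $(\rho_t)_{t\ge 0}$ be a family of Borel probability measures on $E$. If $t\mapsto\rho_t$ is continuous at zero and $$\rho_{t+s}=\rho_t\ast T_t\rho_s\qquad\text{for all } t,s\ge 0,$$ then there exists a càdlàg $E$-valued process $(Z(t), t\ge 0)$ with independent increments such that $\mathcal{L}(Z(t))=\rho_t$ for every $t\ge 0$ and $Z(0)=0$ almost surely. In particular, all $\rho_t$ are infinitely divisible.
   Context: Continuity of $t\mapsto\rho_t$ is with respect to weak convergence of probability measures. $\ast$ is convolution of measures on $E$; for a bounded linear operator $A$ on $E$ and a Borel probability measure $\mu$, $A\mu$ is the image measure $(A\mu)(B)=\mu(\{x\in E: Ax\in B\})$. $\mathcal{L}(Z)$ is the probability distribution of $Z$. Càdlàg: paths are right continuous with left limits. A $C_0$-semigroup on $E$ is a family $(T_t)_{t\ge 0}$ of bounded linear operators with $T_0=I$, $T_tT_s=T_{t+s}$ for $s,t\ge0$, and $t\mapsto T_t x$ continuous for each $x\in E$. *)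

theory Defs
  imports "HOL-Probability.Probability"
begin

definition borel_prob :: "'a::topological_space measure \<Rightarrow> bool" where
  "borel_prob \<mu> \<longleftrightarrow> prob_space \<mu> \<and> sets \<mu> = sets borel"

definition C0_semigroup :: "(real \<Rightarrow> 'a::real_normed_vector \<Rightarrow>\<^sub>L 'a) \<Rightarrow> bool" where
  "C0_semigroup T \<longleftrightarrow>
     T 0 = id_blinfun \<and>
     (\<forall>t\<ge>0. \<forall>s\<ge>0. T (t + s) = T t o\<^sub>L T s) \<and>
     (\<forall>x. continuous_on {0..} (\<lambda>t. blinfun_apply (T t) x))"

(* The library's convolution has the same defining formula, but it is restricted to the
   class ordered_euclidean_space; weak convergence there is restricted to real measures. *)

definition measure_conv :: "'a::{banach, second_countable_topology} measure \<Rightarrow> 'a measure \<Rightarrow> 'a measure" where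
  "measure_conv \<mu> \<nu> = distr (\<mu> \<Otimes>\<^sub>M \<nu>) borel (\<lambda>(x, y). x + y)"

definition weakly_tendsto ::
    "('i \<Rightarrow> 'a::topological_space measure) \<Rightarrow> 'a measure \<Rightarrow> 'i filter \<Rightarrow> bool" where
  "weakly_tendsto \<mu> \<nu> F \<longleftrightarrow>
     (\<forall>f :: 'a \<Rightarrow> real. continuous_on UNIV f \<and> bounded (range f) \<longrightarrow>
        ((\<lambda>i. \<integral>x. f x \<partial>\<mu> i) \<longlongrightarrow> (\<integral>x. f x \<partial>\<nu>)) F)"

definition infinitely_divisible :: "'a::{banach, second_countable_topology} measure \<Rightarrow> bool" where
  "infinitely_divisible \<mu> \<longleftrightarrow>
     (\<forall>n\<ge>(1::nat). \<exists>\<nu>. borel_prob \<nu> \<and> \<mu> = (measure_conv \<nu> ^^ n) (return borel 0))"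

definition cadlag :: "(real \<Rightarrow> 'a::topological_space) \<Rightarrow> bool" where
  "cadlag f \<longleftrightarrow>
     (\<forall>t\<ge>0. (f \<longlongrightarrow> f t) (at_right t)) \<and> (\<forall>t>0. \<exists>l. (f \<longlongrightarrow> l) (at_left t))"

definition independent_increments ::
    "'w measure \<Rightarrow> (real \<Rightarrow> 'w \<Rightarrow> 'a::real_normed_vector) \<Rightarrow> bool" where
  "independent_increments M Z \<longleftrightarrow>
     (\<forall>(n::nat) (t :: nat \<Rightarrow> real). 0 \<le> t 0 \<and> (\<forall>i<n. t i < t (Suc i)) \<longrightarrow>
        prob_space.indep_vars M (\<lambda>_. borel) (\<lambda>i \<omega>. Z (t (Suc i)) \<omega> - Z (t i) \<omega>) {..<n})"

end

theory Submission
  imports Defs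
begin

text \<open>
  The laws \<open>T\<^sub>s \<rho>\<^sub>t\<^sub>-\<^sub>s\<close> form a convolution hemigroup, which is the family of increment laws of a
  process \<open>Z\<close> obtained from Kolmogorov's extension theorem. By Ottaviani's inequality the number of large
  oscillations of \<open>Z\<close> over the rational times of a short interval has geometric tails, so almost surely all
  one-sided limits along rational times exist; the right limits form the cadlag version.

  The increments of \<open>Z\<close> are not identically distributed, so infinite divisibility needs an argument. Cut
  \<open>[0, t]\<close> into \<open>n m\<close> steps of length \<open>h\<close> and group the increments by residue class modulo \<open>m\<close>. The class of
  residue \<open>j\<close> has law \<open>T\<^sub>j\<^sub>h \<alpha>\<^sub>n\<close>, where \<open>\<alpha>\<^sub>n\<close> is the law of the class of residue \<open>0\<close>. As a convolution factor of
  \<open>\<rho>\<^sub>t\<close>, \<open>\<alpha>\<^sub>n\<close> is tight up to translation, and since \<open>T\<^sub>j\<^sub>h\<close> tends strongly to the identity, \<open>\<rho>\<^sub>t\<close> is the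
  \<open>m\<close>-th convolution power of a limit of the translated \<open>\<alpha>\<^sub>n\<close>, translated again.
\<close>

section \<open>Convolution of Borel probability measures\<close>

text \<open>Two facts that the construction rests on are not among the hypotheses. The equation at
  times 0, 0 only says that \<open>\<rho> 0\<close> is idempotent under convolution; that it is the
  point mass at 0 needs its own argument, and both Z(0) = 0 and the smallness of short increments
  depend on it. Moreover \<open>T\<close> is only strongly continuous, so increments T_s X with X
  distributed as \<rho>_h are small uniformly in s on bounded time intervals only through the
  uniform boundedness principle.

  For divisibility the factorization by residue classes is exact for every n; only the twist by
  powers of T_h has to disappear in the limit. The translations that make the factors tight are
  uncontrolled, but a twisted power of a point mass is a point mass, so together they amount to one
  translation by some y_n of the fixed law \<rho>_t. Convergence of the products forces the y_n to
  be tight, and a point mass at -y_n is divided into m equal parts directly. Weak limits do all the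
  work; no Fourier transform enters, so the geometry of the Banach space does not matter.\<close>

lemma borel_probD:
  assumes "borel_prob \<mu>"
  shows "prob_space \<mu>" "sets \<mu> = sets borel" "space \<mu> = UNIV" "sigma_finite_measure \<mu>"
  using assms unfolding borel_prob_def
  by (auto dest: sets_eq_imp_space_eq prob_space_imp_sigma_finite)

lemma borel_probI: "prob_space \<mu> \<Longrightarrow> sets \<mu> = sets borel \<Longrightarrow> borel_prob \<mu>"
  by (simp add: borel_prob_def)

lemma borel_prob_return [simp]: "borel_prob (return borel x)"
  by (auto intro!: borel_probI prob_space_return)

lemma borel_prob_distr:
  "prob_space M \<Longrightarrow> f \<in> borel_measurable M \<Longrightarrow> borel_prob (distr M borel f)"
  by (auto intro!: borel_probI prob_space.prob_space_distr)

lemma measurable_borel_prob: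
  "borel_prob \<mu> \<Longrightarrow> f \<in> borel_measurable borel \<Longrightarrow> f \<in> borel_measurable \<mu>"
  using measurable_cong_sets[OF borel_probD(2) refl] by blast

lemma emeasure_distr_nn_integral:
  assumes [measurable]: "f \<in> M \<rightarrow>\<^sub>M N" "A \<in> sets N"
  shows "emeasure (distr M N f) A = (\<integral>\<^sup>+x. indicator A (f x) \<partial>M)"
proof -
  have "emeasure (distr M N f) A = (\<integral>\<^sup>+y. indicator A y \<partial>distr M N f)"
    by simp
  also have "\<dots> = (\<integral>\<^sup>+x. indicator A (f x) \<partial>M)"
    by (rule nn_integral_distr) measurable
  finally show ?thesis .
qed

lemma borel_prob_eqI:
  assumes "borel_prob \<mu>" "borel_prob \<nu>"
    and "\<And>A. A \<in> sets borel \<Longrightarrow> emeasure \<mu> A = emeasure \<nu> A"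
  shows "\<mu> = \<nu>"
  using assms by (auto intro!: measure_eqI simp: borel_probD)

lemma measurable_plus_conv:
  assumes "borel_prob \<mu>" "borel_prob (\<nu> :: 'a::{banach, second_countable_topology} measure)"
  shows "(\<lambda>(x, y). x + y) \<in> borel_measurable (\<mu> \<Otimes>\<^sub>M \<nu>)"
proof -
  note [measurable_cong] = assms[THEN borel_probD(2)]
  show ?thesis by measurable
qed

lemma borel_prob_conv:
  assumes "borel_prob \<mu>" "borel_prob \<nu>"
  shows "borel_prob (measure_conv \<mu> \<nu>)"
proof -
  interpret \<mu>: prob_space \<mu> using assms(1) by (rule borel_probD)
  interpret \<nu>: prob_space \<nu> using assms(2) by (rule borel_probD)
  interpret pair_prob_space \<mu> \<nu> ..
  show ?thesis
    unfolding measure_conv_def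
    by (rule borel_prob_distr[OF _ measurable_plus_conv[OF assms]]) unfold_locales
qed

text \<open>In this iterated form, commutativity of convolution is Tonelli's theorem and
  associativity is associativity of addition.\<close>

lemma nn_integral_conv:
  assumes \<mu>: "borel_prob \<mu>" and \<nu>: "borel_prob \<nu>" and [measurable]: "f \<in> borel_measurable borel"
  shows "(\<integral>\<^sup>+z. f z \<partial>measure_conv \<mu> \<nu>) = (\<integral>\<^sup>+x. (\<integral>\<^sup>+y. f (x + y) \<partial>\<nu>) \<partial>\<mu>)"
proof -
  note [measurable_cong] = assms(1,2)[THEN borel_probD(2)]
  interpret \<nu>: sigma_finite_measure \<nu> by (rule borel_probD[OF \<nu>])
  show ?thesis
    unfolding measure_conv_def
    by (subst nn_integral_distr) (auto simp: \<nu>.nn_integral_fst[symmetric] split_beta')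
qed

lemma emeasure_conv:
  assumes \<mu>: "borel_prob \<mu>" and \<nu>: "borel_prob \<nu>" and A: "A \<in> sets borel"
  shows "emeasure (measure_conv \<mu> \<nu>) A = (\<integral>\<^sup>+x. (\<integral>\<^sup>+y. indicator A (x + y) \<partial>\<nu>) \<partial>\<mu>)"
proof -
  have "emeasure (measure_conv \<mu> \<nu>) A = (\<integral>\<^sup>+z. indicator A z \<partial>measure_conv \<mu> \<nu>)"
    using A borel_probD[OF borel_prob_conv[OF \<mu> \<nu>]] by simp
  then show ?thesis
    using A by (simp add: nn_integral_conv[OF \<mu> \<nu>])
qed

lemma measurable_shift_nn_integral:
  assumes \<nu>: "borel_prob (\<nu> :: 'a::{banach, second_countable_topology} measure)"
    and [measurable]: "f \<in> borel_measurable borel"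
  shows "(\<lambda>x. \<integral>\<^sup>+y. f (x + y) \<partial>\<nu>) \<in> borel_measurable borel"
proof -
  note [measurable_cong] = borel_probD(2)[OF \<nu>]
  interpret \<nu>: sigma_finite_measure \<nu> by (rule borel_probD[OF \<nu>])
  show ?thesis by measurable
qed

lemma integral_conv:
  fixes f :: "'a::{banach, second_countable_topology} \<Rightarrow> real"
  assumes \<mu>: "borel_prob \<mu>" and \<nu>: "borel_prob \<nu>" and [measurable]: "f \<in> borel_measurable borel"
    and bound: "\<And>x. \<bar>f x\<bar> \<le> C"
  shows "(\<integral>z. f z \<partial>measure_conv \<mu> \<nu>) = (\<integral>x. (\<integral>y. f (x + y) \<partial>\<nu>) \<partial>\<mu>)"
proof -
  note [measurable_cong] = assms(1,2)[THEN borel_probD(2)]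
  interpret \<mu>: prob_space \<mu> using assms(1) by (rule borel_probD)
  interpret \<nu>: prob_space \<nu> using assms(2) by (rule borel_probD)
  interpret pair_prob_space \<mu> \<nu> ..
  have int: "integrable (\<mu> \<Otimes>\<^sub>M \<nu>) (\<lambda>(x, y). f (x + y))"
    using bound by (intro integrable_const_bound[where B=C]) auto
  have "(\<integral>z. f z \<partial>measure_conv \<mu> \<nu>) = (\<integral>z. (case z of (x, y) \<Rightarrow> f (x + y)) \<partial>(\<mu> \<Otimes>\<^sub>M \<nu>))"
    unfolding measure_conv_def by (subst integral_distr) (auto simp: split_beta')
  also have "\<dots> = (\<integral>x. (\<integral>y. f (x + y) \<partial>\<nu>) \<partial>\<mu>)"
    by (rule integral_fst[OF int, symmetric])
  finally show ?thesis .
qed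

lemma conv_commute:
  assumes \<mu>: "borel_prob \<mu>" and \<nu>: "borel_prob \<nu>"
  shows "measure_conv \<mu> \<nu> = measure_conv \<nu> \<mu>"
proof (rule borel_prob_eqI)
  note [measurable_cong] = assms(1,2)[THEN borel_probD(2)]
  interpret \<mu>: prob_space \<mu> using assms(1) by (rule borel_probD)
  interpret \<nu>: prob_space \<nu> using assms(2) by (rule borel_probD)
  interpret pair_prob_space \<mu> \<nu> ..
  fix A :: "'a set" assume [measurable]: "A \<in> sets borel"
  show "emeasure (measure_conv \<mu> \<nu>) A = emeasure (measure_conv \<nu> \<mu>) A"
    unfolding emeasure_conv[OF \<mu> \<nu> \<open>A \<in> sets borel\<close>] emeasure_conv[OF \<nu> \<mu> \<open>A \<in> sets borel\<close>]
    using Fubini'[of "\<lambda>x y. indicator A (x + y)"] by (simp add: add.commute)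
qed (use assms in \<open>auto intro: borel_prob_conv\<close>)

lemma conv_assoc:
  assumes \<mu>: "borel_prob \<mu>" and \<nu>: "borel_prob \<nu>" and \<kappa>: "borel_prob \<kappa>"
  shows "measure_conv (measure_conv \<mu> \<nu>) \<kappa> = measure_conv \<mu> (measure_conv \<nu> \<kappa>)"
proof (rule borel_prob_eqI)
  note [measurable_cong] = assms[THEN borel_probD(2)]
  interpret \<kappa>: prob_space \<kappa> using \<kappa> by (rule borel_probD)
  fix A :: "'a set" assume A[measurable]: "A \<in> sets borel"
  have 1: "(\<lambda>x. \<integral>\<^sup>+z. indicator A (x + z) \<partial>\<kappa>) \<in> borel_measurable borel"
    by (rule measurable_shift_nn_integral[OF \<kappa>]) simp
  have 2: "(\<lambda>z. indicator A (x + z) :: ennreal) \<in> borel_measurable borel" for x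
    by measurable
  have "emeasure (measure_conv (measure_conv \<mu> \<nu>) \<kappa>) A
      = (\<integral>\<^sup>+x. \<integral>\<^sup>+y. \<integral>\<^sup>+z. indicator A (x + y + z) \<partial>\<kappa> \<partial>\<nu> \<partial>\<mu>)"
    unfolding emeasure_conv[OF borel_prob_conv[OF \<mu> \<nu>] \<kappa> A] nn_integral_conv[OF \<mu> \<nu> 1] ..
  also have "\<dots> = emeasure (measure_conv \<mu> (measure_conv \<nu> \<kappa>)) A"
    unfolding emeasure_conv[OF \<mu> borel_prob_conv[OF \<nu> \<kappa>] A] nn_integral_conv[OF \<nu> \<kappa> 2]
    by (simp only: add.assoc)
  finally show "emeasure (measure_conv (measure_conv \<mu> \<nu>) \<kappa>) A = emeasure (measure_conv \<mu> (measure_conv \<nu> \<kappa>)) A" .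
qed (use assms in \<open>auto intro!: borel_prob_conv\<close>)

lemma conv_return_right:
  assumes \<mu>: "borel_prob \<mu>"
  shows "measure_conv \<mu> (return borel a) = distr \<mu> borel (\<lambda>x. x + a)"
proof (rule borel_prob_eqI)
  note [measurable_cong] = assms[THEN borel_probD(2)]
  fix A :: "'a set" assume A[measurable]: "A \<in> sets borel"
  have "emeasure (measure_conv \<mu> (return borel a)) A = (\<integral>\<^sup>+x. indicator A (x + a) \<partial>\<mu>)"
    using assms by (simp add: emeasure_conv nn_integral_return)
  also have "\<dots> = emeasure (distr \<mu> borel (\<lambda>x. x + a)) A"
    by (subst emeasure_distr_nn_integral) auto
  finally show "emeasure (measure_conv \<mu> (return borel a)) A = emeasure (distr \<mu> borel (\<lambda>x. x + a)) A" .
next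
  note [measurable_cong] = assms[THEN borel_probD(2)]
  show "borel_prob (distr \<mu> borel (\<lambda>x. x + a))"
    by (rule borel_prob_distr) (use borel_probD[OF \<mu>] in auto)
qed (use assms in \<open>auto intro!: borel_prob_conv\<close>)

lemma conv_return_0 [simp]:
  assumes \<mu>: "borel_prob \<mu>"
  shows "measure_conv \<mu> (return borel 0) = \<mu>" "measure_conv (return borel 0) \<mu> = \<mu>"
proof -
  show "measure_conv \<mu> (return borel 0) = \<mu>"
    using borel_probD(2)[OF \<mu>] by (simp add: conv_return_right[OF \<mu>] distr_id2)
  then show "measure_conv (return borel 0) \<mu> = \<mu>"
    using \<mu> by (simp add: conv_commute)
qed

lemma conv_return_return: "measure_conv (return borel a) (return borel b) = return borel (a + b)"
  by (subst conv_return_right) (auto simp: distr_return)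

lemma distr_conv_additive:
  fixes f :: "'a::{banach, second_countable_topology} \<Rightarrow> 'b::{banach, second_countable_topology}"
  assumes \<mu>: "borel_prob \<mu>" and \<nu>: "borel_prob \<nu>" and f[measurable]: "f \<in> borel_measurable borel"
    and add: "\<And>x y. f (x + y) = f x + f y"
  shows "distr (measure_conv \<mu> \<nu>) borel f = measure_conv (distr \<mu> borel f) (distr \<nu> borel f)"
proof (rule borel_prob_eqI)
  note [measurable_cong] = borel_probD(2)[OF \<mu>] borel_probD(2)[OF \<nu>] borel_probD(2)[OF borel_prob_conv[OF \<mu> \<nu>]]
  interpret \<nu>: prob_space \<nu> using assms(2) by (rule borel_probD)
  have bp: "borel_prob (distr \<mu> borel f)" "borel_prob (distr \<nu> borel f)"
    by (auto intro!: borel_prob_distr borel_probD \<mu> \<nu>)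
  then show "borel_prob (measure_conv (distr \<mu> borel f) (distr \<nu> borel f))"
    by (rule borel_prob_conv)
  show "borel_prob (distr (measure_conv \<mu> \<nu>) borel f)"
    by (auto intro!: borel_prob_distr borel_probD borel_prob_conv \<mu> \<nu>)
  fix A :: "'b set" assume A[measurable]: "A \<in> sets borel"
  have "emeasure (distr (measure_conv \<mu> \<nu>) borel f) A = (\<integral>\<^sup>+z. indicator A (f z) \<partial>measure_conv \<mu> \<nu>)"
    by (subst emeasure_distr_nn_integral) auto
  also have "\<dots> = (\<integral>\<^sup>+x. \<integral>\<^sup>+y. indicator A (f x + f y) \<partial>\<nu> \<partial>\<mu>)"
    by (simp add: nn_integral_conv[OF \<mu> \<nu>] add)
  also have "\<dots> = emeasure (measure_conv (distr \<mu> borel f) (distr \<nu> borel f)) A"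
    by (simp add: emeasure_conv[OF bp A] nn_integral_distr)
  finally show "emeasure (distr (measure_conv \<mu> \<nu>) borel f) A
    = emeasure (measure_conv (distr \<mu> borel f) (distr \<nu> borel f)) A" .
qed

lemma measurable_blinfun_apply [measurable]:
  "blinfun_apply T \<in> borel_measurable borel"
  by (intro borel_measurable_continuous_onI linear_continuous_on blinfun.bounded_linear_right)

lemma distr_blinfun_conv:
  "borel_prob \<mu> \<Longrightarrow> borel_prob \<nu> \<Longrightarrow>
   distr (measure_conv \<mu> \<nu>) borel (blinfun_apply T)
   = measure_conv (distr \<mu> borel (blinfun_apply T)) (distr \<nu> borel (blinfun_apply T))"
  by (rule distr_conv_additive[OF _ _ measurable_blinfun_apply blinfun.add_right])

lemma borel_prob_distr_borel:
  assumes "borel_prob \<mu>" "f \<in> borel_measurable borel"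
  shows "borel_prob (distr \<mu> borel f)"
  by (rule borel_prob_distr[OF borel_probD(1)[OF assms(1)] measurable_borel_prob[OF assms]])

section \<open>Uniform boundedness and idempotent measures\<close>

text \<open>Baire category: the closed sets \<open>E n\<close> on which the family is bounded by
  \<open>n\<close> cover the space, so one of them contains a ball, and boundedness on a ball
  rescales to all vectors.\<close>

lemma uniform_boundedness:
  fixes F :: "('a::banach \<Rightarrow>\<^sub>L 'b::real_normed_vector) set"
  assumes "\<And>x. \<exists>C. \<forall>T\<in>F. norm (blinfun_apply T x) \<le> C"
  obtains B where "\<And>T. T \<in> F \<Longrightarrow> norm T \<le> B"
proof -
  define E where "E n = {x. \<forall>T\<in>F. norm (blinfun_apply T x) \<le> real n}" for n :: nat
  have closed: "closed (E n)" for n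
  proof -
    have "E n = (\<Inter>T\<in>F. {x. norm (blinfun_apply T x) \<le> real n})" by (auto simp: E_def)
    also have "closed \<dots>"
      by (intro closed_INT ballI closed_Collect_le continuous_intros)
    finally show ?thesis .
  qed
  have "\<exists>n. x \<in> E n" for x
  proof -
    obtain C where "\<forall>T\<in>F. norm (blinfun_apply T x) \<le> C" using assms by blast
    moreover obtain n :: nat where "C \<le> real n" using real_arch_simple by blast
    ultimately have "x \<in> E n" unfolding E_def using order_trans by blast
    then show ?thesis ..
  qed
  then have UN: "\<Union>(range E) = UNIV" by blast
  have "\<exists>n. interior (E n) \<noteq> {}"
  proof (rule ccontr)
    assume "\<not> ?thesis"
    then have "(euclidean :: 'a topology) interior_of \<Union>(range E) = {}"
      using closed
      by (intro Baire_category_alt) (auto simp: completely_metrizable_space_euclidean)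
    then show False unfolding UN by simp
  qed
  then obtain n x where "x \<in> interior (E n)" by blast
  then obtain r where r: "0 < r" "ball x r \<subseteq> E n" by (auto simp: mem_interior)
  \<comment> \<open>A vector \<open>z\<close> of norm \<open>r / 2\<close> is a difference of two
    points of \<open>E n\<close>, so its image has norm at most \<open>2 * n\<close>; rescaling by
    \<open>2 / r\<close> gives the factor 4.\<close>
  have "norm T \<le> 4 * real n / r" if T: "T \<in> F" for T
  proof (rule norm_blinfun_bound)
    show "0 \<le> 4 * real n / r" using r by simp
    fix y
    show "norm (blinfun_apply T y) \<le> 4 * real n / r * norm y"
    proof (cases "y = 0")
      case False
      define z where "z = (r / (2 * norm y)) *\<^sub>R y"
      have "norm z = r / 2" using False r by (simp add: z_def)
      then have "x + z \<in> E n" "x \<in> E n" using r by (auto simp: subset_eq dist_norm)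
      then have *: "norm (blinfun_apply T (x + z)) \<le> real n" "norm (blinfun_apply T x) \<le> real n"
        using T by (auto simp: E_def)
      have "norm (blinfun_apply T z) \<le> 2 * real n"
        using * norm_triangle_ineq4[of "blinfun_apply T (x + z)" "blinfun_apply T x"]
        by (simp add: blinfun.add_right)
      then have "r / (2 * norm y) * norm (blinfun_apply T y) \<le> 2 * real n"
        using r by (simp add: z_def blinfun.scaleR_right)
      then show ?thesis using False r by (simp add: field_simps)
    qed simp
  qed
  then show ?thesis by (rule that)
qed

lemma C0_semigroup_bounded:
  fixes T :: "real \<Rightarrow> 'a::banach \<Rightarrow>\<^sub>L 'a"
  assumes "C0_semigroup T"
  obtains B where "0 < B" "\<And>t. 0 \<le> t \<Longrightarrow> t \<le> K \<Longrightarrow> norm (T t) \<le> B"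
proof -
  have "\<exists>C. \<forall>S\<in>T ` {0..K}. norm (blinfun_apply S x) \<le> C" for x
  proof -
    have "continuous_on {0..K} (\<lambda>t. blinfun_apply (T t) x)"
      using assms by (auto simp: C0_semigroup_def intro: continuous_on_subset)
    then have "compact ((\<lambda>t. blinfun_apply (T t) x) ` {0..K})"
      by (rule compact_continuous_image) simp
    then show ?thesis by (auto dest!: compact_imp_bounded simp: bounded_iff)
  qed
  then obtain B where "\<And>S. S \<in> T ` {0..K} \<Longrightarrow> norm S \<le> B" by (rule uniform_boundedness) blast
  \<comment> \<open>The maximum with 1 makes the bound positive, since it later serves as a
    divisor.\<close>
  then show ?thesis by (intro that[of "max B 1"]) (auto simp: le_max_iff_disj)
qed

section \<open>Idempotent laws and convergence to the point mass at 0\<close>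

text \<open>Countability is the point: statements that hold almost everywhere for each generating
  set merge into one almost sure statement about the whole measure.\<close>

lemma borel_countable_Int_stable_generator:
  obtains C :: "'a::second_countable_topology set set" where
    "countable C" "Int_stable C" "UNIV \<in> C" "sets borel = sigma_sets UNIV C"
proof -
  obtain B :: "'a set set" where B: "countable B" "topological_basis B"
    using ex_countable_basis by blast
  define C where "C = Inter ` {F. F \<subseteq> B \<and> finite F}"
  have borel: "sets borel = sigma_sets UNIV B"
    unfolding borel_eq_countable_basis[OF B] by (rule sets_measure_of) simp
  show ?thesis
  proof
    show "countable C"
      unfolding C_def using countable_Collect_finite_subset[OF B(1)] by (auto simp: conj_commute)
    show "Int_stable C"
    proof (rule Int_stableI)
      fix a b assume "a \<in> C" "b \<in> C"
      then obtain F G where "a = \<Inter>F" "F \<subseteq> B" "finite F" "b = \<Inter>G" "G \<subseteq> B" "finite G"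
        by (auto simp: C_def)
      then have "a \<inter> b = \<Inter>(F \<union> G)" "F \<union> G \<in> {F. F \<subseteq> B \<and> finite F}" by auto
      then show "a \<inter> b \<in> C" unfolding C_def by blast
    qed
    show "UNIV \<in> C" unfolding C_def by (rule image_eqI[of _ _ "{}"]) auto
    show "sets borel = sigma_sets UNIV C"
    proof
      have "B \<subseteq> C" unfolding C_def by (auto intro!: image_eqI[of _ _ "{_}"])
      then show "sets borel \<subseteq> sigma_sets UNIV C"
        unfolding borel by (rule sigma_sets_mono')
      have "C \<subseteq> sets borel"
      proof
        fix a assume "a \<in> C"
        then obtain F where "a = \<Inter>F" "F \<subseteq> B" "finite F" by (auto simp: C_def)
        then show "a \<in> sets borel"
          using B(2) by (auto simp: subset_eq topological_basis_open intro!: borel_open open_Inter)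
      qed
      then show "sigma_sets UNIV C \<subseteq> sets borel"
        using sets.sigma_sets_subset[of C borel] by simp
    qed
  qed
qed

lemma borel_prob_eq_on_generator:
  assumes "borel_prob \<mu>" "borel_prob \<nu>" "Int_stable C" "UNIV \<in> C" "sets borel = sigma_sets UNIV C"
    and "\<And>A. A \<in> C \<Longrightarrow> measure \<mu> A = measure \<nu> A"
  shows "\<mu> = \<nu>"
proof -
  interpret \<mu>: prob_space \<mu> using assms(1) by (rule borel_probD)
  interpret \<nu>: prob_space \<nu> using assms(2) by (rule borel_probD)
  show ?thesis
    by (rule measure_eqI_generator_eq[of C UNIV, where A="\<lambda>_. UNIV"])
      (use assms in \<open>auto simp: borel_probD \<mu>.emeasure_eq_measure \<nu>.emeasure_eq_measure\<close>)
qed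

lemma integral_conv_idempotent:
  fixes f :: "'a::{banach, second_countable_topology} \<Rightarrow> real"
  assumes "borel_prob \<mu>" "measure_conv \<mu> \<mu> = \<mu>" "f \<in> borel_measurable borel" "\<And>x. \<bar>f x\<bar> \<le> C"
  shows "(\<integral>x. f x \<partial>\<mu>) = (\<integral>x. (\<integral>y. f (x + y) \<partial>\<mu>) \<partial>\<mu>)"
  using integral_conv[OF assms(1,1,3,4)] assms(2) by simp

text \<open>\<open>g x\<close> is the mass of \<open>A - x\<close>. Idempotency makes \<open>g\<close> harmonic for the random walk with step law
  \<open>\<mu>\<close>, whose invariant law is \<open>\<mu>\<close> itself; hence the mean square increment of \<open>g\<close> vanishes.\<close>

lemma conv_idempotent_AE_shift:
  fixes \<mu> :: "'a::{banach, second_countable_topology} measure"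
  assumes \<mu>: "borel_prob \<mu>" and idem: "measure_conv \<mu> \<mu> = \<mu>" and A: "A \<in> sets borel"
  defines "g \<equiv> \<lambda>x. \<integral>z. indicat_real A (x + z) \<partial>\<mu>"
  shows "AE x in \<mu>. AE y in \<mu>. g (x + y) = g x"
proof -
  interpret \<mu>: prob_space \<mu> using \<mu> by (rule borel_probD)
  note [measurable_cong] = borel_probD(2)[OF \<mu>]
  note [measurable] = A
  have g_meas[measurable]: "g \<in> borel_measurable borel"
    unfolding g_def by (intro \<mu>.borel_measurable_lebesgue_integral) measurable
  have g_bound: "\<bar>g x\<bar> \<le> 1" for x
  proof -
    have "\<bar>g x\<bar> \<le> (\<integral>z. \<bar>indicat_real A (x + z)\<bar> \<partial>\<mu>)" unfolding g_def by (rule integral_abs_bound)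
    also have "\<dots> \<le> (\<integral>z. 1 \<partial>\<mu>)"
      by (rule integral_mono) (auto intro!: \<mu>.integrable_const_bound[where B=1] simp: indicator_def)
    finally show ?thesis by (simp add: \<mu>.prob_space)
  qed
  have harm: "(\<integral>y. g (x + y) \<partial>\<mu>) = g x" for x
    using integral_conv_idempotent[OF \<mu> idem, of "\<lambda>z. indicator A (x + z)" 1]
    by (simp add: g_def add.assoc indicator_def)
  have g2: "\<bar>(g x)\<^sup>2\<bar> \<le> 1" for x
    using power_mono[OF g_bound[of x], of 2] by simp
  have int[simp]: "integrable \<mu> (\<lambda>y. g (x + y))" "integrable \<mu> (\<lambda>y. (g (x + y))\<^sup>2)" "integrable \<mu> (\<lambda>x. (g x)\<^sup>2)" for x
    using g_bound g2 by (auto intro!: \<mu>.integrable_const_bound[where B=1])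
  define J where "J x = (\<integral>y. (g (x + y) - g x)\<^sup>2 \<partial>\<mu>)" for x
  have sq_int: "integrable \<mu> (\<lambda>y. (g (x + y) - g x)\<^sup>2)" for x
  proof -
    have "integrable \<mu> (\<lambda>y. (g (x + y))\<^sup>2 + (g x)\<^sup>2 - 2 * g (x + y) * g x)"
      by simp
    then show ?thesis by (simp add: power2_diff)
  qed
  have J: "J x = (\<integral>y. (g (x + y))\<^sup>2 \<partial>\<mu>) - (g x)\<^sup>2" for x
  proof -
    have "J x = (\<integral>y. (g (x + y))\<^sup>2 + (g x)\<^sup>2 - 2 * g x * g (x + y) \<partial>\<mu>)"
      unfolding J_def by (intro Bochner_Integration.integral_cong) (auto simp: power2_diff)
    also have "\<dots> = (\<integral>y. (g (x + y))\<^sup>2 \<partial>\<mu>) + (g x)\<^sup>2 - 2 * g x * (\<integral>y. g (x + y) \<partial>\<mu>)"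
      by (simp add: \<mu>.prob_space)
    finally show ?thesis by (simp add: harm power2_eq_square)
  qed
  have J_meas[measurable]: "J \<in> borel_measurable borel"
    unfolding J_def by (intro \<mu>.borel_measurable_lebesgue_integral) measurable
  have inner: "\<bar>\<integral>y. (g (x + y))\<^sup>2 \<partial>\<mu>\<bar> \<le> 1" for x
  proof -
    have "\<bar>\<integral>y. (g (x + y))\<^sup>2 \<partial>\<mu>\<bar> \<le> (\<integral>y. \<bar>(g (x + y))\<^sup>2\<bar> \<partial>\<mu>)" by (rule integral_abs_bound)
    also have "\<dots> \<le> (\<integral>z. 1 \<partial>\<mu>)"
      using g2 by (intro integral_mono) auto
    finally show ?thesis by (simp add: \<mu>.prob_space)
  qed
  have int2: "integrable \<mu> (\<lambda>x. \<integral>y. (g (x + y))\<^sup>2 \<partial>\<mu>)"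
  proof (rule \<mu>.integrable_const_bound[where B=1])
    show "(\<lambda>x. \<integral>y. (g (x + y))\<^sup>2 \<partial>\<mu>) \<in> borel_measurable \<mu>"
      by (intro \<mu>.borel_measurable_lebesgue_integral) measurable
  qed (use inner in auto)
  \<comment> \<open>\<open>J\<close> is the variance of one step of \<open>g\<close> along the walk.
    Idempotency, used a second time and now for the square of \<open>g\<close>, makes the integrals
    of its two terms equal.\<close>
  have "(\<integral>x. J x \<partial>\<mu>) = 0"
  proof -
    have "(\<integral>x. J x \<partial>\<mu>) = (\<integral>x. (\<integral>y. (g (x + y))\<^sup>2 \<partial>\<mu>) \<partial>\<mu>) - (\<integral>x. (g x)\<^sup>2 \<partial>\<mu>)"
      unfolding J by (intro Bochner_Integration.integral_diff int2 int)
    also have "(\<integral>x. (\<integral>y. (g (x + y))\<^sup>2 \<partial>\<mu>) \<partial>\<mu>) = (\<integral>x. (g x)\<^sup>2 \<partial>\<mu>)"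
      by (rule integral_conv_idempotent[OF \<mu> idem _ g2, symmetric]) measurable
    finally show ?thesis by simp
  qed
  moreover have "integrable \<mu> J"
    unfolding J[abs_def] by (intro Bochner_Integration.integrable_diff int2 int)
  moreover have "0 \<le> J x" for x unfolding J_def by simp
  ultimately have "AE x in \<mu>. J x = 0"
    by (subst (asm) integral_nonneg_eq_0_iff_AE) auto
  then show ?thesis
  proof eventually_elim
    case (elim x)
    then have "AE y in \<mu>. (g (x + y) - g x)\<^sup>2 = 0"
      unfolding J_def using sq_int by (subst (asm) integral_nonneg_eq_0_iff_AE) auto
    then show ?case by eventually_elim simp
  qed
qed

text \<open>Invariance under \<open>y\<close> gives invariance under all multiples of
  \<open>y\<close>. Some ball around 0 has mass above 1/2; for large \<open>n\<close> its translate
  by \<open>n\<close> times \<open>y\<close> is disjoint from it and has the same mass, which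
  exceeds the total.\<close>

lemma shift_invariant_imp_zero:
  fixes \<mu> :: "'a::{banach, second_countable_topology} measure"
  assumes \<mu>: "borel_prob \<mu>" and shift: "distr \<mu> borel (\<lambda>z. y + z) = \<mu>"
  shows "y = 0"
proof (rule ccontr)
  assume "y \<noteq> 0"
  interpret \<mu>: prob_space \<mu> using \<mu> by (rule borel_probD)
  note [measurable_cong] = borel_probD(2)[OF \<mu>]
  have iter: "distr \<mu> borel (\<lambda>z. real n *\<^sub>R y + z) = \<mu>" for n
  proof (induction n)
    case 0
    show ?case by (simp add: distr_id2 borel_probD(2)[OF \<mu>])
  next
    case (Suc n)
    have "distr \<mu> borel (\<lambda>z. real (Suc n) *\<^sub>R y + z) = distr (distr \<mu> borel (\<lambda>z. real n *\<^sub>R y + z)) borel (\<lambda>z. y + z)"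
      by (subst distr_distr) (auto simp: o_def algebra_simps intro!: distr_cong)
    then show ?case using Suc shift by simp
  qed
  have "(\<lambda>R. \<mu>.prob {z. norm z \<le> real R}) \<longlonglongrightarrow> \<mu>.prob (\<Union>R. {z. norm z \<le> real R})"
    by (rule \<mu>.finite_Lim_measure_incseq) (auto simp: incseq_def)
  also have "(\<Union>R. {z :: 'a. norm z \<le> real R}) = space \<mu>"
    using real_arch_simple by (auto simp: borel_probD(3)[OF \<mu>])
  finally have "(\<lambda>R. \<mu>.prob {z. norm z \<le> real R}) \<longlonglongrightarrow> 1" by (simp add: \<mu>.prob_space)
  then have "eventually (\<lambda>R. 1 / 2 < \<mu>.prob {z. norm z \<le> real R}) sequentially"
    by (rule order_tendstoD) simp
  then obtain R :: nat where R: "1 / 2 < \<mu>.prob {z. norm z \<le> real R}"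
    by (auto simp: eventually_sequentially)
  obtain n :: nat where n: "2 * real R < real n * norm y"
    using reals_Archimedean3[of "norm y"] \<open>y \<noteq> 0\<close> by auto
  define D where "D = {z. norm (real n *\<^sub>R y + z) \<le> real R}"
  have D[measurable]: "D \<in> sets borel" unfolding D_def by measurable
  have "\<mu>.prob {z. norm z \<le> real R} = measure (distr \<mu> borel (\<lambda>z. real n *\<^sub>R y + z)) {z. norm z \<le> real R}"
    unfolding iter ..
  also have "\<dots> = \<mu>.prob D"
    unfolding D_def by (subst measure_distr) (auto simp: borel_probD(3)[OF \<mu>] vimage_def)
  finally have "1 / 2 < \<mu>.prob D" using R by simp
  moreover have "{z. norm z \<le> real R} \<inter> D = {}"
  proof safe
    fix z assume "norm z \<le> real R" "z \<in> D"
    then have "norm (real n *\<^sub>R y) \<le> real R + real R"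
      using norm_triangle_ineq4[of "real n *\<^sub>R y + z" z] by (simp add: D_def)
    then show "z \<in> {}" using n by simp
  qed
  then have "\<mu>.prob ({z. norm z \<le> real R} \<union> D) = \<mu>.prob {z. norm z \<le> real R} + \<mu>.prob D"
    by (intro \<mu>.finite_measure_Union) auto
  ultimately show False using R \<mu>.prob_le_1[of "{z. norm z \<le> real R} \<union> D"] by linarith
qed

text \<open>For a suitable fixed \<open>x\<close> and almost every \<open>y\<close>, the translates
  of \<open>\<mu>\<close> by \<open>x + y\<close> and by \<open>x\<close> agree on a countable
  generator, hence everywhere. Undoing the translation by \<open>x\<close> shows that
  \<open>\<mu>\<close> is invariant under almost every \<open>y\<close>, so almost every
  \<open>y\<close> is 0.\<close>

lemma conv_idempotent_eq_return:
  fixes \<mu> :: "'a::{banach, second_countable_topology} measure"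
  assumes \<mu>: "borel_prob \<mu>" and idem: "measure_conv \<mu> \<mu> = \<mu>"
  shows "\<mu> = return borel 0"
proof -
  interpret \<mu>: prob_space \<mu> using \<mu> by (rule borel_probD)
  note [measurable_cong] = borel_probD(2)[OF \<mu>]
  obtain C :: "'a set set" where C: "countable C" "Int_stable C" "UNIV \<in> C" "sets borel = sigma_sets UNIV C"
    by (rule borel_countable_Int_stable_generator)
  have C_borel: "A \<in> sets borel" if "A \<in> C" for A using that C(4) by auto
  have int_eq: "(\<integral>z. indicat_real A (x + z) \<partial>\<mu>) = measure (distr \<mu> borel (\<lambda>z. x + z)) A" if "A \<in> sets borel" for A x
  proof -
    have "(\<integral>z. indicat_real A (x + z) \<partial>\<mu>) = (\<integral>z. indicat_real ((\<lambda>z. x + z) -` A) z \<partial>\<mu>)"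
      by (intro Bochner_Integration.integral_cong) (auto simp: indicator_def)
    also have "\<dots> = \<mu>.prob ((\<lambda>z. x + z) -` A \<inter> space \<mu>)" by simp
    also have "\<dots> = measure (distr \<mu> borel (\<lambda>z. x + z)) A"
      using that by (subst measure_distr) auto
    finally show ?thesis .
  qed
  have "AE x in \<mu>. \<forall>A\<in>C. AE y in \<mu>. measure (distr \<mu> borel (\<lambda>z. x + y + z)) A = measure (distr \<mu> borel (\<lambda>z. x + z)) A"
    using C(1) conv_idempotent_AE_shift[OF \<mu> idem C_borel] C_borel
    by (subst AE_ball_countable) (auto simp: int_eq)
  then obtain x where "\<forall>A\<in>C. AE y in \<mu>. measure (distr \<mu> borel (\<lambda>z. x + y + z)) A = measure (distr \<mu> borel (\<lambda>z. x + z)) A"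
    using \<mu>.AE_const[of False] \<mu>.not_empty eventually_happens'[of "ae_filter \<mu>"] \<mu>.ae_filter_bot by blast
  then have "AE y in \<mu>. \<forall>A\<in>C. measure (distr \<mu> borel (\<lambda>z. x + y + z)) A = measure (distr \<mu> borel (\<lambda>z. x + z)) A"
    using C(1) by (subst AE_ball_countable) auto
  then have AE0: "AE y in \<mu>. y = 0"
  proof eventually_elim
    case (elim y)
    have bp: "borel_prob (distr \<mu> borel (\<lambda>z. v + z))" for v
      using \<mu> by (rule borel_prob_distr_borel) measurable
    have "distr \<mu> borel (\<lambda>z. x + y + z) = distr \<mu> borel (\<lambda>z. x + z)"
      using elim by (intro borel_prob_eq_on_generator[OF bp bp C(2,3,4)]) auto
    then have "distr (distr \<mu> borel (\<lambda>z. x + y + z)) borel (\<lambda>z. z - x) = distr (distr \<mu> borel (\<lambda>z. x + z)) borel (\<lambda>z. z - x)"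
      by simp
    then have "distr \<mu> borel (\<lambda>z. y + z) = distr \<mu> borel (\<lambda>z. z)"
      by (simp add: distr_distr comp_def algebra_simps)
    also have "\<dots> = \<mu>" by (rule distr_id2) (simp add: borel_probD(2)[OF \<mu>])
    finally show ?case by (rule shift_invariant_imp_zero[OF \<mu>])
  qed
  have "\<mu> = distr \<mu> borel (\<lambda>z. z)" by (rule distr_id2[symmetric]) (simp add: borel_probD(2)[OF \<mu>])
  also have "\<dots> = distr \<mu> borel (\<lambda>_. 0)" using AE0 by (intro distr_cong_AE) auto
  also have "\<dots> = return borel 0" by (rule \<mu>.distr_const) simp
  finally show ?thesis .
qed

text \<open>A single test function suffices: \<open>min 1 (norm x / \<epsilon>)\<close> vanishes at
  0 and dominates the indicator of the tail.\<close>

lemma weakly_tendsto_return_0_small: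
  fixes \<rho> :: "real \<Rightarrow> 'a::{banach, second_countable_topology} measure"
  assumes \<rho>: "\<And>t. 0 \<le> t \<Longrightarrow> borel_prob (\<rho> t)" and conv: "weakly_tendsto \<rho> (return borel 0) (at_right 0)"
    and "0 < \<epsilon>" "0 < \<eta>"
  obtains \<delta> where "0 < \<delta>" "\<And>h. 0 < h \<Longrightarrow> h < \<delta> \<Longrightarrow> measure (\<rho> h) {x. \<epsilon> < norm x} \<le> \<eta>"
proof -
  define f :: "'a \<Rightarrow> real" where "f x = min 1 (norm x / \<epsilon>)" for x
  have f: "continuous_on UNIV f" "\<And>x. \<bar>f x\<bar> \<le> 1"
    unfolding f_def using \<open>0 < \<epsilon>\<close> by (auto intro!: continuous_intros)
  have [measurable]: "f \<in> borel_measurable borel" by (rule borel_measurable_continuous_onI) fact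
  have "((\<lambda>h. \<integral>x. f x \<partial>\<rho> h) \<longlongrightarrow> (\<integral>x. f x \<partial>return borel 0)) (at_right 0)"
    using conv f unfolding weakly_tendsto_def by (auto simp: bounded_iff)
  also have "(\<integral>x. f x \<partial>return borel 0) = 0" by (simp add: integral_return f_def)
  finally have "eventually (\<lambda>h. (\<integral>x. f x \<partial>\<rho> h) < \<eta>) (at_right 0)"
    using \<open>0 < \<eta>\<close> by (rule order_tendstoD)
  then obtain \<delta> where \<delta>: "0 < \<delta>" "\<And>h. 0 < h \<Longrightarrow> h < \<delta> \<Longrightarrow> (\<integral>x. f x \<partial>\<rho> h) < \<eta>"
    by (auto simp: eventually_at_right_field)
  have "measure (\<rho> h) {x. \<epsilon> < norm x} \<le> \<eta>" if h: "0 < h" "h < \<delta>" for h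
  proof -
    have bp: "borel_prob (\<rho> h)" using \<rho> h by simp
    interpret prob_space "\<rho> h" using bp by (rule borel_probD)
    note [measurable_cong] = borel_probD(2)[OF bp]
    have "measure (\<rho> h) {x. \<epsilon> < norm x} = (\<integral>x. indicator {x. \<epsilon> < norm x} x \<partial>\<rho> h)"
      by (simp add: borel_probD(3)[OF bp])
    also have "\<dots> \<le> (\<integral>x. f x \<partial>\<rho> h)"
    proof (rule integral_mono)
      show "indicator {x. \<epsilon> < norm x} x \<le> f x" for x
        using \<open>0 < \<epsilon>\<close> by (auto simp: f_def indicator_def)
    qed (use f in \<open>auto intro!: integrable_const_bound[where B=1]\<close>)
    finally show ?thesis using \<delta>(2)[OF h] by simp
  qed
  with \<delta>(1) show ?thesis by (rule that)
qed

section \<open>Kolmogorov extension for complete separable metric spaces\<close>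

text \<open>The library's extension theorem is stated for the class \<open>polish_space\<close>, of which a type variable of
  sort \<open>{banach, second_countable_topology}\<close> is not an instance; a copy of the type is.\<close>

typedef 'a polish_copy = "UNIV :: 'a set" morphisms of_copy to_copy ..

instantiation polish_copy :: (metric_space) metric_space
begin

definition dist_polish_copy :: "'a polish_copy \<Rightarrow> 'a polish_copy \<Rightarrow> real"
  where "dist_polish_copy x y = dist (of_copy x) (of_copy y)"

definition uniformity_polish_copy :: "('a polish_copy \<times> 'a polish_copy) filter" where
  "uniformity_polish_copy = (INF e\<in>{0 <..}. principal {(x, y). dist x y < e})"

definition open_polish_copy :: "'a polish_copy set \<Rightarrow> bool" where
  "open_polish_copy U \<longleftrightarrow> (\<forall>x\<in>U. eventually (\<lambda>(x', y). x' = x \<longrightarrow> y \<in> U) uniformity)"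

instance
proof
  fix x y z :: "'a polish_copy"
  show "dist x y = 0 \<longleftrightarrow> x = y"
    by (simp add: dist_polish_copy_def of_copy_inject)
  show "dist x y \<le> dist x z + dist y z"
    by (simp add: dist_polish_copy_def dist_triangle2)
qed (simp_all add: uniformity_polish_copy_def open_polish_copy_def)

end

lemma continuous_on_of_copy: "continuous_on UNIV (of_copy :: 'a::metric_space polish_copy \<Rightarrow> 'a)"
  unfolding continuous_on_iff by (auto simp: dist_polish_copy_def)

lemma continuous_on_to_copy: "continuous_on UNIV (to_copy :: 'a::metric_space \<Rightarrow> 'a polish_copy)"
  unfolding continuous_on_iff by (auto simp: dist_polish_copy_def to_copy_inverse)

instance polish_copy :: (complete_space) complete_space
proof
  fix X :: "nat \<Rightarrow> 'a polish_copy"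
  assume "Cauchy X"
  then have "Cauchy (\<lambda>n. of_copy (X n))"
    by (simp add: Cauchy_def dist_polish_copy_def)
  then obtain l where "(\<lambda>n. of_copy (X n)) \<longlonglongrightarrow> l"
    using Cauchy_convergent convergent_def by blast
  then have "X \<longlonglongrightarrow> to_copy l"
    by (simp add: lim_sequentially dist_polish_copy_def to_copy_inverse)
  then show "convergent X"
    by (rule convergentI)
qed

instance polish_copy :: ("{metric_space, second_countable_topology}") second_countable_topology
proof
  obtain B :: "'a set set" where B: "countable B" "topological_basis B"
    using ex_countable_basis by blast
  have "topological_basis ((\<lambda>b. of_copy -` b) ` B)"
  proof (rule topological_basisI)
    fix b' :: "'a polish_copy set" assume "b' \<in> (\<lambda>b. of_copy -` b) ` B"
    then show "open b'"
      using B continuous_on_of_copy by (auto simp: topological_basis_open intro!: open_vimage)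
  next
    fix S :: "'a polish_copy set" and x assume S: "open S" "x \<in> S"
    have "open (to_copy -` S)"
      using S continuous_on_to_copy by (auto intro!: open_vimage)
    moreover have "of_copy x \<in> to_copy -` S"
      using S by (simp add: of_copy_inverse)
    ultimately obtain b where b: "b \<in> B" "of_copy x \<in> b" "b \<subseteq> to_copy -` S"
      using B topological_basisE by metis
    have "of_copy -` b \<subseteq> S"
      using b(3) by (auto simp: of_copy_inverse subset_eq)
    then show "\<exists>b'\<in>(\<lambda>b. of_copy -` b) ` B. x \<in> b' \<and> b' \<subseteq> S"
      using b by blast
  qed
  then show "\<exists>B::'a polish_copy set set. countable B \<and> open = generate_topology B"
    using B(1) topological_basis_imp_subbasis by blast
qed

instance polish_copy :: ("{complete_space, second_countable_topology}") polish_space ..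

lemma measurable_of_copy [measurable]:
  "(of_copy :: 'a::{metric_space, second_countable_topology} polish_copy \<Rightarrow> 'a) \<in> borel_measurable borel"
  by (rule borel_measurable_continuous_onI[OF continuous_on_of_copy])

lemma measurable_to_copy [measurable]:
  "(to_copy :: 'a::{metric_space, second_countable_topology} \<Rightarrow> 'a polish_copy) \<in> borel_measurable borel"
  by (rule borel_measurable_continuous_onI[OF continuous_on_to_copy])

text \<open>The family is pushed to the copy by \<open>c\<close>, extended there and pulled back by
  \<open>d\<close>. On extensional functions \<open>d J\<close> undoes \<open>c J\<close>, so the
  prescribed marginals are recovered.\<close>

lemma Kolmogorov_extension:
  fixes P :: "'i set \<Rightarrow> ('i \<Rightarrow> 'a::{complete_space, second_countable_topology}) measure"
  assumes "projective_family I P (\<lambda>_. borel)"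
  obtains M :: "('i \<Rightarrow> 'a) measure" where
    "prob_space M" "sets M = sets (PiM I (\<lambda>_. borel))"
    "\<And>J. finite J \<Longrightarrow> J \<subseteq> I \<Longrightarrow> distr M (PiM J (\<lambda>_. borel)) (\<lambda>\<omega>. restrict \<omega> J) = P J"
proof -
  interpret P: projective_family I P "\<lambda>_. borel" by fact
  define c :: "'i set \<Rightarrow> ('i \<Rightarrow> 'a) \<Rightarrow> 'i \<Rightarrow> 'a polish_copy"
    where "c J \<omega> = (\<lambda>i\<in>J. to_copy (\<omega> i))" for J \<omega>
  define d :: "'i set \<Rightarrow> ('i \<Rightarrow> 'a polish_copy) \<Rightarrow> 'i \<Rightarrow> 'a"
    where "d J \<omega> = (\<lambda>i\<in>J. of_copy (\<omega> i))" for J \<omega>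
  have c[measurable]: "c J \<in> PiM J (\<lambda>_. borel) \<rightarrow>\<^sub>M PiM J (\<lambda>_. borel)" for J
    unfolding c_def by measurable
  have d[measurable]: "d J \<in> PiM J (\<lambda>_. borel) \<rightarrow>\<^sub>M PiM J (\<lambda>_. borel)" for J
    unfolding d_def by measurable
  have dc: "d J (c J \<omega>) = \<omega>" if "\<omega> \<in> space (PiM J (\<lambda>_. borel))" for J \<omega>
    using that by (auto simp: c_def d_def to_copy_inverse space_PiM PiE_def extensional_def fun_eq_iff)
  define P' where "P' J = distr (P J) (PiM J (\<lambda>_. borel)) (c J)" for J
  interpret P': projective_family I P' "\<lambda>_. borel"
  proof (rule projective_family.intro)
    fix J H :: "'i set" assume H: "J \<subseteq> H" "finite H" "H \<subseteq> I"
    then have fJ: "finite J" "J \<subseteq> I" by (auto intro: finite_subset)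
    note [measurable_cong] = P.sets_P[OF H(2,3)] P.sets_P[OF fJ]
    have [measurable]:
      "(\<lambda>\<omega>. restrict \<omega> J) \<in> PiM H (\<lambda>_. borel :: 'a measure) \<rightarrow>\<^sub>M PiM J (\<lambda>_. borel)"
      "(\<lambda>\<omega>. restrict \<omega> J) \<in> PiM H (\<lambda>_. borel :: 'a polish_copy measure) \<rightarrow>\<^sub>M PiM J (\<lambda>_. borel)"
      using H(1) by (auto intro: measurable_restrict_subset)
    have "P' J = distr (distr (P H) (PiM J (\<lambda>_. borel)) (\<lambda>f. restrict f J)) (PiM J (\<lambda>_. borel)) (c J)"
      unfolding P'_def by (subst P.P[OF H]) simp
    also have "\<dots> = distr (P H) (PiM J (\<lambda>_. borel)) (\<lambda>\<omega>. c J (restrict \<omega> J))"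
      using H by (subst distr_distr) (auto simp: comp_def)
    also have "\<dots> = distr (P H) (PiM J (\<lambda>_. borel)) (\<lambda>\<omega>. restrict (c H \<omega>) J)"
      using H by (intro distr_cong) (auto simp: c_def fun_eq_iff)
    also have "\<dots> = distr (P' H) (PiM J (\<lambda>_. borel)) (\<lambda>\<omega>. restrict \<omega> J)"
      unfolding P'_def using H by (subst distr_distr) (auto simp: comp_def)
    finally show "P' J = distr (P' H) (PiM J (\<lambda>_. borel)) (\<lambda>\<omega>. restrict \<omega> J)" .
  next
    fix J assume J: "finite J" "J \<subseteq> I"
    note [measurable_cong] = P.sets_P[OF J]
    show "prob_space (P' J)"
      unfolding P'_def using P.prob_space_P[OF J] by (rule prob_space.prob_space_distr) simp
  qed
  interpret P': polish_projective I P' ..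
  note [measurable_cong] = P'.sets_lim
  define M where "M = distr P'.lim (PiM I (\<lambda>_. borel)) (d I)"
  show ?thesis
  proof
    show "prob_space M"
      unfolding M_def by (rule P'.P.prob_space_distr) simp
    show "sets M = sets (PiM I (\<lambda>_. borel))"
      unfolding M_def by simp
    fix J assume J: "finite J" "J \<subseteq> I"
    note [measurable_cong] = P.sets_P[OF J]
    have [measurable]:
      "(\<lambda>\<omega>. restrict \<omega> J) \<in> PiM I (\<lambda>_. borel :: 'a measure) \<rightarrow>\<^sub>M PiM J (\<lambda>_. borel)"
      "(\<lambda>\<omega>. restrict \<omega> J) \<in> PiM I (\<lambda>_. borel :: 'a polish_copy measure) \<rightarrow>\<^sub>M PiM J (\<lambda>_. borel)"
      using J(2) by (auto intro: measurable_restrict_subset)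
    have lim: "distr P'.lim (PiM J (\<lambda>_. borel)) (\<lambda>\<omega>. restrict \<omega> J) = P' J"
    proof (rule measure_eqI)
      fix A assume "A \<in> sets (distr P'.lim (PiM J (\<lambda>_. borel)) (\<lambda>\<omega>. restrict \<omega> J))"
      then have A: "A \<in> sets (PiM J (\<lambda>_. borel))" by simp
      have "(\<lambda>\<omega>. restrict \<omega> J) -` A \<inter> space P'.lim = prod_emb I (\<lambda>_. borel) J A"
        by (simp add: prod_emb_def P'.space_lim space_PiM)
      then show "emeasure (distr P'.lim (PiM J (\<lambda>_. borel)) (\<lambda>\<omega>. restrict \<omega> J)) A = emeasure (P' J) A"
        using J A by (simp add: emeasure_distr P'.emeasure_lim_emb)
    qed (simp add: P'.sets_P[OF J])
    have "distr M (PiM J (\<lambda>_. borel)) (\<lambda>\<omega>. restrict \<omega> J)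
        = distr P'.lim (PiM J (\<lambda>_. borel)) (\<lambda>\<omega>. restrict (d I \<omega>) J)"
      unfolding M_def using J by (subst distr_distr) (auto simp: comp_def)
    also have "\<dots> = distr P'.lim (PiM J (\<lambda>_. borel)) (\<lambda>\<omega>. d J (restrict \<omega> J))"
      using J by (intro distr_cong) (auto simp: d_def fun_eq_iff)
    also have "\<dots> = distr (P' J) (PiM J (\<lambda>_. borel)) (d J)"
      unfolding lim[symmetric] using J by (subst distr_distr) (auto simp: comp_def)
    also have "\<dots> = distr (P J) (PiM J (\<lambda>_. borel)) (\<lambda>\<omega>. d J (c J \<omega>))"
      unfolding P'_def by (subst distr_distr) (auto simp: comp_def)
    also have "\<dots> = distr (P J) (PiM J (\<lambda>_. borel)) (\<lambda>\<omega>. \<omega>)"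
      using P.space_P[OF J] by (intro distr_cong) (auto simp: dc)
    also have "\<dots> = P J"
      by (rule distr_id2) (simp add: P.sets_P[OF J])
    finally show "distr M (PiM J (\<lambda>_. borel)) (\<lambda>\<omega>. restrict \<omega> J) = P J" .
  qed
qed

section \<open>Weak convergence along a filter\<close>

text \<open>Working along a filter along which all bounded real sequences converge replaces every passage to a
  subsequence below.\<close>

definition limit_filter :: "nat filter \<Rightarrow> bool" where
  "limit_filter U \<longleftrightarrow> U \<noteq> bot \<and> U \<le> sequentially \<and>
     (\<forall>f :: nat \<Rightarrow> real. bounded (range f) \<longrightarrow> (\<exists>l. (f \<longlongrightarrow> l) U))"

text \<open>Tychonoff's theorem: the point \<open>p n\<close> collects the \<open>n\<close>-th terms
  of all bounded sequences and lies in a compact product of intervals. For a cluster point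
  \<open>x\<close> of these points, \<open>U\<close> is the filter of indices along which
  \<open>p\<close> tends to \<open>x\<close>, and the coordinate \<open>x f\<close> is the limit of
  \<open>f\<close>. Unbounded sequences are replaced by 0 so that every coordinate has a
  bound.\<close>

lemma limit_filter_exists: "\<exists>U. limit_filter U"
proof -
  define g :: "(nat \<Rightarrow> real) \<Rightarrow> nat \<Rightarrow> real" where "g f n = (if bounded (range f) then f n else 0)" for f n
  have "\<exists>C. \<forall>n. \<bar>g f n\<bar> \<le> C" for f
  proof (cases "bounded (range f)")
    case True
    then show ?thesis by (auto simp: g_def bounded_iff)
  next
    case False
    then have "\<forall>n. \<bar>g f n\<bar> \<le> 0" by (simp add: g_def)
    then show ?thesis ..
  qed
  then obtain C where C: "\<And>f n. \<bar>g f n\<bar> \<le> C f" by metis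
  define p where "p n = (\<lambda>f. g f n)" for n
  define K where "K = PiE UNIV (\<lambda>f. {- C f..C f})"
  have "compactin (product_topology (\<lambda>_. euclidean) UNIV) K"
    unfolding K_def compactin_PiE by auto
  then have "compact K" by (simp add: euclidean_product_topology)
  moreover have "p n \<in> K" for n
    using C[of _ n] by (auto simp: p_def K_def abs_le_iff) (metis minus_le_iff)
  then have "eventually (\<lambda>x. x \<in> K) (filtermap p sequentially)"
    by (simp add: eventually_filtermap)
  moreover have "filtermap p sequentially \<noteq> bot" by (simp add: filtermap_bot_iff)
  ultimately obtain x where x: "inf (nhds x) (filtermap p sequentially) \<noteq> bot"
    unfolding compact_filter by blast
  define U where "U = inf sequentially (filtercomap p (nhds x))"
  have "U \<noteq> bot"
  proof
    assume "U = bot"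
    then have "eventually (\<lambda>_. False) U" by simp
    then obtain P Q where P: "eventually P sequentially" and Q: "eventually Q (nhds x)"
      and PQ: "\<And>n. P n \<Longrightarrow> Q (p n) \<Longrightarrow> False"
      unfolding U_def eventually_inf eventually_filtercomap by blast
    have "eventually (\<lambda>y. \<not> Q y) (filtermap p sequentially)"
      unfolding eventually_filtermap using P by eventually_elim (use PQ in auto)
    with Q have "eventually (\<lambda>_. False) (inf (nhds x) (filtermap p sequentially))"
      unfolding eventually_inf by blast
    with x show False by (simp add: trivial_limit_def)
  qed
  moreover have "(f \<longlongrightarrow> x f) U" if "bounded (range f)" for f
  proof -
    have "filterlim p (nhds x) U"
      unfolding U_def filterlim_iff_le_filtercomap by simp
    moreover have "((\<lambda>y. y f) \<longlongrightarrow> x f) (nhds x)"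
    proof (rule topological_tendstoI)
      fix S :: "real set" assume S: "open S" "x f \<in> S"
      have "open ((\<lambda>y :: (nat \<Rightarrow> real) \<Rightarrow> real. y f) -` S)"
        using S(1) continuous_on_product_coordinates by (rule open_vimage)
      then show "eventually (\<lambda>y. y f \<in> S) (nhds x)"
        unfolding eventually_nhds using S(2) by (intro exI[of _ "(\<lambda>y. y f) -` S"]) auto
    qed
    ultimately have "((\<lambda>n. p n f) \<longlongrightarrow> x f) U" by (rule filterlim_compose[rotated])
    then show ?thesis using that by (simp add: p_def g_def)
  qed
  moreover have "U \<le> sequentially" by (simp add: U_def)
  ultimately have "limit_filter U" unfolding limit_filter_def by blast
  then show ?thesis ..
qed

lemma limit_filterD:
  assumes "limit_filter U"
  shows "U \<noteq> bot" "X \<longlonglongrightarrow> l \<Longrightarrow> (X \<longlongrightarrow> l) U"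
    "(\<And>n. \<bar>f n\<bar> \<le> (C::real)) \<Longrightarrow> (f \<longlongrightarrow> Lim U f) U"
proof -
  show U: "U \<noteq> bot" using assms by (simp add: limit_filter_def)
  show "X \<longlonglongrightarrow> l \<Longrightarrow> (X \<longlongrightarrow> l) U"
    using assms filterlim_mono[of X "nhds l" sequentially "nhds l" U] by (simp add: limit_filter_def)
  assume "\<And>n. \<bar>f n\<bar> \<le> C"
  then have "bounded (range f)" by (auto simp: bounded_iff)
  then obtain l where "(f \<longlongrightarrow> l) U" using assms by (auto simp: limit_filter_def)
  then show "(f \<longlongrightarrow> Lim U f) U" using tendsto_Lim[OF U] by metis
qed

section \<open>Bounded Lipschitz test functions\<close>

definition bounded_lipschitz :: "('a::metric_space \<Rightarrow> real) \<Rightarrow> bool" where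
  "bounded_lipschitz f \<longleftrightarrow> (\<exists>C. \<forall>x. \<bar>f x\<bar> \<le> C) \<and> (\<exists>L. \<forall>x y. \<bar>f x - f y\<bar> \<le> L * dist x y)"

lemma bounded_lipschitzE:
  assumes "bounded_lipschitz f"
  obtains C L where "0 < C" "0 < L" "\<And>x. \<bar>f x\<bar> \<le> C" "\<And>x y. \<bar>f x - f y\<bar> \<le> L * dist x y"
proof -
  obtain C L where CL: "\<And>x. \<bar>f x\<bar> \<le> C" "\<And>x y. \<bar>f x - f y\<bar> \<le> L * dist x y"
    using assms by (auto simp: bounded_lipschitz_def)
  show ?thesis
  proof
    show "\<bar>f x\<bar> \<le> max C 1" for x using CL(1)[of x] by simp
    show "\<bar>f x - f y\<bar> \<le> max L 1 * dist x y" for x y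
      using CL(2)[of x y] mult_right_mono[of L "max L 1" "dist x y"] by simp
  qed auto
qed

lemma lipschitz_imp_measurable:
  fixes f :: "'a::metric_space \<Rightarrow> real"
  assumes "\<And>x y. \<bar>f x - f y\<bar> \<le> L * dist x y"
  shows "f \<in> borel_measurable borel"
proof (rule borel_measurable_continuous_onI)
  have L: "\<bar>f x - f y\<bar> \<le> (max L 1) * dist x y" for x y
    using assms[of x y] mult_right_mono[of L "max L 1" "dist x y"] by simp
  show "continuous_on UNIV f"
    unfolding continuous_on_iff
  proof (intro ballI allI impI)
    fix x :: 'a and e :: real assume "0 < e"
    then show "\<exists>d>0. \<forall>x'\<in>UNIV. dist x' x < d \<longrightarrow> dist (f x') (f x) < e"
    proof (intro exI[of _ "e / max L 1"] conjI ballI impI)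
      fix x' assume "dist x' x < e / max L 1"
      then have "max L 1 * dist x' x < e" by (simp add: field_simps)
      then show "dist (f x') (f x) < e" using L[of x' x] by (simp add: dist_real_def)
    qed simp
  qed
qed

lemma bounded_lipschitz_measurable [measurable_dest]:
  "bounded_lipschitz f \<Longrightarrow> f \<in> borel_measurable borel"
  by (auto simp: bounded_lipschitz_def intro: lipschitz_imp_measurable)

text \<open>One family for two purposes: \<open>a = 1\<close> with growing \<open>b\<close>
  approximates the indicator of a closed set, and \<open>a = 2\<close>, \<open>b = 2 / e\<close> is
  a cut-off that equals 1 within \<open>e / 2\<close> of \<open>S\<close> and 0 beyond
  \<open>e\<close>.\<close>

lemma bounded_lipschitz_ramp: "bounded_lipschitz (\<lambda>x. max 0 (min 1 (a - b * infdist x S)))"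
  unfolding bounded_lipschitz_def
proof (intro conjI exI allI)
  fix x y
  show "\<bar>max 0 (min 1 (a - b * infdist x S))\<bar> \<le> 1" by auto
  have "\<bar>max 0 (min 1 (a - b * infdist x S)) - max 0 (min 1 (a - b * infdist y S))\<bar>
      \<le> \<bar>b * infdist x S - b * infdist y S\<bar>" by (auto simp: abs_if max_def min_def)
  also have "\<dots> = \<bar>b\<bar> * \<bar>infdist x S - infdist y S\<bar>" by (simp add: abs_mult right_diff_distrib[symmetric])
  also have "\<dots> \<le> \<bar>b\<bar> * dist x y" by (intro mult_left_mono infdist_triangle_abs) simp
  finally show "\<bar>max 0 (min 1 (a - b * infdist x S)) - max 0 (min 1 (a - b * infdist y S))\<bar> \<le> \<bar>b\<bar> * dist x y" .
qed

text \<open>The integral of a non-integrable function is 0 by convention, so the bound covers that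
  case as well, thanks to \<open>0 \<le> C\<close>.\<close>

lemma (in prob_space) abs_expectation_le:
  fixes f :: "'a \<Rightarrow> real"
  assumes "\<And>x. x \<in> space M \<Longrightarrow> \<bar>f x\<bar> \<le> C" "0 \<le> C"
  shows "\<bar>expectation f\<bar> \<le> C"
proof (cases "integrable M f")
  case True
  have "\<bar>expectation f\<bar> \<le> (\<integral>x. \<bar>f x\<bar> \<partial>M)" by (rule integral_abs_bound)
  also have "\<dots> \<le> (\<integral>x. C \<partial>M)" using True assms by (intro integral_mono) auto
  finally show ?thesis by (simp add: prob_space)
qed (use assms in \<open>simp add: not_integrable_integral_eq\<close>)

lemma (in prob_space)
  assumes "N \<in> events"
  shows integrable_affine_indicator: "integrable M (\<lambda>x. a + b * indicat_real N x)"
    and integral_affine_indicator: "(\<integral>x. a + b * indicat_real N x \<partial>M) = a + b * prob N"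
proof -
  have *: "integrable M (indicat_real N)" using assms by (simp add: emeasure_eq_measure)
  then show "integrable M (\<lambda>x. a + b * indicat_real N x)" by simp
  have "N \<inter> space M = N" using assms sets.sets_into_space by blast
  then show "(\<integral>x. a + b * indicat_real N x \<partial>M) = a + b * prob N" using * by (simp add: prob_space)
qed

text \<open>Ramps converge pointwise to the indicator of a closed set, and closed sets form an
  intersection-stable generator of the Borel sets.\<close>

lemma bounded_lipschitz_eqI:
  fixes \<mu> :: "'a::{banach, second_countable_topology} measure"
  assumes \<mu>: "borel_prob \<mu>" and \<nu>: "borel_prob \<nu>"
    and eq: "\<And>f. bounded_lipschitz f \<Longrightarrow> (\<integral>x. f x \<partial>\<mu>) = (\<integral>x. f x \<partial>\<nu>)"
  shows "\<mu> = \<nu>"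
proof (rule borel_prob_eq_on_generator[OF \<mu> \<nu>, where C="Collect closed"])
  show "sets borel = sigma_sets UNIV (Collect closed :: 'a set set)"
    unfolding borel_eq_closed by (rule sets_measure_of) simp
  fix S :: "'a set" assume "S \<in> Collect closed"
  then have S: "closed S" by simp
  show "measure \<mu> S = measure \<nu> S"
  proof (cases "S = {}")
    \<comment> \<open>\<open>infdist\<close> to the empty set is 0, so the ramps of an empty
      \<open>S\<close> would be constantly 1; that case is left to the end, where both sides are
      0.\<close>
    case False
    define f where "f n x = max 0 (min 1 (1 - real n * infdist x S))" for n x
    have f: "bounded_lipschitz (f n)" for n
      unfolding f_def by (rule bounded_lipschitz_ramp)
    have lim: "(\<lambda>n. f n x) \<longlonglongrightarrow> indicat_real S x" for x
    proof (cases "x \<in> S")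
      case False
      then have "0 < infdist x S"
        using in_closed_iff_infdist_zero[OF S \<open>S \<noteq> {}\<close>] infdist_nonneg[of x S] by (auto simp: less_le)
      then obtain N :: nat where N: "1 < real N * infdist x S" using reals_Archimedean3 by blast
      have "f n x = 0" if "N \<le> n" for n
      proof -
        have "real N * infdist x S \<le> real n * infdist x S"
          using that infdist_nonneg by (intro mult_right_mono) auto
        then show ?thesis using N by (simp add: f_def)
      qed
      then have "eventually (\<lambda>n. f n x = 0) sequentially" by (auto simp: eventually_sequentially)
      then show ?thesis using False by (simp add: tendsto_eventually)
    qed (simp add: f_def)
    have conv: "(\<lambda>n. \<integral>x. f n x \<partial>\<kappa>) \<longlonglongrightarrow> measure \<kappa> S" if \<kappa>: "borel_prob \<kappa>" for \<kappa>
    proof -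
      interpret \<kappa>: prob_space \<kappa> using \<kappa> by (rule borel_probD)
      note [measurable_cong] = borel_probD(2)[OF \<kappa>]
      have [measurable]: "f n \<in> borel_measurable borel" for n using f by (rule bounded_lipschitz_measurable)
      have "(\<lambda>n. \<integral>x. f n x \<partial>\<kappa>) \<longlonglongrightarrow> (\<integral>x. indicat_real S x \<partial>\<kappa>)"
      proof (rule integral_dominated_convergence[where w="\<lambda>_. 1"])
        show "AE x in \<kappa>. (\<lambda>n. f n x) \<longlonglongrightarrow> indicat_real S x" using lim by simp
        show "AE x in \<kappa>. norm (f n x) \<le> 1" for n by (auto simp: f_def)
      qed (use borel_closed[OF S] in auto)
      then show ?thesis by (simp add: borel_probD(3)[OF \<kappa>])
    qed
    show ?thesis using LIMSEQ_unique[OF conv[OF \<mu>]] conv[OF \<nu>] eq[OF f] by simp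
  qed simp
qed (auto simp: Int_stable_def)

section \<open>Weak convergence by bounded Lipschitz functions, and tightness\<close>

definition bl_tendsto :: "('i \<Rightarrow> 'a::metric_space measure) \<Rightarrow> 'a measure \<Rightarrow> 'i filter \<Rightarrow> bool" where
  "bl_tendsto \<mu> \<nu> F \<longleftrightarrow> (\<forall>f. bounded_lipschitz f \<longrightarrow> ((\<lambda>i. \<integral>x. f x \<partial>\<mu> i) \<longlongrightarrow> (\<integral>x. f x \<partial>\<nu>)) F)"

text \<open>Tightness in its total boundedness form, with finite unions of balls in place of compact
  sets. It is asked only eventually along \<open>F\<close>, and one \<open>e\<close> serves as
  radius and as missing mass.\<close>

definition tight_along :: "('i \<Rightarrow> 'a::metric_space measure) \<Rightarrow> 'i filter \<Rightarrow> bool" where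
  "tight_along \<mu> F \<longleftrightarrow> (\<forall>e>0. \<exists>S. finite S \<and> eventually (\<lambda>i. 1 - e \<le> measure (\<mu> i) (\<Union>q\<in>S. ball q e)) F)"

lemma bl_tendsto_unique:
  fixes \<mu> :: "'i \<Rightarrow> 'a::{banach, second_countable_topology} measure"
  assumes "F \<noteq> bot" "borel_prob \<nu>" "borel_prob \<nu>'" "bl_tendsto \<mu> \<nu> F" "bl_tendsto \<mu> \<nu>' F"
  shows "\<nu> = \<nu>'"
  using assms by (intro bounded_lipschitz_eqI) (auto simp: bl_tendsto_def intro: tendsto_unique)

text \<open>Separability: balls of a fixed radius around a dense sequence cover the space, and
  finite subfamilies exhaust the mass.\<close>

lemma borel_prob_finite_balls:
  fixes \<nu> :: "'a::{banach, second_countable_topology} measure"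
  assumes \<nu>: "borel_prob \<nu>" and "0 < r" "0 < e"
  obtains S where "finite S" "1 - e < measure \<nu> (\<Union>q\<in>S. ball q r)"
proof -
  interpret prob_space \<nu> using \<nu> by (rule borel_probD)
  note [measurable_cong] = borel_probD(2)[OF \<nu>]
  obtain D :: "'a set" where D: "countable D" "\<And>X. open X \<Longrightarrow> X \<noteq> {} \<Longrightarrow> \<exists>d\<in>D. d \<in> X"
    using countable_dense_exists by blast
  then have "D \<noteq> {}" using D(2)[of UNIV] by auto
  define A where "A n = (\<Union>q\<in>from_nat_into D ` {..n}. ball q r)" for n
  have "(\<lambda>n. prob (A n)) \<longlonglongrightarrow> prob (\<Union>n. A n)"
    unfolding A_def by (rule finite_Lim_measure_incseq) (force simp: incseq_def borel_probD[OF \<nu>])+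
  also have "(\<Union>n. A n) = space \<nu>"
  proof -
    have "x \<in> (\<Union>n. A n)" for x
    proof -
      obtain d where "d \<in> D" "d \<in> ball x r" using D(2)[of "ball x r"] \<open>0 < r\<close> by auto
      moreover then obtain n where "d = from_nat_into D n" using from_nat_into_surj[OF D(1)] by metis
      ultimately have "x \<in> A n" by (auto simp: A_def dist_commute)
      then show ?thesis by blast
    qed
    then show ?thesis by (auto simp: borel_probD(3)[OF \<nu>])
  qed
  finally have "(\<lambda>n. prob (A n)) \<longlonglongrightarrow> 1" by (simp add: prob_space)
  then have "eventually (\<lambda>n. 1 - e < prob (A n)) sequentially"
    using \<open>0 < e\<close> by (intro order_tendstoD) auto
  then obtain n where "1 - e < prob (A n)" by (auto simp: eventually_sequentially)
  then show ?thesis unfolding A_def by (intro that[of "from_nat_into D ` {..n}"]) auto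
qed

text \<open>Finitely many balls of radius \<open>e / 2\<close> carry almost all of the limit law.
  The cut-off that is 1 on them and 0 off the balls of radius \<open>e\<close> hands this mass on to
  the approximants.\<close>

lemma bl_tendsto_imp_tight:
  fixes \<mu> :: "'i \<Rightarrow> 'a::{banach, second_countable_topology} measure"
  assumes \<mu>: "\<And>i. borel_prob (\<mu> i)" and \<nu>: "borel_prob \<nu>" and conv: "bl_tendsto \<mu> \<nu> F"
  shows "tight_along \<mu> F"
  unfolding tight_along_def
proof (intro allI impI)
  fix e :: real assume "0 < e"
  obtain S where S: "finite S" "1 - e / 2 < measure \<nu> (\<Union>q\<in>S. ball q (e / 2))"
    using borel_prob_finite_balls[OF \<nu>, of "e / 2" "e / 2"] \<open>0 < e\<close> by auto
  show "\<exists>S. finite S \<and> eventually (\<lambda>i. 1 - e \<le> measure (\<mu> i) (\<Union>q\<in>S. ball q e)) F"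
  proof (cases "S = {}")
    case True
    then have "1 - e < 0" using S \<open>0 < e\<close> by simp
    then show ?thesis
      by (intro exI[of _ "{}"]) auto
  next
    case False
    define f where "f x = max 0 (min 1 (2 - 2 / e * infdist x S))" for x
    have f: "bounded_lipschitz f" unfolding f_def by (rule bounded_lipschitz_ramp)
    have [measurable]: "f \<in> borel_measurable borel" using f by (rule bounded_lipschitz_measurable)
    have fb: "\<bar>f x\<bar> \<le> 1" for x by (auto simp: f_def)
    have balls[measurable]: "(\<Union>q\<in>S. ball q r) \<in> sets borel" for r by (intro borel_open open_UN) auto
    have f1: "f x = 1" if x: "x \<in> (\<Union>q\<in>S. ball q (e / 2))" for x
    proof -
      obtain q where "q \<in> S" "dist q x < e / 2" using x by auto
      then have "infdist x S < e / 2" using infdist_le[of q S x] by (simp add: dist_commute)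
      then have "2 / e * infdist x S \<le> 1" using \<open>0 < e\<close> by (simp add: field_simps)
      then show ?thesis by (simp add: f_def)
    qed
    have f0: "x \<in> (\<Union>q\<in>S. ball q e)" if "f x \<noteq> 0" for x
    proof -
      have "infdist x S < e" using that \<open>0 < e\<close> by (auto simp: f_def field_simps max_def min_def split: if_splits)
      then have "Inf (dist x ` S) < e" using False by (simp add: infdist_notempty)
      then obtain q where "q \<in> S" "dist x q < e" using cInf_lessD[of "dist x ` S" e] False by auto
      then show ?thesis by (auto simp: dist_commute)
    qed
    have "1 - e / 2 < (\<integral>x. f x \<partial>\<nu>)"
    proof -
      interpret prob_space \<nu> using \<nu> by (rule borel_probD)
      note [measurable_cong] = borel_probD(2)[OF \<nu>]
      have "measure \<nu> (\<Union>q\<in>S. ball q (e / 2)) = (\<integral>x. indicator (\<Union>q\<in>S. ball q (e / 2)) x \<partial>\<nu>)"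
        by (simp add: borel_probD(3)[OF \<nu>])
      also have "\<dots> \<le> (\<integral>x. f x \<partial>\<nu>)"
      proof (rule integral_mono)
        show "indicator (\<Union>q\<in>S. ball q (e / 2)) x \<le> f x" for x
          using f1[of x] by (auto simp: indicator_def f_def)
      qed (use fb in \<open>auto intro!: integrable_const_bound[where B=1]\<close>)
      finally show ?thesis using S(2) by linarith
    qed
    moreover have "((\<lambda>i. \<integral>x. f x \<partial>\<mu> i) \<longlongrightarrow> (\<integral>x. f x \<partial>\<nu>)) F"
      using conv f by (simp add: bl_tendsto_def)
    ultimately have "eventually (\<lambda>i. 1 - e / 2 < (\<integral>x. f x \<partial>\<mu> i)) F"
      by (intro order_tendstoD)
    then have "eventually (\<lambda>i. 1 - e \<le> measure (\<mu> i) (\<Union>q\<in>S. ball q e)) F"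
    proof eventually_elim
      case (elim i)
      interpret prob_space "\<mu> i" using \<mu> by (rule borel_probD)
      note [measurable_cong] = borel_probD(2)[OF \<mu>]
      have "(\<integral>x. f x \<partial>\<mu> i) \<le> (\<integral>x. indicator (\<Union>q\<in>S. ball q e) x \<partial>\<mu> i)"
      proof (rule integral_mono)
        show "f x \<le> indicator (\<Union>q\<in>S. ball q e) x" for x
          using f0[of x] fb[of x] by (cases "f x = 0") (auto simp: abs_le_iff)
      qed (use fb in \<open>auto intro!: integrable_const_bound[where B=1]\<close>)
      also have "\<dots> = measure (\<mu> i) (\<Union>q\<in>S. ball q e)"
        by (simp add: borel_probD(3)[OF \<mu>])
      finally show ?case using elim \<open>0 < e\<close> by linarith
    qed
    with S(1) show ?thesis by blast
  qed
qed

text \<open>With \<open>g \<kappa> x\<close> for the integral of \<open>f (x + y)\<close> over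
  \<open>\<kappa>\<close>, the integral against the convolution is that of
  \<open>g (\<nu> i)\<close> against \<open>\<mu> i\<close>. The functions
  \<open>g (\<nu> i)\<close> converge pointwise and share one Lipschitz constant, so they converge
  almost uniformly on finitely many small balls, which carry nearly all of \<open>\<mu> i\<close> by
  tightness.\<close>

lemma bl_tendsto_conv:
  fixes \<mu> \<nu> :: "'i \<Rightarrow> 'a::{banach, second_countable_topology} measure"
  assumes \<mu>: "\<And>i. borel_prob (\<mu> i)" "borel_prob \<mu>'" "bl_tendsto \<mu> \<mu>' F"
    and \<nu>: "\<And>i. borel_prob (\<nu> i)" "borel_prob \<nu>'" "bl_tendsto \<nu> \<nu>' F"
  shows "bl_tendsto (\<lambda>i. measure_conv (\<mu> i) (\<nu> i)) (measure_conv \<mu>' \<nu>') F"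
  unfolding bl_tendsto_def
proof (intro allI impI)
  fix f :: "'a \<Rightarrow> real" assume f: "bounded_lipschitz f"
  obtain C L where C: "0 < C" "0 < L" "\<And>x. \<bar>f x\<bar> \<le> C" "\<And>x y. \<bar>f x - f y\<bar> \<le> L * dist x y"
    using bounded_lipschitzE[OF f] by metis
  have fm[measurable]: "f \<in> borel_measurable borel" using f by (rule bounded_lipschitz_measurable)
  define g where "g \<kappa> x = (\<integral>y. f (x + y) \<partial>\<kappa>)" for \<kappa> x
  have g_diff: "\<bar>g \<kappa> x - g \<kappa> x'\<bar> \<le> L * dist x x'" and g_bound: "\<bar>g \<kappa> x\<bar> \<le> C" if \<kappa>: "borel_prob \<kappa>" for \<kappa> x x'
  proof -
    interpret prob_space \<kappa> using \<kappa> by (rule borel_probD)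
    note [measurable_cong] = borel_probD(2)[OF \<kappa>]
    have int: "integrable \<kappa> (\<lambda>y. f (x + y))" for x
      using C(3) by (intro integrable_const_bound[where B=C]) auto
    have "g \<kappa> x - g \<kappa> x' = (\<integral>y. f (x + y) - f (x' + y) \<partial>\<kappa>)"
      unfolding g_def using int by simp
    also have "\<bar>\<dots>\<bar> \<le> L * dist x x'"
    proof (rule abs_expectation_le)
      show "\<bar>f (x + y) - f (x' + y)\<bar> \<le> L * dist x x'" for y
        using C(4)[of "x + y" "x' + y"] by (simp add: dist_norm)
    qed (use C in simp)
    finally show "\<bar>g \<kappa> x - g \<kappa> x'\<bar> \<le> L * dist x x'" .
    show "\<bar>g \<kappa> x\<bar> \<le> C"
      unfolding g_def using C by (intro abs_expectation_le) auto
  qed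
  have g_bl: "bounded_lipschitz (g \<kappa>)" if "borel_prob \<kappa>" for \<kappa>
    unfolding bounded_lipschitz_def using g_diff[OF that] g_bound[OF that] by blast
  have pointwise: "((\<lambda>i. g (\<nu> i) x) \<longlongrightarrow> g \<nu>' x) F" for x
  proof -
    have "bounded_lipschitz (\<lambda>y. f (x + y))"
      unfolding bounded_lipschitz_def
    proof (intro conjI exI allI)
      show "\<bar>f (x + y)\<bar> \<le> C" for y by (rule C)
      show "\<bar>f (x + y) - f (x + z)\<bar> \<le> L * dist y z" for y z
        using C(4)[of "x + y" "x + z"] by (simp add: dist_norm)
    qed
    then show ?thesis using \<nu>(3) by (simp add: bl_tendsto_def g_def)
  qed
  have "((\<lambda>i. (\<integral>x. g (\<nu> i) x \<partial>\<mu> i) - (\<integral>x. g \<nu>' x \<partial>\<mu> i)) \<longlongrightarrow> 0) F"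
  proof (rule tendstoI)
    fix e :: real assume e: "0 < e"
    \<comment> \<open>The error is at most \<open>2 * L * r\<close> for moving to a centre in both
      functions, \<open>r\<close> for the difference at the centre, and \<open>2 * C * r\<close> off
      the balls.\<close>
    define r where "r = e / (4 * L + 4 * C + 4)"
    have r: "0 < r" "2 * L * r + 2 * C * r + r < e"
    proof -
      show "0 < r" using e C by (simp add: r_def)
      have "(4 * L + 4 * C + 4) * r = e" using C by (simp add: r_def field_simps)
      moreover have "0 < L * r" "0 < C * r" using C \<open>0 < r\<close> by auto
      ultimately show "2 * L * r + 2 * C * r + r < e" using \<open>0 < r\<close> by (simp add: algebra_simps)
    qed
    obtain S where S: "finite S" "eventually (\<lambda>i. 1 - r \<le> measure (\<mu> i) (\<Union>q\<in>S. ball q r)) F"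
      using bl_tendsto_imp_tight[OF \<mu>] r(1) unfolding tight_along_def by blast
    have "eventually (\<lambda>i. \<forall>q\<in>S. dist (g (\<nu> i) q) (g \<nu>' q) < r) F"
      using S(1) r(1) tendstoD[OF pointwise] by (intro eventually_ball_finite) auto
    with S(2) show "eventually (\<lambda>i. dist ((\<integral>x. g (\<nu> i) x \<partial>\<mu> i) - (\<integral>x. g \<nu>' x \<partial>\<mu> i)) 0 < e) F"
    proof eventually_elim
      case (elim i)
      interpret prob_space "\<mu> i" using \<mu>(1) by (rule borel_probD)
      note [measurable_cong] = borel_probD(2)[OF \<mu>(1)]
      let ?A = "\<Union>q\<in>S. ball q r"
      have [measurable]: "g (\<nu> i) \<in> borel_measurable borel" "g \<nu>' \<in> borel_measurable borel"
        using g_bl \<nu> by (auto intro: bounded_lipschitz_measurable)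
      have A[measurable]: "?A \<in> sets borel" by (intro borel_open open_UN) auto
      have A': "- ?A \<in> events" unfolding borel_probD(2)[OF \<mu>(1)] by (intro borel_comp A)
      have int: "integrable (\<mu> i) (g (\<nu> i))" "integrable (\<mu> i) (g \<nu>')"
        using g_bound \<nu> by (auto intro!: integrable_const_bound[where B=C])
      have point: "\<bar>g (\<nu> i) x - g \<nu>' x\<bar> \<le> (2 * L * r + r) + 2 * C * indicator (- ?A) x" for x
      proof (cases "x \<in> ?A")
        case True
        then obtain q where q: "q \<in> S" "dist x q < r" by (auto simp: dist_commute)
        have "L * dist x q \<le> L * r" using C(2) q(2) by (intro mult_left_mono) auto
        then have "\<bar>g (\<nu> i) x - g (\<nu> i) q\<bar> \<le> L * r" "\<bar>g \<nu>' x - g \<nu>' q\<bar> \<le> L * r"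
          using g_diff[OF \<nu>(1), of i x q] g_diff[OF \<nu>(2), of x q] by auto
        moreover have "\<bar>g (\<nu> i) q - g \<nu>' q\<bar> < r" using elim(2) q(1) by (auto simp: dist_real_def)
        ultimately show ?thesis using True by simp
      next
        case False
        have "0 \<le> 2 * L * r + r" using C r by simp
        then show ?thesis using False g_bound[OF \<nu>(1), of i x] g_bound[OF \<nu>(2), of x] by simp
      qed
      have "\<bar>(\<integral>x. g (\<nu> i) x \<partial>\<mu> i) - (\<integral>x. g \<nu>' x \<partial>\<mu> i)\<bar> = \<bar>\<integral>x. g (\<nu> i) x - g \<nu>' x \<partial>\<mu> i\<bar>"
        using int by simp
      also have "\<dots> \<le> (\<integral>x. \<bar>g (\<nu> i) x - g \<nu>' x\<bar> \<partial>\<mu> i)"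
        by (rule integral_abs_bound)
      also have "\<dots> \<le> (\<integral>x. (2 * L * r + r) + 2 * C * indicator (- ?A) x \<partial>\<mu> i)"
        using int point A' by (intro integral_mono integrable_affine_indicator) auto
      also have "\<dots> = (2 * L * r + r) + 2 * C * prob (- ?A)"
        by (rule integral_affine_indicator[OF A'])
      also have "prob (- ?A) \<le> r"
        using prob_compl[of ?A] elim(1) by (simp add: borel_probD[OF \<mu>(1)] Compl_eq_Diff_UNIV)
      finally show ?case using r(2) C by (simp add: dist_real_def mult_left_mono algebra_simps)
    qed
  qed
  moreover have "((\<lambda>i. \<integral>x. g \<nu>' x \<partial>\<mu> i) \<longlongrightarrow> (\<integral>x. g \<nu>' x \<partial>\<mu>')) F"
    using \<mu>(3) g_bl[OF \<nu>(2)] by (simp add: bl_tendsto_def)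
  ultimately have "((\<lambda>i. \<integral>x. g (\<nu> i) x \<partial>\<mu> i) \<longlongrightarrow> (\<integral>x. g \<nu>' x \<partial>\<mu>')) F"
    using tendsto_add by fastforce
  then show "((\<lambda>i. \<integral>x. f x \<partial>measure_conv (\<mu> i) (\<nu> i)) \<longlongrightarrow> (\<integral>x. f x \<partial>measure_conv \<mu>' \<nu>')) F"
    using integral_conv[OF \<mu>(1) \<nu>(1) fm C(3)] integral_conv[OF \<mu>(2) \<nu>(2) fm C(3)]
    by (simp add: g_def)
qed

text \<open>The operators converge only strongly, but they are equicontinuous: closeness to the
  identity at finitely many centres spreads to within \<open>(\<bar>B\<bar> + 2) * r\<close> on the
  balls of radius \<open>r\<close>, and tightness disposes of the rest.\<close>

lemma bl_tendsto_distr_blinfun: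
  fixes \<mu> :: "'i \<Rightarrow> 'a::{banach, second_countable_topology} measure" and S :: "'i \<Rightarrow> 'a \<Rightarrow>\<^sub>L 'a"
  assumes \<mu>: "\<And>i. borel_prob (\<mu> i)" "borel_prob \<mu>'" "bl_tendsto \<mu> \<mu>' F"
    and S: "\<And>i. norm (S i) \<le> B" "\<And>x. ((\<lambda>i. blinfun_apply (S i) x) \<longlongrightarrow> x) F"
  shows "bl_tendsto (\<lambda>i. distr (\<mu> i) borel (blinfun_apply (S i))) \<mu>' F"
  unfolding bl_tendsto_def
proof (intro allI impI)
  fix f :: "'a \<Rightarrow> real" assume f: "bounded_lipschitz f"
  obtain C L where C: "0 < C" "0 < L" "\<And>x. \<bar>f x\<bar> \<le> C" "\<And>x y. \<bar>f x - f y\<bar> \<le> L * dist x y"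
    using bounded_lipschitzE[OF f] by metis
  have fm[measurable]: "f \<in> borel_measurable borel" using f by (rule bounded_lipschitz_measurable)
  have "((\<lambda>i. (\<integral>x. f (blinfun_apply (S i) x) \<partial>\<mu> i) - (\<integral>x. f x \<partial>\<mu> i)) \<longlongrightarrow> 0) F"
  proof (rule tendstoI)
    fix e :: real assume e: "0 < e"
    define D where "D = L * (\<bar>B\<bar> + 2) + 2 * C"
    have D: "0 < D" using C by (simp add: D_def add_pos_pos mult_pos_pos)
    define r where "r = e / (2 * D)"
    have r: "0 < r" "D * r < e" using e D by (auto simp: r_def)
    obtain Q where Q: "finite Q" "eventually (\<lambda>i. 1 - r \<le> measure (\<mu> i) (\<Union>q\<in>Q. ball q r)) F"
      using bl_tendsto_imp_tight[OF \<mu>] r(1) unfolding tight_along_def by blast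
    have "eventually (\<lambda>i. \<forall>q\<in>Q. dist (blinfun_apply (S i) q) q < r) F"
      using Q(1) r(1) tendstoD[OF S(2)] by (intro eventually_ball_finite) auto
    with Q(2) show "eventually (\<lambda>i. dist ((\<integral>x. f (blinfun_apply (S i) x) \<partial>\<mu> i) - (\<integral>x. f x \<partial>\<mu> i)) 0 < e) F"
    proof eventually_elim
      case (elim i)
      interpret prob_space "\<mu> i" using \<mu>(1) by (rule borel_probD)
      note [measurable_cong] = borel_probD(2)[OF \<mu>(1)]
      let ?A = "\<Union>q\<in>Q. ball q r"
      have A[measurable]: "?A \<in> sets borel" by (intro borel_open open_UN) auto
      have A': "- ?A \<in> events" unfolding borel_probD(2)[OF \<mu>(1)] by (intro borel_comp A)
      have int: "integrable (\<mu> i) (\<lambda>x. f (blinfun_apply (S i) x))" "integrable (\<mu> i) f"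
        using C by (auto intro!: integrable_const_bound[where B=C])
      have point: "\<bar>f (blinfun_apply (S i) x) - f x\<bar> \<le> L * ((\<bar>B\<bar> + 2) * r) + 2 * C * indicator (- ?A) x" for x
      proof (cases "x \<in> ?A")
        case True
        then obtain q where q: "q \<in> Q" "dist x q < r" by (auto simp: dist_commute)
        have "dist (blinfun_apply (S i) x) (blinfun_apply (S i) q) \<le> norm (S i) * dist x q"
          using norm_blinfun[of "S i" "x - q"] by (simp add: dist_norm blinfun.diff_right)
        also have "\<dots> \<le> \<bar>B\<bar> * r" using S(1)[of i] q(2) by (intro mult_mono) auto
        finally have "dist (blinfun_apply (S i) x) x \<le> \<bar>B\<bar> * r + r + r"
          using q elim(2) dist_triangle[of "blinfun_apply (S i) x" x "blinfun_apply (S i) q"]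
            dist_triangle[of "blinfun_apply (S i) q" x q] dist_commute[of x q]
          by fastforce
        then have "L * dist (blinfun_apply (S i) x) x \<le> L * ((\<bar>B\<bar> + 2) * r)"
          using C(2) by (intro mult_left_mono) (auto simp: algebra_simps)
        then show ?thesis using True C(4)[of "blinfun_apply (S i) x" x] by simp
      next
        case False
        have "0 \<le> L * ((\<bar>B\<bar> + 2) * r)" using C r by simp
        then show ?thesis using False C(3)[of x] C(3)[of "blinfun_apply (S i) x"] by simp
      qed
      have "\<bar>(\<integral>x. f (blinfun_apply (S i) x) \<partial>\<mu> i) - (\<integral>x. f x \<partial>\<mu> i)\<bar> = \<bar>\<integral>x. f (blinfun_apply (S i) x) - f x \<partial>\<mu> i\<bar>"
        using int by simp
      also have "\<dots> \<le> (\<integral>x. \<bar>f (blinfun_apply (S i) x) - f x\<bar> \<partial>\<mu> i)"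
        by (rule integral_abs_bound)
      also have "\<dots> \<le> (\<integral>x. L * ((\<bar>B\<bar> + 2) * r) + 2 * C * indicator (- ?A) x \<partial>\<mu> i)"
        using int point A' by (intro integral_mono integrable_affine_indicator) auto
      also have "\<dots> = L * ((\<bar>B\<bar> + 2) * r) + 2 * C * prob (- ?A)"
        by (rule integral_affine_indicator[OF A'])
      also have "prob (- ?A) \<le> r"
        using prob_compl[of ?A] elim(1) by (simp add: borel_probD[OF \<mu>(1)] Compl_eq_Diff_UNIV)
      finally have "\<bar>(\<integral>x. f (blinfun_apply (S i) x) \<partial>\<mu> i) - (\<integral>x. f x \<partial>\<mu> i)\<bar> \<le> D * r"
        using C by (simp add: D_def algebra_simps mult_left_mono)
      then show ?case using r(2) by (simp add: dist_real_def)
    qed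
  qed
  moreover have "((\<lambda>i. \<integral>x. f x \<partial>\<mu> i) \<longlongrightarrow> (\<integral>x. f x \<partial>\<mu>')) F"
    using \<mu>(3) f by (simp add: bl_tendsto_def)
  ultimately have "((\<lambda>i. \<integral>x. f (blinfun_apply (S i) x) \<partial>\<mu> i) \<longlongrightarrow> (\<integral>x. f x \<partial>\<mu>')) F"
    using tendsto_add by fastforce
  moreover have "(\<integral>x. f x \<partial>distr (\<mu> i) borel (blinfun_apply (S i))) = (\<integral>x. f (blinfun_apply (S i) x) \<partial>\<mu> i)" for i
    by (rule integral_distr) (auto intro: measurable_borel_prob[OF \<mu>(1)])
  ultimately show "((\<lambda>i. \<integral>x. f x \<partial>distr (\<mu> i) borel (blinfun_apply (S i))) \<longlongrightarrow> (\<integral>x. f x \<partial>\<mu>')) F"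
    by simp
qed

section \<open>Prokhorov's theorem by integer codes\<close>

lemma eventually_finite_coords:
  fixes c :: "nat \<Rightarrow> 'a \<Rightarrow> nat"
  assumes "finite J" "0 < e" and \<mu>: "\<And>n. prob_space (\<mu> n)"
    and c: "\<And>n k. c k \<in> \<mu> n \<rightarrow>\<^sub>M count_space UNIV"
    and tight: "\<And>k e. 0 < e \<Longrightarrow> \<exists>N. eventually (\<lambda>n. 1 - e \<le> measure (\<mu> n) {x\<in>space (\<mu> n). c k x \<le> N}) F"
  shows "\<exists>N. eventually (\<lambda>n. 1 - e \<le> measure (\<mu> n) {x\<in>space (\<mu> n). \<forall>k\<in>J. c k x \<le> N}) F"
  using assms(1,2)
proof (induction J arbitrary: e)
  case empty
  then show ?case using prob_space.prob_space[OF \<mu>] by simp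
next
  case (insert k J)
  obtain N where N: "eventually (\<lambda>n. 1 - e / 2 \<le> measure (\<mu> n) {x\<in>space (\<mu> n). \<forall>k\<in>J. c k x \<le> N}) F"
    using insert.IH[of "e / 2"] insert.prems by auto
  obtain N' where N': "eventually (\<lambda>n. 1 - e / 2 \<le> measure (\<mu> n) {x\<in>space (\<mu> n). c k x \<le> N'}) F"
    using tight[of "e / 2" k] insert.prems by auto
  from N N' have "eventually (\<lambda>n. 1 - e \<le> measure (\<mu> n) {x\<in>space (\<mu> n). \<forall>j\<in>insert k J. c j x \<le> max N N'}) F"
  proof eventually_elim
    case (elim n)
    interpret prob_space "\<mu> n" by (rule \<mu>)
    note [measurable] = c[of _ n]
    let ?A = "{x\<in>space (\<mu> n). \<forall>k\<in>J. c k x \<le> N}" and ?B = "{x\<in>space (\<mu> n). c k x \<le> N'}"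
    have [measurable]: "?A \<in> events" "?B \<in> events" using insert.hyps by measurable
    have "prob ?A + prob ?B \<le> 1 + prob (?A \<inter> ?B)"
      using finite_measure_Union'[of ?A ?B] finite_measure_Diff'[of ?B ?A] prob_le_1[of "?A \<union> ?B"]
      by (simp add: Int_commute)
    moreover have "prob (?A \<inter> ?B) \<le> prob {x\<in>space (\<mu> n). \<forall>j\<in>insert k J. c j x \<le> max N N'}"
      using insert.hyps by (intro finite_measure_mono) auto
    ultimately show ?case using elim by linarith
  qed
  then show ?case ..
qed

text \<open>The limit of the joint laws of countably many integer coordinates, taken along \<open>U\<close>: finite
  additivity is inherited from the approximants and tightness of the coordinates gives countable additivity.
  The coordinates become real numbers because \<open>nat\<close> is not a metric space type.\<close>

lemma limit_of_integer_coordinates: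
  fixes c :: "nat \<Rightarrow> 'a \<Rightarrow> nat"
  assumes U: "limit_filter U" and \<mu>: "\<And>n. prob_space (\<mu> n)"
    and c: "\<And>n k. c k \<in> \<mu> n \<rightarrow>\<^sub>M count_space UNIV"
    and tight: "\<And>k e. 0 < e \<Longrightarrow> \<exists>N. eventually (\<lambda>n. 1 - e \<le> measure (\<mu> n) {x\<in>space (\<mu> n). c k x \<le> N}) U"
  obtains M :: "(nat \<Rightarrow> real) measure" where "prob_space M" "sets M = sets (PiM UNIV (\<lambda>_. borel))"
    "\<And>J B. finite J \<Longrightarrow> B \<in> sets (PiM J (\<lambda>_. borel)) \<Longrightarrow>
      ((\<lambda>n. measure (\<mu> n) {x\<in>space (\<mu> n). (\<lambda>k\<in>J. real (c k x)) \<in> B}) \<longlongrightarrow>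
        measure M {\<omega>\<in>space M. restrict \<omega> J \<in> B}) U"
proof -
  note U_D = limit_filterD[OF U]
  define p where "p J B n = measure (\<mu> n) {x\<in>space (\<mu> n). (\<lambda>k\<in>J. real (c k x)) \<in> B}" for J B n
  define L where "L J B = Lim U (p J B)" for J B
  have p_bound: "\<bar>p J B n\<bar> \<le> 1" for J B n
    using prob_space.prob_le_1[OF \<mu>] by (simp add: p_def)
  have lim: "(p J B \<longlongrightarrow> L J B) U" for J B
    unfolding L_def by (rule U_D(3)[OF p_bound])
  have L_eqI: "L J B = l" if "(p J B \<longlongrightarrow> l) U" for J B l
    using tendsto_unique[OF U_D(1) lim that] .
  have L_nonneg: "0 \<le> L J B" for J B
    by (rule tendsto_lowerbound[OF lim _ U_D(1)]) (simp add: p_def)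
  have meas_c[measurable]: "(\<lambda>x. \<lambda>k\<in>J. real (c k x)) \<in> \<mu> n \<rightarrow>\<^sub>M PiM J (\<lambda>_. borel)" for J n
    using c[of _ n] by (intro measurable_restrict) measurable
  have events: "{x\<in>space (\<mu> n). (\<lambda>k\<in>J. real (c k x)) \<in> B} \<in> sets (\<mu> n)" if "B \<in> sets (PiM J (\<lambda>_. borel))" for n J B
    using measurable_sets[OF meas_c that, of n] by (simp add: vimage_def Int_def conj_commute)
  define P where "P J = measure_of (space (PiM J (\<lambda>_. borel))) (sets (PiM J (\<lambda>_. borel))) (\<lambda>B. ennreal (L J B))" for J
  have P_sets: "sets (P J) = sets (PiM J (\<lambda>_. borel))" "space (P J) = space (PiM J (\<lambda>_. borel))" for J
    by (simp_all add: P_def)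
  have P_emeasure: "emeasure (P J) B = ennreal (L J B)" if J: "finite J" and B: "B \<in> sets (PiM J (\<lambda>_. borel))" for J B
  proof -
    let ?M = "sets (PiM J (\<lambda>_. borel :: real measure))"
    have pos: "positive ?M (\<lambda>B. ennreal (L J B))"
    proof -
      have "L J {} = 0" by (rule L_eqI) (simp add: p_def[abs_def])
      then show ?thesis by (simp add: positive_def)
    qed
    have add: "additive ?M (\<lambda>B. ennreal (L J B))"
    proof (unfold additive_def, intro ballI impI)
      fix A B assume AB: "A \<in> ?M" "B \<in> ?M" "A \<inter> B = {}"
      have "p J (A \<union> B) n = p J A n + p J B n" for n
      proof -
        interpret prob_space "\<mu> n" by (rule \<mu>)
        have "{x\<in>space (\<mu> n). (\<lambda>k\<in>J. real (c k x)) \<in> A \<union> B}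
          = {x\<in>space (\<mu> n). (\<lambda>k\<in>J. real (c k x)) \<in> A} \<union> {x\<in>space (\<mu> n). (\<lambda>k\<in>J. real (c k x)) \<in> B}" by auto
        then show ?thesis
          unfolding p_def using AB by (simp only:) (rule finite_measure_Union; use events in auto)
      qed
      then have "p J (A \<union> B) = (\<lambda>n. p J A n + p J B n)" by auto
      then have "L J (A \<union> B) = L J A + L J B"
        by (intro L_eqI) (auto intro!: tendsto_add lim)
      then show "ennreal (L J (A \<union> B)) = ennreal (L J A) + ennreal (L J B)"
        using L_nonneg by simp
    qed
    \<comment> \<open>Up to mass \<open>e / 2\<close> the coordinates lie in the finite set
      \<open>K\<close>, uniformly along \<open>U\<close>. A decreasing sequence of sets with empty
      intersection has left \<open>K\<close> after finitely many steps.\<close>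
    have "(\<lambda>i. ennreal (L J (A i))) \<longlonglongrightarrow> 0" if A: "range A \<subseteq> ?M" "decseq A" "(\<Inter>i. A i) = {}" for A
    proof -
      have "(\<lambda>i. L J (A i)) \<longlonglongrightarrow> 0"
      proof (rule LIMSEQ_I)
        fix e :: real assume "0 < e"
        have "0 < e / 2" using \<open>0 < e\<close> by simp
        then have "\<exists>N. eventually (\<lambda>n. 1 - e / 2 \<le> measure (\<mu> n) {x\<in>space (\<mu> n). \<forall>k\<in>J. c k x \<le> N}) U"
          using J \<mu> c tight by (intro eventually_finite_coords)
        then obtain N where N: "eventually (\<lambda>n. 1 - e / 2 \<le> measure (\<mu> n) {x\<in>space (\<mu> n). \<forall>k\<in>J. c k x \<le> N}) U" ..
        define K where "K = PiE J (\<lambda>_. real ` {..N})"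
        have "finite K" unfolding K_def using J by (intro finite_PiE) auto
        have "\<exists>i. \<forall>f\<in>K. f \<notin> A i"
          using \<open>finite K\<close>
        proof (induction K)
          case (insert f K)
          then obtain i where i: "\<forall>f\<in>K. f \<notin> A i" by blast
          obtain j where "f \<notin> A j" using A(3) by blast
          then have "\<forall>g\<in>insert f K. g \<notin> A (max i j)"
            using i decseqD[OF A(2), of i "max i j"] decseqD[OF A(2), of j "max i j"] by auto
          then show ?case ..
        qed simp
        then obtain i where i: "\<forall>f\<in>K. f \<notin> A i" by blast
        have "L J (A m) \<le> e / 2" if "i \<le> m" for m
        proof (rule tendsto_upperbound[OF lim _ U_D(1)])
          from N show "eventually (\<lambda>n. p J (A m) n \<le> e / 2) U"
          proof eventually_elim
            case (elim n)
            interpret prob_space "\<mu> n" by (rule \<mu>)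
            note [measurable] = c[of _ n]
            let ?C = "{x\<in>space (\<mu> n). \<forall>k\<in>J. c k x \<le> N}"
            have C: "?C \<in> events" using J by measurable
            have "{x\<in>space (\<mu> n). (\<lambda>k\<in>J. real (c k x)) \<in> A m} \<subseteq> space (\<mu> n) - ?C"
            proof safe
              fix x assume "(\<lambda>k\<in>J. real (c k x)) \<in> A m" "\<forall>k\<in>J. c k x \<le> N"
              moreover from this have "(\<lambda>k\<in>J. real (c k x)) \<in> K" by (auto simp: K_def)
              ultimately show False using i decseqD[OF A(2) that] by blast
            qed
            then have "p J (A m) n \<le> prob (space (\<mu> n) - ?C)"
              unfolding p_def using C by (intro finite_measure_mono) auto
            then show ?case using prob_compl[OF C] elim by simp
          qed
        qed
        then show "\<exists>i. \<forall>m\<ge>i. norm (L J (A m) - 0) < e"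
          using L_nonneg \<open>0 < e\<close> by (intro exI[of _ i]) fastforce
      qed
      then show ?thesis using tendsto_ennrealI by fastforce
    qed
    then have "countably_additive ?M (\<lambda>B. ennreal (L J B))"
      using pos add by (intro sets.empty_continuous_imp_countably_additive) auto
    then show ?thesis
      unfolding P_def using B pos by (intro emeasure_measure_of_sigma sets.sigma_algebra_axioms) auto
  qed
  have restr: "p J B = p H ((\<lambda>f. restrict f J) -` B \<inter> space (PiM H (\<lambda>_. borel)))" if "J \<subseteq> H" for J H B
    unfolding p_def using that
    by (auto intro!: ext arg_cong[where f="measure _"] simp: space_PiM Int_absorb1 Int_absorb2 cong: conj_cong)
  have "projective_family UNIV P (\<lambda>_. borel)"
  proof (rule projective_family.intro)
    fix J H :: "nat set" assume H: "J \<subseteq> H" "finite H" "H \<subseteq> UNIV"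
    have fJ: "finite J" using H finite_subset by blast
    have [measurable]: "(\<lambda>f. restrict f J) \<in> PiM H (\<lambda>_. borel :: real measure) \<rightarrow>\<^sub>M PiM J (\<lambda>_. borel)"
      using H(1) by (rule measurable_restrict_subset)
    show "P J = distr (P H) (PiM J (\<lambda>_. borel)) (\<lambda>f. restrict f J)"
    proof (rule measure_eqI)
      fix B assume "B \<in> sets (P J)"
      then have B: "B \<in> sets (PiM J (\<lambda>_. borel))" by (simp add: P_sets)
      have "emeasure (distr (P H) (PiM J (\<lambda>_. borel)) (\<lambda>f. restrict f J)) B
          = emeasure (P H) ((\<lambda>f. restrict f J) -` B \<inter> space (PiM H (\<lambda>_. borel)))"
        using B by (subst emeasure_distr) (auto simp: P_sets measurable_cong_sets[OF P_sets(1) refl])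
      also have "\<dots> = ennreal (L H ((\<lambda>f. restrict f J) -` B \<inter> space (PiM H (\<lambda>_. borel))))"
        using B by (intro P_emeasure H measurable_sets[of _ _ "PiM J (\<lambda>_. borel)"]) auto
      also have "\<dots> = emeasure (P J) B"
        using B fJ by (simp add: P_emeasure L_def restr[OF H(1)])
      finally show "emeasure (P J) B = emeasure (distr (P H) (PiM J (\<lambda>_. borel)) (\<lambda>f. restrict f J)) B" ..
    qed (simp add: P_sets)
  next
    fix J :: "nat set" assume J: "finite J"
    show "prob_space (P J)"
    proof
      have "L J (space (PiM J (\<lambda>_. borel))) = 1"
      proof (rule L_eqI)
        have "p J (space (PiM J (\<lambda>_. borel))) = (\<lambda>_. 1)"
          using prob_space.prob_space[OF \<mu>] by (auto simp: p_def space_PiM)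
        then show "(p J (space (PiM J (\<lambda>_. borel))) \<longlongrightarrow> 1) U" by simp
      qed
      then show "emeasure (P J) (space (P J)) = 1"
        using J by (simp add: P_emeasure P_sets)
    qed
  qed
  then show ?thesis
  proof (rule Kolmogorov_extension)
    fix M :: "(nat \<Rightarrow> real) measure"
    assume M: "prob_space M" "sets M = sets (PiM UNIV (\<lambda>_. borel))"
      "\<And>J. finite J \<Longrightarrow> J \<subseteq> UNIV \<Longrightarrow> distr M (PiM J (\<lambda>_. borel)) (\<lambda>\<omega>. restrict \<omega> J) = P J"
    show thesis
    proof (rule that[OF M(1,2)])
      fix J :: "nat set" and B assume J: "finite J" and B: "B \<in> sets (PiM J (\<lambda>_. borel :: real measure))"
      have m: "(\<lambda>\<omega>. restrict \<omega> J) \<in> M \<rightarrow>\<^sub>M PiM J (\<lambda>_. borel)"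
        unfolding measurable_cong_sets[OF M(2) refl] by (rule measurable_restrict_subset) simp
      have "measure M {\<omega>\<in>space M. restrict \<omega> J \<in> B} = measure (P J) B"
        unfolding M(3)[OF J subset_UNIV, symmetric]
        using m B by (subst measure_distr) (auto intro!: arg_cong[where f="measure M"])
      also have "\<dots> = L J B"
        using P_emeasure[OF J B] L_nonneg by (simp add: measure_def)
      finally show "((\<lambda>n. measure (\<mu> n) {x\<in>space (\<mu> n). (\<lambda>k\<in>J. real (c k x)) \<in> B}) \<longlongrightarrow>
        measure M {\<omega>\<in>space M. restrict \<omega> J \<in> B}) U"
        using lim[of J B] by (simp add: p_def[abs_def])
    qed
  qed
qed

text \<open>Up to the tail, the expectation is a finite combination of point probabilities; in this
  way convergence of probabilities along a filter turns into convergence of integrals.\<close>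

lemma (in prob_space) expectation_truncate_to_nat:
  fixes g :: "real \<Rightarrow> real"
  assumes Y[measurable]: "Y \<in> borel_measurable M" and g[measurable]: "g \<in> borel_measurable borel"
    and C: "\<And>x. \<bar>g x\<bar> \<le> C"
  shows "\<bar>(\<integral>x. g (Y x) \<partial>M) - (\<Sum>i\<le>N. g (real i) * prob {x\<in>space M. Y x = real i})\<bar>
    \<le> C * (1 - prob {x\<in>space M. Y x \<in> real ` {..N}})"
proof -
  have C0: "0 \<le> C" using C[of 0] by linarith
  let ?K = "{x\<in>space M. Y x \<in> real ` {..N}}"
  have K[measurable]: "?K \<in> events"
    using measurable_sets[OF Y, of "real ` {..N}"] by (simp add: vimage_def Int_def conj_commute finite_imp_closed)
  have point: "(\<Sum>i\<le>N. g (real i) * indicator {x\<in>space M. Y x = real i} x) = g (Y x) * indicator ?K x"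
    if x: "x \<in> space M" for x
  proof (cases "x \<in> ?K")
    case True
    then obtain j where j: "j \<le> N" "Y x = real j" by auto
    have "(\<Sum>i\<le>N. g (real i) * indicator {x\<in>space M. Y x = real i} x) = (\<Sum>i\<le>N. if i = j then g (real j) else 0)"
      using j x by (intro sum.cong) (auto simp: indicator_def)
    then show ?thesis using j x True by simp
  next
    case False
    then show ?thesis using x by (auto simp: indicator_def intro!: sum.neutral)
  qed
  have int: "integrable M (\<lambda>x. g (Y x))" "integrable M (\<lambda>x. g (Y x) * indicator ?K x)"
    using C C0 by (auto intro!: integrable_const_bound[where B=C] simp: indicator_def)
  have "(\<Sum>i\<le>N. g (real i) * prob {x\<in>space M. Y x = real i})
      = (\<integral>x. (\<Sum>i\<le>N. g (real i) * indicator {x\<in>space M. Y x = real i} x) \<partial>M)"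
    by (subst Bochner_Integration.integral_sum) (auto intro!: sum.cong simp: emeasure_eq_measure Int_absorb2 subset_eq)
  also have "\<dots> = (\<integral>x. g (Y x) * indicator ?K x \<partial>M)"
    by (intro Bochner_Integration.integral_cong refl point)
  finally have "(\<integral>x. g (Y x) \<partial>M) - (\<Sum>i\<le>N. g (real i) * prob {x\<in>space M. Y x = real i})
      = (\<integral>x. g (Y x) - g (Y x) * indicator ?K x \<partial>M)"
    using int by simp
  also have "\<bar>\<dots>\<bar> \<le> (\<integral>x. \<bar>g (Y x) - g (Y x) * indicator ?K x\<bar> \<partial>M)"
    by (rule integral_abs_bound)
  also have "\<dots> \<le> (\<integral>x. 0 + C * indicator (space M - ?K) x \<partial>M)"
    using int C C0 by (intro integral_mono integrable_affine_indicator) (auto simp: indicator_def)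
  also have "\<dots> = C * prob (space M - ?K)"
    by (subst integral_affine_indicator) auto
  also have "\<dots> = C * (1 - prob ?K)" by (simp add: prob_compl[OF K])
  finally show ?thesis .
qed

text \<open>The compactness half of Prokhorov's theorem. A point \<open>x\<close> is coded by the
  integers \<open>c k x\<close>, the first index of a dense sequence within distance 2^(-k).
  Tightness of the measures makes each code tight, so the joint laws of the codes have a limit
  \<open>M\<close>. Under \<open>M\<close> the decoded points are almost surely Cauchy, and by
  completeness their limit \<open>X\<close> exists; its law is the limit law.\<close>

lemma tight_imp_bl_tendsto:
  fixes \<mu> :: "nat \<Rightarrow> 'a::{banach, second_countable_topology} measure"
  assumes U: "limit_filter U" and \<mu>: "\<And>n. borel_prob (\<mu> n)" and tight: "tight_along \<mu> U"
  obtains \<alpha> where "borel_prob \<alpha>" "bl_tendsto \<mu> \<alpha> U"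
proof -
  note U_D = limit_filterD[OF U]
  obtain D :: "'a set" where D: "countable D" "\<And>X. open X \<Longrightarrow> X \<noteq> {} \<Longrightarrow> \<exists>d\<in>D. d \<in> X"
    using countable_dense_exists by blast
  define q where "q = from_nat_into D"
  have q: "\<exists>i. dist x (q i) < r" if r: "0 < r" for x r
  proof -
    obtain d where "d \<in> D" "d \<in> ball x r" using D(2)[of "ball x r"] r by auto
    moreover then obtain i where "d = q i" unfolding q_def using from_nat_into_surj[OF D(1)] by metis
    ultimately show ?thesis by auto
  qed
  define c where "c k x = (LEAST i. dist x (q i) < (1 / 2) ^ k)" for k x
  have c_dist: "dist x (q (c k x)) < (1 / 2) ^ k" for k x
    unfolding c_def using q by (rule LeastI_ex) simp
  have c_borel[measurable]: "c k \<in> borel \<rightarrow>\<^sub>M count_space UNIV" for k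
    unfolding c_def by measurable
  have c_meas: "c k \<in> \<mu> n \<rightarrow>\<^sub>M count_space UNIV" for k n
    using c_borel by (simp add: measurable_cong_sets[OF borel_probD(2)[OF \<mu>] refl])
  have c_real: "(\<lambda>x. real (c k x)) \<in> borel_measurable (\<mu> n)" for k n
    using measurable_compose[OF c_meas[of k n], of real borel] by simp
  have c_tight: "\<exists>N. eventually (\<lambda>n. 1 - e \<le> measure (\<mu> n) {x\<in>space (\<mu> n). c k x \<le> N}) U" if e: "0 < e" for k e
  proof -
    \<comment> \<open>Half of 2^(-k) is spent on the ball around \<open>s\<close>, the other half on
      a dense point near \<open>s\<close>; on the ball the code is then at most the index of that
      dense point.\<close>
    define r where "r = min e ((1 / 2) ^ k / 2)"
    have r: "0 < r" "r \<le> e" "r \<le> (1 / 2) ^ k / 2" using e by (auto simp: r_def)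
    obtain S where S: "finite S" "eventually (\<lambda>n. 1 - r \<le> measure (\<mu> n) (\<Union>s\<in>S. ball s r)) U"
      using tight r(1) unfolding tight_along_def by blast
    have "\<exists>i. dist s (q i) < (1 / 2) ^ k / 2" for s by (rule q) simp
    then obtain i where i: "\<And>s. dist s (q (i s)) < (1 / 2) ^ k / 2" by metis
    define N where "N = Max (insert 0 (i ` S))"
    have "c k x \<le> N" if x: "x \<in> (\<Union>s\<in>S. ball s r)" for x
    proof -
      obtain s where s: "s \<in> S" "dist s x < r" using x by auto
      have "dist x (q (i s)) < (1 / 2) ^ k"
        using dist_triangle[of x "q (i s)" s] i[of s] s(2) r(3) by (simp add: dist_commute)
      then have "c k x \<le> i s" unfolding c_def by (rule Least_le)
      also have "\<dots> \<le> N" unfolding N_def using S(1) s(1) by (intro Max_ge) auto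
      finally show ?thesis .
    qed
    then have sub: "(\<Union>s\<in>S. ball s r) \<subseteq> {x. c k x \<le> N}" by blast
    from S(2) have "eventually (\<lambda>n. 1 - e \<le> measure (\<mu> n) {x\<in>space (\<mu> n). c k x \<le> N}) U"
    proof eventually_elim
      case (elim n)
      interpret prob_space "\<mu> n" using \<mu> by (rule borel_probD)
      note [measurable_cong] = borel_probD(2)[OF \<mu>]
      have "prob (\<Union>s\<in>S. ball s r) \<le> prob {x\<in>space (\<mu> n). c k x \<le> N}"
        using sub by (intro finite_measure_mono) (auto simp: borel_probD(3)[OF \<mu>])
      then show ?case using elim r(2) by linarith
    qed
    then show ?thesis ..
  qed
  show thesis
  proof (rule limit_of_integer_coordinates[OF U borel_probD(1)[OF \<mu>] c_meas c_tight])
    fix M :: "(nat \<Rightarrow> real) measure"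
    assume M: "prob_space M" "sets M = sets (PiM UNIV (\<lambda>_. borel))"
      and lim_M: "\<And>J B. finite J \<Longrightarrow> B \<in> sets (PiM J (\<lambda>_. borel)) \<Longrightarrow>
      ((\<lambda>n. measure (\<mu> n) {x\<in>space (\<mu> n). (\<lambda>k\<in>J. real (c k x)) \<in> B}) \<longlongrightarrow>
        measure M {\<omega>\<in>space M. restrict \<omega> J \<in> B}) U"
    interpret M: prob_space M by fact
    have comp[measurable]: "(\<lambda>\<omega>. \<omega> k) \<in> borel_measurable M" for k
      unfolding measurable_cong_sets[OF M(2) refl] by (rule measurable_component_singleton) simp
    \<comment> \<open>Decoding: the coordinates are integers stored as real numbers, so rounding
      down recovers the index.\<close>
    define Q where "Q r = q (nat \<lfloor>r\<rfloor>)" for r :: real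
    have [measurable]: "Q \<in> borel_measurable borel"
      unfolding Q_def by measurable
    have Q_real: "Q (real i) = q i" for i by (simp add: Q_def)
    have prob_M: "((\<lambda>n. measure (\<mu> n) {x\<in>space (\<mu> n). real (c k x) \<in> A}) \<longlongrightarrow> M.prob {\<omega>\<in>space M. \<omega> k \<in> A}) U"
      if [measurable]: "A \<in> sets borel" for k A
    proof -
      have "{f\<in>space (PiM {k} (\<lambda>_. borel)). f k \<in> A} \<in> sets (PiM {k} (\<lambda>_. borel))" by measurable
      from lim_M[OF _ this] show ?thesis
        by (simp add: space_PiM)
    qed
    \<comment> \<open>The inequality holds surely under every \<open>\<mu> n\<close>, and the
      probabilities of all measurable finite-dimensional events converge along \<open>U\<close>; the
      limit probability is therefore 1.\<close>
    have AE_dist: "AE \<omega> in M. dist (Q (\<omega> k)) (Q (\<omega> l)) \<le> (1 / 2) ^ k + (1 / 2) ^ l" for k l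
    proof -
      let ?B = "{f\<in>space (PiM {k, l} (\<lambda>_. borel)). dist (Q (f k)) (Q (f l)) \<le> (1 / 2) ^ k + (1 / 2) ^ l}"
      have B: "?B \<in> sets (PiM {k, l} (\<lambda>_. borel))" by measurable
      have "{x\<in>space (\<mu> n). (\<lambda>k\<in>{k, l}. real (c k x)) \<in> ?B} = space (\<mu> n)" for n
      proof -
        have "dist (q (c k x)) (q (c l x)) \<le> (1 / 2) ^ k + (1 / 2) ^ l" for x
          using dist_triangle3[of "q (c k x)" "q (c l x)" x] c_dist[of x k] c_dist[of x l] by linarith
        then show ?thesis by (auto simp: space_PiM Q_real)
      qed
      then have "((\<lambda>n. 1) \<longlongrightarrow> M.prob {\<omega>\<in>space M. restrict \<omega> {k, l} \<in> ?B}) U"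
        using lim_M[OF _ B] prob_space.prob_space[OF borel_probD(1)[OF \<mu>]] by simp
      then have "M.prob {\<omega>\<in>space M. restrict \<omega> {k, l} \<in> ?B} = 1"
        using tendsto_unique[OF U_D(1) _ tendsto_const] by blast
      then show ?thesis
        using M.AE_prob_1[of "{\<omega>\<in>space M. restrict \<omega> {k, l} \<in> ?B}"] by auto
    qed
    define X where "X \<omega> = lim (\<lambda>k. Q (\<omega> k))" for \<omega>
    have X_meas[measurable]: "X \<in> borel_measurable M"
      unfolding X_def by measurable
    have "AE \<omega> in M. \<forall>k l. dist (Q (\<omega> k)) (Q (\<omega> l)) \<le> (1 / 2) ^ k + (1 / 2) ^ l"
      using AE_dist by (simp add: AE_all_countable)
    then have AE_X: "AE \<omega> in M. \<forall>k. dist (Q (\<omega> k)) (X \<omega>) \<le> (1 / 2) ^ k"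
    proof eventually_elim
      case (elim \<omega>)
      have pow: "(\<lambda>k. (1 / 2) ^ k :: real) \<longlonglongrightarrow> 0" by (rule LIMSEQ_realpow_zero) auto
      have "Cauchy (\<lambda>k. Q (\<omega> k))"
      proof (rule metric_CauchyI)
        fix e :: real assume "0 < e"
        then have "eventually (\<lambda>k. (1 / 2) ^ k < e / 2) sequentially"
          using pow by (intro order_tendstoD) auto
        then obtain N where N: "\<And>k. N \<le> k \<Longrightarrow> (1 / 2 :: real) ^ k < e / 2" by (auto simp: eventually_sequentially)
        have "dist (Q (\<omega> m)) (Q (\<omega> n)) < e" if "N \<le> m" "N \<le> n" for m n
          using elim[rule_format, of m n] N[OF that(1)] N[OF that(2)] by linarith
        then show "\<exists>N. \<forall>m\<ge>N. \<forall>n\<ge>N. dist (Q (\<omega> m)) (Q (\<omega> n)) < e" by blast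
      qed
      then have "(\<lambda>k. Q (\<omega> k)) \<longlonglongrightarrow> X \<omega>"
        unfolding X_def by (simp add: Cauchy_convergent_iff convergent_LIMSEQ_iff)
      then have "(\<lambda>l. dist (Q (\<omega> k)) (Q (\<omega> l))) \<longlonglongrightarrow> dist (Q (\<omega> k)) (X \<omega>)" for k
        by (intro tendsto_intros)
      then have "dist (Q (\<omega> k)) (X \<omega>) \<le> (1 / 2) ^ k + 0" for k
        by (rule LIMSEQ_le[OF _ tendsto_add[OF tendsto_const pow]]) (use elim in auto)
      then show ?case by simp
    qed
    have int_lim: "((\<lambda>n. \<integral>x. g (real (c k x)) \<partial>\<mu> n) \<longlongrightarrow> (\<integral>\<omega>. g (\<omega> k) \<partial>M)) U"
      if g[measurable]: "g \<in> borel_measurable borel" and C: "\<And>x. \<bar>g x\<bar> \<le> C" "0 < C" for g :: "real \<Rightarrow> real" and C k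
    proof (rule tendstoI)
      fix e :: real assume "0 < e"
      \<comment> \<open>Each of three errors gets \<open>e / 4\<close>: the truncation under
        \<open>\<mu> n\<close>, the truncation under \<open>M\<close>, and the difference of the
        finite sums.\<close>
      define d where "d = e / (4 * C)"
      have d: "0 < d" "C * d = e / 4" using \<open>0 < e\<close> C by (auto simp: d_def)
      obtain N where N: "eventually (\<lambda>n. 1 - d \<le> measure (\<mu> n) {x\<in>space (\<mu> n). c k x \<le> N}) U"
        using c_tight[OF d(1)] by blast
      have fin: "real ` {..N} \<in> sets borel" by (intro borel_closed finite_imp_closed) auto
      have c_N: "{x\<in>space (\<mu> n). c k x \<le> N} = {x\<in>space (\<mu> n). real (c k x) \<in> real ` {..N}}" for n
        by auto
      have "1 - d \<le> M.prob {\<omega>\<in>space M. \<omega> k \<in> real ` {..N}}"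
        by (rule tendsto_lowerbound[OF prob_M[OF fin] _ U_D(1)]) (use N in \<open>simp add: c_N\<close>)
      then have M_d: "C * (1 - M.prob {\<omega>\<in>space M. \<omega> k \<in> real ` {..N}}) \<le> C * d"
        using C by (intro mult_left_mono) auto
      have "((\<lambda>n. \<Sum>i\<le>N. g (real i) * measure (\<mu> n) {x\<in>space (\<mu> n). real (c k x) = real i}) \<longlongrightarrow>
          (\<Sum>i\<le>N. g (real i) * M.prob {\<omega>\<in>space M. \<omega> k = real i})) U"
        using prob_M[of "{real _}"] by (intro tendsto_sum tendsto_mult tendsto_const) auto
      then have "eventually (\<lambda>n. dist (\<Sum>i\<le>N. g (real i) * measure (\<mu> n) {x\<in>space (\<mu> n). real (c k x) = real i})
          (\<Sum>i\<le>N. g (real i) * M.prob {\<omega>\<in>space M. \<omega> k = real i}) < e / 4) U"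
        using \<open>0 < e\<close> by (intro tendstoD) auto
      with N show "eventually (\<lambda>n. dist (\<integral>x. g (real (c k x)) \<partial>\<mu> n) (\<integral>\<omega>. g (\<omega> k) \<partial>M) < e) U"
      proof eventually_elim
        case (elim n)
        interpret prob_space "\<mu> n" using \<mu> by (rule borel_probD)
        from expectation_truncate_to_nat[OF c_real g C(1), of k N]
        have "\<bar>(\<integral>x. g (real (c k x)) \<partial>\<mu> n) - (\<Sum>i\<le>N. g (real i) * prob {x\<in>space (\<mu> n). real (c k x) = real i})\<bar>
            \<le> C * (1 - prob {x\<in>space (\<mu> n). real (c k x) \<in> real ` {..N}})" .
        also have "\<dots> \<le> C * d" using elim(1) C by (intro mult_left_mono) (auto simp: c_N)
        finally show ?case
          using M.expectation_truncate_to_nat[OF comp g C(1), of k N] M_d elim(2) d(2) \<open>0 < e\<close>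
          unfolding dist_real_def by linarith
      qed
    qed
    define \<alpha> where "\<alpha> = distr M borel X"
    have "bl_tendsto \<mu> \<alpha> U"
      unfolding bl_tendsto_def
    proof (intro allI impI)
      fix f :: "'a \<Rightarrow> real" assume f: "bounded_lipschitz f"
      obtain C L where C: "0 < C" "0 < L" "\<And>x. \<bar>f x\<bar> \<le> C" "\<And>x y. \<bar>f x - f y\<bar> \<le> L * dist x y"
        using bounded_lipschitzE[OF f] by metis
      have fm[measurable]: "f \<in> borel_measurable borel" using f by (rule bounded_lipschitz_measurable)
      have "\<bar>\<integral>x. f x \<partial>\<mu> n\<bar> \<le> C" for n
        using C by (intro prob_space.abs_expectation_le borel_probD(1)[OF \<mu>]) auto
      then have lim: "((\<lambda>n. \<integral>x. f x \<partial>\<mu> n) \<longlongrightarrow> Lim U (\<lambda>n. \<integral>x. f x \<partial>\<mu> n)) U"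
        by (rule U_D(3))
      have approx_\<mu>: "\<bar>(\<integral>x. f x \<partial>\<mu> n) - (\<integral>x. f (Q (real (c k x))) \<partial>\<mu> n)\<bar> \<le> L * (1 / 2) ^ k" for n k
      proof -
        interpret prob_space "\<mu> n" using \<mu> by (rule borel_probD)
        note [measurable] = c_real[of k n] measurable_borel_prob[OF \<mu> fm, of n]
        have "(\<integral>x. f x \<partial>\<mu> n) - (\<integral>x. f (Q (real (c k x))) \<partial>\<mu> n) = (\<integral>x. f x - f (Q (real (c k x))) \<partial>\<mu> n)"
          using C by (intro Bochner_Integration.integral_diff[symmetric] integrable_const_bound[where B=C]) auto
        also have "\<bar>\<dots>\<bar> \<le> L * (1 / 2) ^ k"
        proof (rule abs_expectation_le)
          fix x
          have "\<bar>f x - f (q (c k x))\<bar> \<le> L * dist x (q (c k x))" by (rule C)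
          also have "\<dots> \<le> L * (1 / 2) ^ k" using C c_dist[of x k] by (intro mult_left_mono) auto
          finally show "\<bar>f x - f (Q (real (c k x)))\<bar> \<le> L * (1 / 2) ^ k" by (simp add: Q_real)
        qed (use C in simp)
        finally show ?thesis .
      qed
      have approx_M: "\<bar>(\<integral>\<omega>. f (X \<omega>) \<partial>M) - (\<integral>\<omega>. f (Q (\<omega> k)) \<partial>M)\<bar> \<le> L * (1 / 2) ^ k" for k
      proof -
        have int: "integrable M (\<lambda>\<omega>. f (X \<omega>))" "integrable M (\<lambda>\<omega>. f (Q (\<omega> k)))"
          using C by (auto intro!: M.integrable_const_bound[where B=C])
        have "\<bar>(\<integral>\<omega>. f (X \<omega>) \<partial>M) - (\<integral>\<omega>. f (Q (\<omega> k)) \<partial>M)\<bar> = \<bar>\<integral>\<omega>. f (X \<omega>) - f (Q (\<omega> k)) \<partial>M\<bar>"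
          using int by simp
        also have "\<dots> \<le> (\<integral>\<omega>. \<bar>f (X \<omega>) - f (Q (\<omega> k))\<bar> \<partial>M)" by (rule integral_abs_bound)
        also have "\<dots> \<le> (\<integral>\<omega>. L * (1 / 2) ^ k \<partial>M)"
        proof (rule integral_mono_AE)
          show "AE \<omega> in M. \<bar>f (X \<omega>) - f (Q (\<omega> k))\<bar> \<le> L * (1 / 2) ^ k"
            using AE_X
          proof eventually_elim
            case (elim \<omega>)
            have "\<bar>f (X \<omega>) - f (Q (\<omega> k))\<bar> \<le> L * dist (X \<omega>) (Q (\<omega> k))" by (rule C)
            also have "\<dots> \<le> L * (1 / 2) ^ k"
              using C elim by (intro mult_left_mono) (auto simp: dist_commute)
            finally show ?case .
          qed
        qed (use int in auto)
        finally show ?thesis by (simp add: M.prob_space)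
      qed
      have "\<bar>Lim U (\<lambda>n. \<integral>x. f x \<partial>\<mu> n) - (\<integral>\<omega>. f (X \<omega>) \<partial>M)\<bar> \<le> 2 * L * (1 / 2) ^ k" for k
      proof -
        have "((\<lambda>n. \<integral>x. f (Q (real (c k x))) \<partial>\<mu> n) \<longlongrightarrow> (\<integral>\<omega>. f (Q (\<omega> k)) \<partial>M)) U"
          using C by (intro int_lim[of "\<lambda>r. f (Q r)" C]) auto
        then have "((\<lambda>n. \<bar>(\<integral>x. f x \<partial>\<mu> n) - (\<integral>x. f (Q (real (c k x))) \<partial>\<mu> n)\<bar>) \<longlongrightarrow>
            \<bar>Lim U (\<lambda>n. \<integral>x. f x \<partial>\<mu> n) - (\<integral>\<omega>. f (Q (\<omega> k)) \<partial>M)\<bar>) U"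
          using lim by (intro tendsto_intros)
        then have "\<bar>Lim U (\<lambda>n. \<integral>x. f x \<partial>\<mu> n) - (\<integral>\<omega>. f (Q (\<omega> k)) \<partial>M)\<bar> \<le> L * (1 / 2) ^ k"
          by (rule tendsto_upperbound[OF _ _ U_D(1)]) (simp add: approx_\<mu>)
        then show ?thesis using approx_M[of k] by linarith
      qed
      moreover have "(\<lambda>k. 2 * L * (1 / 2) ^ k) \<longlonglongrightarrow> 2 * L * 0"
        by (intro tendsto_intros LIMSEQ_realpow_zero) auto
      ultimately have "\<bar>Lim U (\<lambda>n. \<integral>x. f x \<partial>\<mu> n) - (\<integral>\<omega>. f (X \<omega>) \<partial>M)\<bar> \<le> 2 * L * 0"
        by (intro LIMSEQ_le_const) auto
      then have "Lim U (\<lambda>n. \<integral>x. f x \<partial>\<mu> n) = (\<integral>x. f x \<partial>\<alpha>)"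
        by (simp add: \<alpha>_def integral_distr)
      with lim show "((\<lambda>n. \<integral>x. f x \<partial>\<mu> n) \<longlongrightarrow> (\<integral>x. f x \<partial>\<alpha>)) U" by simp
    qed
    moreover have "borel_prob \<alpha>"
      unfolding \<alpha>_def by (rule borel_prob_distr) (auto intro: M.prob_space_axioms)
    ultimately show thesis by (rule that[rotated])
  qed
qed

section \<open>Convolution hemigroups\<close>

lemma prob_space_PiM_borel_prob:
  "(\<And>i. i \<in> I \<Longrightarrow> borel_prob (M i)) \<Longrightarrow> prob_space (PiM I M)"
  by (rule prob_space_PiM) (rule borel_probD)

lemma sets_PiM_borel_prob:
  "(\<And>i. i \<in> I \<Longrightarrow> borel_prob (M i)) \<Longrightarrow> sets (PiM I M) = sets (PiM I (\<lambda>_. borel))"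
  by (rule sets_PiM_cong) (auto dest: borel_probD(2))

lemma indep_vars_PiM_components:
  assumes M: "\<And>i. i \<in> I \<Longrightarrow> borel_prob (M i)" and "I \<noteq> {}"
  shows "prob_space.indep_vars (PiM I M) (\<lambda>_. borel) (\<lambda>i \<omega>. \<omega> i) I"
proof -
  interpret prob_space "PiM I M" by (rule prob_space_PiM_borel_prob[OF M])
  have meas: "(\<lambda>\<omega>. \<omega> i) \<in> borel_measurable (PiM I M)" if "i \<in> I" for i
    using measurable_component_singleton[OF that, of M] measurable_cong_sets[OF refl borel_probD(2)[OF M[OF that]]]
    by blast
  have comp: "distr (PiM I M) borel (\<lambda>\<omega>. \<omega> i) = M i" if "i \<in> I" for i
  proof -
    have "distr (PiM I M) borel (\<lambda>\<omega>. \<omega> i) = distr (PiM I M) (M i) (\<lambda>\<omega>. \<omega> i)"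
      by (rule distr_cong) (auto simp: borel_probD(2)[OF M[OF that]])
    also have "\<dots> = M i"
      by (rule distr_PiM_component[OF borel_probD(1)[OF M] that])
    finally show ?thesis .
  qed
  have "distr (PiM I M) (PiM I (\<lambda>_. borel)) (\<lambda>\<omega>. \<lambda>i\<in>I. \<omega> i) = distr (PiM I M) (PiM I M) (\<lambda>\<omega>. \<omega>)"
    by (rule distr_cong) (auto simp: sets_PiM_borel_prob[OF M] space_PiM)
  also have "\<dots> = PiM I M" by (rule distr_id)
  also have "\<dots> = PiM I (\<lambda>i. distr (PiM I M) borel (\<lambda>\<omega>. \<omega> i))"
    by (rule PiM_cong) (auto simp: comp)
  finally show ?thesis
    by (subst indep_vars_iff_distr_eq_PiM') (auto simp: assms meas)
qed

lemma distr_PiM_sum_insert: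
  assumes "finite I" "i \<notin> I" and M: "\<And>j. j \<in> insert i I \<Longrightarrow> borel_prob (M j)"
  shows "distr (PiM (insert i I) M) borel (\<lambda>\<omega>. \<Sum>j\<in>insert i I. \<omega> j)
    = measure_conv (M i) (distr (PiM I M) borel (\<lambda>\<omega>. \<Sum>j\<in>I. \<omega> j))"
proof -
  have M': "borel_prob (M i)" "\<And>j. j \<in> I \<Longrightarrow> borel_prob (M j)" using M by auto
  note [measurable_cong] = borel_probD(2)[OF M'(1)] sets_PiM_borel_prob[OF M'(2)] sets_PiM_borel_prob[OF M]
  interpret Q: prob_space "PiM I M" by (rule prob_space_PiM_borel_prob[OF M'(2)])
  have [measurable]: "(\<lambda>(x, X). X(i := x)) \<in> M i \<Otimes>\<^sub>M PiM I M \<rightarrow>\<^sub>M PiM (insert i I) M"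
    by measurable
  have [measurable]: "(\<lambda>\<omega>. \<Sum>j\<in>I. \<omega> j) \<in> borel_measurable (PiM I M)"
    "(\<lambda>\<omega>. \<Sum>j\<in>insert i I. \<omega> j) \<in> borel_measurable (PiM (insert i I) M)"
    by measurable
  have sf: "sigma_finite_measure (distr (PiM I M) borel (\<lambda>\<omega>. \<Sum>j\<in>I. \<omega> j))"
    by (intro prob_space_imp_sigma_finite Q.prob_space_distr) measurable
  have "distr (PiM (insert i I) M) borel (\<lambda>\<omega>. \<Sum>j\<in>insert i I. \<omega> j)
    = distr (distr (M i \<Otimes>\<^sub>M PiM I M) (PiM (insert i I) M) (\<lambda>(x, X). X(i := x))) borel
        (\<lambda>\<omega>. \<Sum>j\<in>insert i I. \<omega> j)"
    by (subst distr_pair_PiM_eq_PiM) (auto intro: borel_probD M')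
  also have "\<dots> = distr (M i \<Otimes>\<^sub>M PiM I M) borel (\<lambda>(x, X). x + (\<Sum>j\<in>I. X j))"
    by (subst distr_distr) (use assms(1,2) in \<open>auto intro!: distr_cong sum.cong simp: split_beta'\<close>)
  also have "\<dots> = distr (distr (M i) borel (\<lambda>x. x) \<Otimes>\<^sub>M distr (PiM I M) borel (\<lambda>\<omega>. \<Sum>j\<in>I. \<omega> j)) borel (\<lambda>(x, y). x + y)"
    by (subst pair_measure_distr[OF _ _ sf]) (auto simp: distr_distr split_beta' comp_def)
  also have "distr (M i) borel (\<lambda>x. x) = M i"
    by (rule distr_id2) (simp add: borel_probD(2)[OF M'(1)])
  finally show ?thesis unfolding measure_conv_def .
qed

lemma prob_space_PiM_empty_eqI:
  assumes "prob_space P" "prob_space Q" "sets P = sets (PiM {} M)" "sets Q = sets (PiM {} M)"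
  shows "P = Q"
proof (rule measure_eqI)
  interpret P: prob_space P by fact
  interpret Q: prob_space Q by fact
  have sp: "space P = {\<lambda>_. undefined}" "space Q = {\<lambda>_. undefined}"
    using assms(3,4)[THEN sets_eq_imp_space_eq] by (auto simp: space_PiM)
  fix A assume "A \<in> sets P"
  then have "A = {} \<or> A = space P" using sets.sets_into_space[of A P] sp by auto
  then show "emeasure P A = emeasure Q A"
    using P.emeasure_space_1 Q.emeasure_space_1 sp by auto
qed (use assms in simp)

text \<open>The left neighbour of \<open>t\<close> in the grid \<open>G\<close>; the first grid
  point gets the starting time \<open>a\<close>.\<close>

definition last_before :: "'a::linorder \<Rightarrow> 'a set \<Rightarrow> 'a \<Rightarrow> 'a" where
  "last_before a G t = Max (insert a {s\<in>G. s < t})"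

locale convolution_hemigroup =
  fixes \<mu> :: "real \<Rightarrow> real \<Rightarrow> 'a::{banach, second_countable_topology} measure"
  assumes borel_prob_mu: "0 \<le> s \<Longrightarrow> s \<le> t \<Longrightarrow> borel_prob (\<mu> s t)"
    and mu_diag: "0 \<le> t \<Longrightarrow> \<mu> t t = return borel 0"
    and mu_conv: "0 \<le> s \<Longrightarrow> s \<le> t \<Longrightarrow> t \<le> u \<Longrightarrow> measure_conv (\<mu> s t) (\<mu> t u) = \<mu> s u"
begin

lemma borel_prob_step:
  assumes "finite G" "0 \<le> a" "a \<le> t"
  shows "borel_prob (\<mu> (last_before a G t) t)"
proof (rule borel_prob_mu)
  show "last_before a G t \<le> t" using assms by (auto simp: last_before_def)
  have "a \<le> last_before a G t" using assms by (auto simp: last_before_def)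
  with assms show "0 \<le> last_before a G t" by linarith
qed

text \<open>Induction adds the largest grid point last: the neighbours of the older points do not
  change, its own neighbour is the old maximum, and \<open>mu_conv\<close> joins the two
  intervals.\<close>

lemma distr_chain_sum:
  assumes "finite G" "0 \<le> a" "\<And>s. s \<in> G \<Longrightarrow> a \<le> s"
  shows "distr (PiM G (\<lambda>t. \<mu> (last_before a G t) t)) borel (\<lambda>\<omega>. \<Sum>s\<in>G. \<omega> s) = \<mu> a (Max (insert a G))"
  using assms(1,3)
proof (induction G rule: finite_linorder_max_induct)
  case empty
  interpret prob_space "PiM {} (\<lambda>t. \<mu> (last_before a {} t) t)" by (rule prob_space_PiM) simp
  have "distr (PiM {} (\<lambda>t. \<mu> (last_before a {} t) t)) borel (\<lambda>\<omega>. \<Sum>s\<in>{}. \<omega> s) = return borel 0"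
    by (simp add: distr_const)
  then show ?case by (simp add: mu_diag assms)
next
  case (insert b G)
  have bG: "b \<notin> G" using insert by auto
  let ?M = "\<lambda>t. \<mu> (last_before a (insert b G) t) t"
  have M: "borel_prob (?M t)" if "t \<in> insert b G" for t
    using insert that \<open>0 \<le> a\<close> by (intro borel_prob_step) auto
  have "{s \<in> insert b G. s < t} = {s \<in> G. s < t}" if "t \<in> G" for t
    using insert that by fastforce
  then have "PiM G ?M = PiM G (\<lambda>t. \<mu> (last_before a G t) t)"
    by (intro PiM_cong) (auto simp: last_before_def)
  then have IH: "distr (PiM G ?M) borel (\<lambda>\<omega>. \<Sum>s\<in>G. \<omega> s) = \<mu> a (Max (insert a G))"
    using insert by simp
  have "{s \<in> insert b G. s < b} = G" using insert by auto
  then have b: "last_before a (insert b G) b = Max (insert a G)"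
    by (simp add: last_before_def)
  have le: "a \<le> Max (insert a G)" "Max (insert a G) \<le> b"
    using insert by (auto simp: less_imp_le)
  have "distr (PiM (insert b G) ?M) borel (\<lambda>\<omega>. \<Sum>s\<in>insert b G. \<omega> s)
      = measure_conv (?M b) (distr (PiM G ?M) borel (\<lambda>\<omega>. \<Sum>s\<in>G. \<omega> s))"
    using insert M bG by (intro distr_PiM_sum_insert) auto
  also have "\<dots> = measure_conv (\<mu> a (Max (insert a G))) (\<mu> (Max (insert a G)) b)"
    unfolding IH b using le \<open>0 \<le> a\<close> by (intro conv_commute borel_prob_mu) auto
  also have "\<dots> = \<mu> a b"
    using le \<open>0 \<le> a\<close> by (intro mu_conv) auto
  finally have "distr (PiM (insert b G) ?M) borel (\<lambda>\<omega>. \<Sum>s\<in>insert b G. \<omega> s) = \<mu> a b" .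
  moreover have "Max (insert a (insert b G)) = b"
    using insert le by (intro Max_eqI) (auto simp: less_imp_le)
  ultimately show ?case by simp
qed

definition increments_law :: "real set \<Rightarrow> (real \<Rightarrow> 'a) measure" where
  "increments_law H = PiM H (\<lambda>t. \<mu> (last_before 0 H t) t)"

definition partial_sums :: "real set \<Rightarrow> real set \<Rightarrow> (real \<Rightarrow> 'a) \<Rightarrow> real \<Rightarrow> 'a" where
  "partial_sums H J \<omega> = (\<lambda>t\<in>J. \<Sum>s\<in>{s\<in>H. s \<le> t}. \<omega> s)"

text \<open>The values are rebuilt as sums of independent increments, so independence is built in
  and consistency is what remains to be proved.\<close>

definition fdd :: "real set \<Rightarrow> (real \<Rightarrow> 'a) measure" where
  "fdd H = distr (increments_law H) (PiM H (\<lambda>_. borel)) (partial_sums H H)"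

lemma
  assumes "finite H" "H \<subseteq> {0..}"
  shows prob_space_increments_law: "prob_space (increments_law H)"
    and sets_increments_law: "sets (increments_law H) = sets (PiM H (\<lambda>_. borel))"
  unfolding increments_law_def
  by (rule prob_space_PiM_borel_prob sets_PiM_borel_prob, rule borel_prob_step; use assms in auto)+

lemma measurable_partial_sums [measurable]:
  "partial_sums H J \<in> PiM H (\<lambda>_. borel) \<rightarrow>\<^sub>M PiM J (\<lambda>_. borel)"
  unfolding partial_sums_def by measurable

text \<open>The increments over a coarser partition \<open>J\<close> are sums of increments over disjoint blocks of \<open>H\<close>.\<close>

lemma fdd_restrict:
  assumes "J \<subseteq> H" "finite H" "H \<subseteq> {0..}"
  shows "fdd J = distr (fdd H) (PiM J (\<lambda>_. borel)) (\<lambda>\<omega>. restrict \<omega> J)"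
proof -
  have J: "finite J" "J \<subseteq> {0..}" using assms by (auto intro: finite_subset)
  \<comment> \<open>The block of \<open>t\<close>: the points of \<open>H\<close> after the left
    neighbour of \<open>t\<close> in \<open>J\<close>, up to and including \<open>t\<close>.\<close>
  define B where "B t = {s\<in>H. s \<le> t \<and> (\<forall>j\<in>J. j < t \<longrightarrow> j < s)}" for t
  have B: "finite (B t)" "B t \<subseteq> H" for t using assms by (auto simp: B_def)
  define G where "G \<omega> = (\<lambda>t\<in>J. \<Sum>s\<in>B t. \<omega> s)" for \<omega> :: "real \<Rightarrow> 'a"
  interpret Q: prob_space "increments_law H" using assms by (intro prob_space_increments_law)
  note [measurable_cong] = sets_increments_law[OF assms(2,3)] sets_increments_law[OF J]
  have comp[measurable]: "(\<lambda>\<omega>. \<omega> s) \<in> borel_measurable (increments_law H)" if "s \<in> H" for s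
    using that by measurable
  have G[measurable]: "G \<in> increments_law H \<rightarrow>\<^sub>M PiM J (\<lambda>_. borel)"
    unfolding G_def using B by (intro measurable_restrict borel_measurable_sum comp) auto
  have [measurable]: "(\<lambda>\<omega>. restrict \<omega> J) \<in> PiM H (\<lambda>_. borel :: 'a measure) \<rightarrow>\<^sub>M PiM J (\<lambda>_. borel)"
    using assms(1) by (rule measurable_restrict_subset)
  have law: "distr (increments_law H) borel (\<lambda>\<omega>. \<Sum>s\<in>B t. \<omega> s) = \<mu> (last_before 0 J t) t" if t: "t \<in> J" for t
  proof -
    define a where "a = last_before 0 J t"
    have fin: "finite (insert 0 {s\<in>J. s < t})" using J by simp
    have a: "a \<in> insert 0 {s\<in>J. s < t}" "\<And>j. j \<in> J \<Longrightarrow> j < t \<Longrightarrow> j \<le> a" "0 \<le> a"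
      unfolding a_def last_before_def using Max_in[OF fin] Max_ge[OF fin] by auto
    \<comment> \<open>Inside a block, left neighbours in \<open>H\<close> stay in the block, except
      that the first point has the block's starting time \<open>a\<close>; thus the block is itself
      a chain from \<open>a\<close> to \<open>t\<close>.\<close>
    have pred: "last_before 0 H s = last_before a (B t) s" if s: "s \<in> B t" for s
    proof -
      have "s \<ge> a" using s a assms by (auto simp: B_def less_imp_le)
      have 1: "x \<le> a" if x: "x \<in> H" "x < s" "x \<notin> B t" for x
      proof -
        have "x \<le> t" using s x by (auto simp: B_def)
        with x obtain j where "j \<in> J" "j < t" "x \<le> j" by (auto simp: B_def not_less)
        then show ?thesis using a(2) by fastforce
      qed
      have 2: "a = 0 \<or> a \<in> H \<and> a < s"
        using a(1) s assms(1) by (auto simp: B_def)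
      define R where "R = insert a {x\<in>B t. x < s}"
      have fin_R: "finite R" using B(1)[of t] by (simp add: R_def)
      have max_R: "Max R \<in> R" using fin_R by (intro Max_in) (auto simp: R_def)
      have 3: "a \<le> Max R" using fin_R by (intro Max_ge) (auto simp: R_def)
      have 4: "x \<le> Max R" if "x \<in> B t" "x < s" for x
        using fin_R that by (intro Max_ge) (auto simp: R_def)
      have "Max (insert 0 {x\<in>H. x < s}) = Max R"
      proof (rule Max_eqI)
        show "finite (insert 0 {x\<in>H. x < s})" using assms(2) by simp
        show "Max R \<in> insert 0 {x\<in>H. x < s}"
          using max_R B(2)[of t] 2 by (auto simp: R_def)
        fix x assume x: "x \<in> insert 0 {x\<in>H. x < s}"
        consider "x \<in> B t" "x < s" | "x \<le> a" using x \<open>0 \<le> a\<close> 1 by blast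
        then show "x \<le> Max R"
        proof cases
          case 2 then show ?thesis using 3 by linarith
        qed (rule 4)
      qed
      then show ?thesis by (simp add: last_before_def R_def)
    qed
    let ?M = "\<lambda>t. \<mu> (last_before 0 H t) t"
    have M: "borel_prob (?M s)" if "s \<in> H" for s
      using that assms by (intro borel_prob_step) auto
    have "distr (increments_law H) (PiM (B t) ?M) (\<lambda>\<omega>. \<lambda>s\<in>B t. \<omega> s) = PiM (B t) ?M"
      unfolding increments_law_def using B(2)[of t]
      by (intro distr_PiM_reindex[where f="\<lambda>s. s"] borel_probD(1)[OF M]) auto
    also have "\<dots> = PiM (B t) (\<lambda>s. \<mu> (last_before a (B t) s) s)"
      by (rule PiM_cong) (auto simp: pred)
    finally have eq: "distr (increments_law H) (PiM (B t) ?M) (\<lambda>\<omega>. \<lambda>s\<in>B t. \<omega> s)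
        = PiM (B t) (\<lambda>s. \<mu> (last_before a (B t) s) s)" .
    have setsB: "sets (PiM (B t) ?M) = sets (PiM (B t) (\<lambda>_. borel))"
      using B(2)[of t] M by (intro sets_PiM_borel_prob) auto
    have [measurable]: "(\<lambda>\<omega>. \<lambda>s\<in>B t. \<omega> s) \<in> increments_law H \<rightarrow>\<^sub>M PiM (B t) ?M"
      unfolding measurable_cong_sets[OF refl setsB]
      using B(2)[of t] by (intro measurable_restrict comp) auto
    have [measurable]: "(\<lambda>\<omega>. \<Sum>s\<in>B t. \<omega> s) \<in> borel_measurable (PiM (B t) ?M)"
      unfolding measurable_cong_sets[OF setsB refl] by measurable
    have "distr (increments_law H) borel (\<lambda>\<omega>. \<Sum>s\<in>B t. \<omega> s)
        = distr (distr (increments_law H) (PiM (B t) ?M) (\<lambda>\<omega>. \<lambda>s\<in>B t. \<omega> s)) borel (\<lambda>\<omega>. \<Sum>s\<in>B t. \<omega> s)"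
      by (subst distr_distr) (auto simp: comp_def)
    also have "\<dots> = \<mu> a (Max (insert a (B t)))"
      unfolding eq using B(1) a assms(1,3) by (intro distr_chain_sum) (auto simp: B_def less_imp_le)
    also have "Max (insert a (B t)) = t"
      using t assms(1) B(1)[of t] a(1,3) J by (intro Max_eqI) (auto simp: B_def less_imp_le)
    finally show ?thesis unfolding a_def .
  qed
  have law_G: "distr (increments_law H) (PiM J (\<lambda>_. borel)) G = increments_law J"
  proof (cases "J = {}")
    \<comment> \<open>The characterization of independence by product laws needs a nonempty index
      set; over the empty one there is only one probability measure.\<close>
    case True
    then show ?thesis
      using prob_space_increments_law[OF J] sets_increments_law[OF J] G
      by (intro prob_space_PiM_empty_eqI[where M="\<lambda>_. borel"] Q.prob_space_distr) auto
  next
    case False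
    then have "H \<noteq> {}" using assms(1) by auto
    then have "Q.indep_vars (\<lambda>_. borel) (\<lambda>s \<omega>. \<omega> s) H"
      using indep_vars_PiM_components[of H "\<lambda>t. \<mu> (last_before 0 H t) t"] borel_prob_step[OF assms(2), of 0] assms(3)
      by (auto simp: increments_law_def)
    moreover have "disjoint_family_on B J"
    proof (unfold disjoint_family_on_def, intro ballI impI)
      fix i j assume "i \<in> J" "j \<in> J" "i \<noteq> j"
      then show "B i \<inter> B j = {}"
        by (cases "i < j") (force simp: B_def)+
    qed
    ultimately have "Q.indep_vars (\<lambda>t. PiM (B t) (\<lambda>_. borel)) (\<lambda>t \<omega>. \<lambda>s\<in>B t. \<omega> s) J"
      using B(2) by (intro Q.indep_vars_restrict) auto
    then have "Q.indep_vars (\<lambda>_. borel) (\<lambda>t \<omega>. \<Sum>s\<in>B t. (\<lambda>s\<in>B t. \<omega> s) s) J"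
      by (rule Q.indep_vars_compose2[where Y="\<lambda>t \<omega>. \<Sum>s\<in>B t. \<omega> s"]) measurable
    then have "Q.indep_vars (\<lambda>_. borel) (\<lambda>t \<omega>. \<Sum>s\<in>B t. \<omega> s) J"
      by simp
    then have "distr (increments_law H) (PiM J (\<lambda>_. borel)) G
        = PiM J (\<lambda>t. distr (increments_law H) borel (\<lambda>\<omega>. \<Sum>s\<in>B t. \<omega> s))"
      unfolding G_def using False B(2)
      by (subst (asm) Q.indep_vars_iff_distr_eq_PiM') (auto intro!: borel_measurable_sum comp)
    also have "\<dots> = increments_law J"
      unfolding increments_law_def by (rule PiM_cong) (auto simp: law[unfolded increments_law_def])
    finally show ?thesis .
  qed
  have sums: "partial_sums J J (G \<omega>) = restrict (partial_sums H H \<omega>) J" for \<omega>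
  proof
    fix t
    have "(\<Sum>j\<in>{j\<in>J. j \<le> t}. \<Sum>s\<in>B j. \<omega> s) = (\<Sum>s\<in>{s\<in>H. s \<le> t}. \<omega> s)" if t: "t \<in> J"
    proof -
      have "(\<Sum>j\<in>{j\<in>J. j \<le> t}. \<Sum>s\<in>B j. \<omega> s) = (\<Sum>s\<in>(\<Union>j\<in>{j\<in>J. j \<le> t}. B j). \<omega> s)"
      proof (rule sum.UNION_disjoint[symmetric])
        show "\<forall>i\<in>{j \<in> J. j \<le> t}. \<forall>j\<in>{j \<in> J. j \<le> t}. i \<noteq> j \<longrightarrow> B i \<inter> B j = {}"
        proof (intro ballI impI)
          fix i j assume "i \<in> {j \<in> J. j \<le> t}" "j \<in> {j \<in> J. j \<le> t}" "i \<noteq> j"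
          then show "B i \<inter> B j = {}"
            by (cases "i < j") (force simp: B_def)+
        qed
      qed (use B J in auto)
      also have "(\<Union>j\<in>{j\<in>J. j \<le> t}. B j) = {s\<in>H. s \<le> t}"
      proof (intro set_eqI iffI)
        fix s assume s: "s \<in> {s\<in>H. s \<le> t}"
        define j where "j = Min {j\<in>J. s \<le> j}"
        have fin: "finite {j\<in>J. s \<le> j}" "{j\<in>J. s \<le> j} \<noteq> {}" using J t s by auto
        then have "j \<in> {j\<in>J. s \<le> j}" "\<And>i. i \<in> J \<Longrightarrow> s \<le> i \<Longrightarrow> j \<le> i"
          unfolding j_def using Min_in[OF fin] Min_le[OF fin(1)] by auto
        with s t have "j \<in> {j\<in>J. j \<le> t}" "s \<in> B j"
          by (auto simp: B_def not_le[symmetric])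
        then show "s \<in> (\<Union>j\<in>{j\<in>J. j \<le> t}. B j)" by blast
      qed (auto simp: B_def)
      finally show ?thesis .
    qed
    moreover have "{j \<in> J. j \<le> t} \<subseteq> J" by auto
    ultimately show "partial_sums J J (G \<omega>) t = restrict (partial_sums H H \<omega>) J t"
      using assms(1) by (auto simp: partial_sums_def G_def restrict_def subset_eq intro!: sum.cong)
  qed
  have "fdd J = distr (distr (increments_law H) (PiM J (\<lambda>_. borel)) G) (PiM J (\<lambda>_. borel)) (partial_sums J J)"
    unfolding law_G fdd_def ..
  also have "\<dots> = distr (increments_law H) (PiM J (\<lambda>_. borel)) (\<lambda>\<omega>. restrict (partial_sums H H \<omega>) J)"
    by (subst distr_distr) (auto simp: comp_def sums)
  also have "\<dots> = distr (fdd H) (PiM J (\<lambda>_. borel)) (\<lambda>\<omega>. restrict \<omega> J)"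
    unfolding fdd_def by (subst distr_distr) (auto simp: comp_def)
  finally show ?thesis .
qed

lemma prob_space_fdd: "finite H \<Longrightarrow> H \<subseteq> {0..} \<Longrightarrow> prob_space (fdd H)"
  unfolding fdd_def
  by (intro prob_space.prob_space_distr prob_space_increments_law)
    (simp_all add: measurable_cong_sets[OF sets_increments_law refl])

text \<open>Joint laws of increments are stated as product measures: this form contains independence
  together with the marginals and is what the oscillation estimate consumes.\<close>

lemma process_exists:
  obtains M :: "(real \<Rightarrow> 'a) measure" where
    "prob_space M" "\<And>t. 0 \<le> t \<Longrightarrow> (\<lambda>\<omega>. \<omega> t) \<in> borel_measurable M"
    "\<And>s. 0 \<le> s \<Longrightarrow> distr M borel (\<lambda>\<omega>. \<omega> s) = \<mu> 0 s"
    "\<And>n t. 0 \<le> t 0 \<Longrightarrow> (\<And>i. i < n \<Longrightarrow> t i < t (Suc i)) \<Longrightarrow>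
      distr M (PiM {..<n} (\<lambda>_. borel)) (\<lambda>\<omega>. \<lambda>i\<in>{..<n}. \<omega> (t (Suc i)) - \<omega> (t i))
      = PiM {..<n} (\<lambda>i. \<mu> (t i) (t (Suc i)))"
proof -
  have "projective_family {0..} fdd (\<lambda>_. borel)"
    by (rule projective_family.intro) (auto intro: fdd_restrict prob_space_fdd finite_subset)
  then obtain M :: "(real \<Rightarrow> 'a) measure" where M: "prob_space M" "sets M = sets (PiM {0..} (\<lambda>_. borel))"
    "\<And>J. finite J \<Longrightarrow> J \<subseteq> {0..} \<Longrightarrow> distr M (PiM J (\<lambda>_. borel)) (\<lambda>\<omega>. restrict \<omega> J) = fdd J"
    by (rule Kolmogorov_extension) metis
  interpret prob_space M by fact
  note [measurable_cong] = M(2)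
  have comp: "(\<lambda>\<omega>. \<omega> t) \<in> borel_measurable M" if "0 \<le> t" for t
    using measurable_component_singleton[of t "{0..}" "\<lambda>_. borel"] that
    by (simp add: measurable_cong_sets[OF M(2) refl])
  have fdd: "distr M N (\<lambda>\<omega>. f (restrict \<omega> H)) = distr (increments_law H) N (\<lambda>\<omega>. f (partial_sums H H \<omega>))"
    if H: "finite H" "H \<subseteq> {0..}" and [measurable]: "f \<in> PiM H (\<lambda>_. borel) \<rightarrow>\<^sub>M N"
    for H N and f :: "(real \<Rightarrow> 'a) \<Rightarrow> 'c"
  proof -
    note [measurable_cong] = sets_increments_law[OF H]
    have [measurable]: "(\<lambda>\<omega>. restrict \<omega> H) \<in> PiM {0..} (\<lambda>_. borel :: 'a measure) \<rightarrow>\<^sub>M PiM H (\<lambda>_. borel)"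
      using H(2) by (rule measurable_restrict_subset)
    have "distr M N (\<lambda>\<omega>. f (restrict \<omega> H)) = distr (fdd H) N f"
      unfolding M(3)[OF H, symmetric] by (subst distr_distr) (auto simp: comp_def)
    also have "\<dots> = distr (increments_law H) N (\<lambda>\<omega>. f (partial_sums H H \<omega>))"
      unfolding fdd_def by (subst distr_distr) (auto simp: comp_def)
    finally show ?thesis .
  qed
  show ?thesis
  proof
    show "prob_space M" by fact
    show "(\<lambda>\<omega>. \<omega> t) \<in> borel_measurable M" if "0 \<le> t" for t using comp[OF that] .
  next
    fix s :: real assume s: "0 \<le> s"
    have "distr M borel (\<lambda>\<omega>. \<omega> s) = distr M borel (\<lambda>\<omega>. (restrict \<omega> {s}) s)" by simp
    also have "\<dots> = distr (increments_law {s}) borel (\<lambda>\<omega>. partial_sums {s} {s} \<omega> s)"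
      using s by (intro fdd) auto
    also have "\<dots> = distr (PiM {s} (\<lambda>t. \<mu> (last_before 0 {s} t) t)) borel (\<lambda>\<omega>. \<Sum>s\<in>{s}. \<omega> s)"
      unfolding increments_law_def
      by (intro distr_cong) (auto simp: partial_sums_def conj_commute cong: conj_cong)
    also have "\<dots> = \<mu> 0 s"
      using s distr_chain_sum[of "{s}" 0] by simp
    finally show "distr M borel (\<lambda>\<omega>. \<omega> s) = \<mu> 0 s" .
  next
    fix n :: nat and t :: "nat \<Rightarrow> real" assume t0: "0 \<le> t 0" and t: "\<And>i. i < n \<Longrightarrow> t i < t (Suc i)"
    have tmono: "t i < t j" if "i < j" "j \<le> n" for i j
      using that
    proof (induction j)
      case (Suc j) then show ?case using t[of j] by (cases "i = j") auto
    qed simp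
    have tle: "t i \<le> t j \<longleftrightarrow> i \<le> j" if "i \<le> n" "j \<le> n" for i j
      using tmono[of i j] tmono[of j i] that by (cases i j rule: linorder_cases) auto
    have inj: "inj_on t {..n}" using tle by (auto simp: inj_on_def) (metis order.antisym order_refl)
    \<comment> \<open>The grid includes \<open>t 0\<close>; its coordinate, the increment from time
      0, enters all partial sums and cancels in the differences.\<close>
    define H where "H = t ` {..n}"
    have t_nonneg: "0 \<le> t i" if "i \<le> n" for i using tle[of 0 i] that t0 by auto
    have H: "finite H" "H \<subseteq> {0..}" using t_nonneg by (auto simp: H_def)
    note [measurable_cong] = sets_increments_law[OF H]
    have sum: "partial_sums H H \<omega> (t i) = (\<Sum>j\<in>{..i}. \<omega> (t j))" if "i \<le> n" for i \<omega>
    proof -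
      have "{s \<in> H. s \<le> t i} = t ` {..i}" using tle that by (fastforce simp: H_def)
      moreover have "inj_on t {..i}" using that by (intro inj_on_subset[OF inj]) auto
      ultimately show ?thesis
        using that by (simp add: partial_sums_def H_def sum.reindex)
    qed
    have pred: "last_before 0 H (t (Suc i)) = t i" if "i < n" for i
      unfolding last_before_def
    proof (rule Max_eqI)
      show "y \<le> t i" if "y \<in> insert 0 {s \<in> H. s < t (Suc i)}" for y
        using that \<open>i < n\<close> t_nonneg tle by (force simp: H_def not_le[symmetric])
      show "t i \<in> insert 0 {s \<in> H. s < t (Suc i)}" using t[OF that] that by (auto simp: H_def)
    qed (use H in auto)
    have tH: "t i \<in> H" if "i \<le> n" for i using that by (auto simp: H_def)
    have "distr M (PiM {..<n} (\<lambda>_. borel)) (\<lambda>\<omega>. \<lambda>i\<in>{..<n}. \<omega> (t (Suc i)) - \<omega> (t i))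
        = distr M (PiM {..<n} (\<lambda>_. borel)) (\<lambda>\<omega>. (\<lambda>\<omega>. \<lambda>i\<in>{..<n}. \<omega> (t (Suc i)) - \<omega> (t i)) (restrict \<omega> H))"
      by (intro distr_cong refl restrict_ext) (auto simp: tH)
    also have "\<dots> = distr (increments_law H) (PiM {..<n} (\<lambda>_. borel))
        (\<lambda>\<omega>. \<lambda>i\<in>{..<n}. partial_sums H H \<omega> (t (Suc i)) - partial_sums H H \<omega> (t i))"
      using H tH by (intro fdd measurable_restrict borel_measurable_diff measurable_component_singleton) auto
    also have "\<dots> = distr (increments_law H) (PiM {..<n} (\<lambda>i. \<mu> (last_before 0 H (t (Suc i))) (t (Suc i)))) (\<lambda>\<omega>. \<lambda>i\<in>{..<n}. \<omega> (t (Suc i)))"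
    proof (rule distr_cong)
      show "sets (PiM {..<n} (\<lambda>_. borel)) = sets (PiM {..<n} (\<lambda>i. \<mu> (last_before 0 H (t (Suc i))) (t (Suc i))))"
        using H t_nonneg by (intro sets_PiM_borel_prob[symmetric] borel_prob_step) auto
    qed (auto simp: sum fun_eq_iff)
    also have "\<dots> = PiM {..<n} (\<lambda>i. \<mu> (last_before 0 H (t (Suc i))) (t (Suc i)))"
      unfolding increments_law_def
    proof (rule distr_PiM_reindex[where f="\<lambda>i. t (Suc i)"])
      show "prob_space (\<mu> (last_before 0 H i) i)" if "i \<in> H" for i
        using H that by (intro borel_probD(1)[OF borel_prob_step]) auto
      show "inj_on (\<lambda>i. t (Suc i)) {..<n}"
      proof (rule inj_onI)
        fix i j assume "i \<in> {..<n}" "j \<in> {..<n}" "t (Suc i) = t (Suc j)"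
        then show "i = j" using inj_onD[OF inj, of "Suc i" "Suc j"] by auto
      qed
    qed (auto intro: tH)
    also have "\<dots> = PiM {..<n} (\<lambda>i. \<mu> (t i) (t (Suc i)))"
      by (intro PiM_cong) (auto simp: pred)
    finally show "distr M (PiM {..<n} (\<lambda>_. borel)) (\<lambda>\<omega>. \<lambda>i\<in>{..<n}. \<omega> (t (Suc i)) - \<omega> (t i))
      = PiM {..<n} (\<lambda>i. \<mu> (t i) (t (Suc i)))" .
  qed
qed


end

section \<open>Oscillations of partial sums\<close>

text \<open>The walk with steps \<open>ys\<close> is observed until it leaves the ball of radius
  \<open>e\<close>, then recentred. \<open>d\<close> is the displacement since the last recentring;
  the recursion stands in for a sequence of stopping times.\<close>

fun exits :: "real \<Rightarrow> 'a::real_normed_vector \<Rightarrow> 'a list \<Rightarrow> nat" where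
  "exits e d [] = 0"
| "exits e d (y # ys) = (if e < norm (d + y) then Suc (exits e 0 ys) else exits e (d + y) ys)"

lemma measurable_exits:
  fixes d :: "'b \<Rightarrow> 'a::{banach, second_countable_topology}"
  assumes "d \<in> borel_measurable M" "\<And>j. j \<in> set js \<Longrightarrow> X j \<in> borel_measurable M"
  shows "(\<lambda>\<omega>. exits e (d \<omega>) (map (\<lambda>j. X j \<omega>) js)) \<in> M \<rightarrow>\<^sub>M count_space UNIV"
  using assms
proof (induction js arbitrary: d)
  case (Cons j js)
  have [measurable]: "d \<in> borel_measurable M" "X j \<in> borel_measurable M" using Cons.prems by auto
  have [measurable]: "(\<lambda>\<omega>. exits e (d' \<omega>) (map (\<lambda>j. X j \<omega>) js)) \<in> M \<rightarrow>\<^sub>M count_space UNIV"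
    if "d' \<in> borel_measurable M" for d'
    using Cons.IH[OF that] Cons.prems by auto
  have [measurable]: "(\<lambda>\<omega>. d \<omega> + X j \<omega>) \<in> borel_measurable M" "(\<lambda>\<omega>. 0 :: 'a) \<in> borel_measurable M"
    by measurable
  show ?case by simp
qed simp

text \<open>Peeling off the first increment in the product measure replaces the usual stopping time argument
  behind Ottaviani's inequality.\<close>

lemma exits_Suc_bound:
  fixes N :: "'i \<Rightarrow> 'a::{banach, second_countable_topology} measure"
  assumes N: "\<And>j. borel_prob (N j)" and "distinct js" and "0 \<le> \<alpha>" "\<alpha> < 1" "0 \<le> \<epsilon>"
    and tails: "\<And>ks ls. js = ks @ ls \<Longrightarrow>
      measure (PiM (set ls) N) {\<omega>\<in>space (PiM (set ls) N). \<epsilon> < norm (\<Sum>j\<in>set ls. \<omega> j)} \<le> \<alpha>"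
    and "norm d \<le> 2 * \<epsilon>"
  shows "(1 - \<alpha>) * measure (PiM (set js) N) {\<omega>\<in>space (PiM (set js) N). Suc p \<le> exits (2 * \<epsilon>) d (map \<omega> js)}
    \<le> (\<alpha> / (1 - \<alpha>)) ^ p * measure (PiM (set js) N) {\<omega>\<in>space (PiM (set js) N). \<epsilon> < norm (d + (\<Sum>j\<in>set js. \<omega> j))}"
  using assms(2,6,7)
proof (induction js arbitrary: d p)
  case Nil
  then show ?case using assms(3,4) by simp
next
  case (Cons i js)
  let ?c = "\<alpha> / (1 - \<alpha>)"
  interpret product_sigma_finite N
    unfolding product_sigma_finite_def using borel_probD(4)[OF N] by blast
  let ?Q = "PiM (set js) N" and ?P = "PiM (insert i (set js)) N"
  interpret Q: prob_space ?Q using N by (intro prob_space_PiM_borel_prob) auto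
  interpret P: prob_space ?P using N by (intro prob_space_PiM_borel_prob) auto
  note [measurable_cong] = borel_probD(2)[OF N]
  have i: "i \<notin> set js" "distinct js" using Cons.prems(1) by auto
  have comp[measurable]: "(\<lambda>\<omega>. \<omega> j) \<in> borel_measurable (PiM S N)" if "j \<in> S" for j and S :: "'i set"
    using measurable_component_singleton[OF that, of N]
    by (simp add: measurable_cong_sets[OF refl borel_probD(2)[OF N]])
  have mQ[measurable]: "(\<lambda>\<omega>. exits e d (map \<omega> js)) \<in> ?Q \<rightarrow>\<^sub>M count_space UNIV" for e d
    by (rule measurable_exits[where X="\<lambda>j \<omega>. \<omega> j"]) (auto intro: comp)
  have mP[measurable]: "(\<lambda>\<omega>. exits e d (map \<omega> (i # js))) \<in> ?P \<rightarrow>\<^sub>M count_space UNIV" for e d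
    by (rule measurable_exits[where X="\<lambda>j \<omega>. \<omega> j"]) (auto intro: comp)
  have tails': "measure (PiM (set ls) N) {\<omega>\<in>space (PiM (set ls) N). \<epsilon> < norm (\<Sum>j\<in>set ls. \<omega> j)} \<le> \<alpha>"
    if "js = ks @ ls" for ks ls
    using Cons.prems(2)[of "i # ks" ls] that by simp
  have IH: "(1 - \<alpha>) * Q.prob {\<omega>\<in>space ?Q. Suc q \<le> exits (2 * \<epsilon>) d' (map \<omega> js)}
      \<le> ?c ^ q * Q.prob {\<omega>\<in>space ?Q. \<epsilon> < norm (d' + (\<Sum>j\<in>set js. \<omega> j))}"
    if "norm d' \<le> 2 * \<epsilon>" for d' q
    by (rule Cons.IH[OF i(2) tails' that])
  have tail: "Q.prob {\<omega>\<in>space ?Q. \<epsilon> < norm (\<Sum>j\<in>set js. \<omega> j)} \<le> \<alpha>"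
    using tails'[of "[]" js] by simp
  have c: "0 \<le> ?c" using assms(3,4) by simp
  \<comment> \<open>The walk restarted at 0: its endpoint exceeds \<open>\<epsilon>\<close> with
    probability at most \<open>\<alpha>\<close>, which turns the power \<open>r\<close> of the ratio
    into the power \<open>Suc r\<close>.\<close>
  have count: "Q.prob {\<omega>\<in>space ?Q. q \<le> exits (2 * \<epsilon>) 0 (map \<omega> js)} \<le> ?c ^ q" for q
  proof (cases q)
    case (Suc r)
    have "(1 - \<alpha>) * Q.prob {\<omega>\<in>space ?Q. Suc r \<le> exits (2 * \<epsilon>) 0 (map \<omega> js)} \<le> ?c ^ r * \<alpha>"
      using IH[of 0 r] assms(5) tail c by (simp add: mult_left_mono order_trans[OF _ mult_left_mono])
    then show ?thesis using assms(4) Suc by (simp add: field_simps)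
  qed (auto simp: Q.prob_le_1)
  \<comment> \<open>The claim for a fixed first increment \<open>y\<close>. Without an exit it is
    the induction hypothesis at \<open>d + y\<close>, which is why the bound must keep the endpoint
    event. After an exit the walk is beyond \<open>2 * \<epsilon>\<close>, and with probability at
    least \<open>1 - \<alpha>\<close> the remaining steps move it by at most
    \<open>\<epsilon>\<close>, so the endpoint event occurs anyway; \<open>count\<close> bounds the
    remaining exits.\<close>
  have key: "(1 - \<alpha>) * Q.prob {\<omega>\<in>space ?Q. Suc p \<le> exits (2 * \<epsilon>) d (y # map \<omega> js)}
    \<le> ?c ^ p * Q.prob {\<omega>\<in>space ?Q. \<epsilon> < norm (d + (y + (\<Sum>j\<in>set js. \<omega> j)))}" for y
  proof (cases "2 * \<epsilon> < norm (d + y)")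
    case False
    then show ?thesis using IH[of "d + y" p] by (simp add: add.assoc)
  next
    case True
    have "1 - \<alpha> \<le> 1 - Q.prob {\<omega>\<in>space ?Q. \<epsilon> < norm (\<Sum>j\<in>set js. \<omega> j)}" using tail by simp
    also have "\<dots> = Q.prob (space ?Q - {\<omega>\<in>space ?Q. \<epsilon> < norm (\<Sum>j\<in>set js. \<omega> j)})"
      by (subst Q.prob_compl) auto
    also have "\<dots> \<le> Q.prob {\<omega>\<in>space ?Q. \<epsilon> < norm (d + (y + (\<Sum>j\<in>set js. \<omega> j)))}"
    proof (rule Q.finite_measure_mono)
      show "space ?Q - {\<omega>\<in>space ?Q. \<epsilon> < norm (\<Sum>j\<in>set js. \<omega> j)}
        \<subseteq> {\<omega>\<in>space ?Q. \<epsilon> < norm (d + (y + (\<Sum>j\<in>set js. \<omega> j)))}"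
      proof safe
        fix \<omega> :: "'i \<Rightarrow> 'a" assume "\<not> \<epsilon> < norm (\<Sum>j\<in>set js. \<omega> j)"
        then show "\<epsilon> < norm (d + (y + (\<Sum>j\<in>set js. \<omega> j)))"
          using True norm_triangle_ineq4[of "d + (y + (\<Sum>j\<in>set js. \<omega> j))" "\<Sum>j\<in>set js. \<omega> j"]
          by (simp add: algebra_simps)
      qed
    qed measurable
    finally have "?c ^ p * (1 - \<alpha>) \<le> ?c ^ p * Q.prob {\<omega>\<in>space ?Q. \<epsilon> < norm (d + (y + (\<Sum>j\<in>set js. \<omega> j)))}"
      using c by (intro mult_left_mono) auto
    moreover have "(1 - \<alpha>) * Q.prob {\<omega>\<in>space ?Q. p \<le> exits (2 * \<epsilon>) 0 (map \<omega> js)} \<le> (1 - \<alpha>) * ?c ^ p"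
      using count assms(4) by (intro mult_left_mono) auto
    ultimately show ?thesis using True by (simp add: mult.commute)
  qed
  have slice: "(\<integral>\<^sup>+\<omega>. indicator {\<omega>\<in>space ?P. R \<omega>} (fun_upd \<omega> i y) \<partial>?Q)
      = ennreal (Q.prob {\<omega>\<in>space ?Q. R (fun_upd \<omega> i y)})"
    if [measurable]: "Measurable.pred ?P R" for R y
  proof -
    have [measurable]: "(\<lambda>\<omega>. fun_upd \<omega> i y) \<in> ?Q \<rightarrow>\<^sub>M ?P"
      by (rule measurable_fun_upd[where J="set js"]) (auto simp: borel_probD(3)[OF N])
    have "(\<integral>\<^sup>+\<omega>. indicator {\<omega>\<in>space ?P. R \<omega>} (fun_upd \<omega> i y) \<partial>?Q)
        = (\<integral>\<^sup>+\<omega>. indicator {\<omega>\<in>space ?Q. R (fun_upd \<omega> i y)} \<omega> \<partial>?Q)"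
      by (intro nn_integral_cong)
        (auto simp: indicator_def space_PiM borel_probD(3)[OF N] PiE_def extensional_def)
    also have "\<dots> = ennreal (Q.prob {\<omega>\<in>space ?Q. R (fun_upd \<omega> i y)})"
      by (simp add: Q.emeasure_eq_measure)
    finally show ?thesis .
  qed
  have meas_slice: "(\<lambda>y. ennreal (Q.prob {\<omega>\<in>space ?Q. R (fun_upd \<omega> i y)})) \<in> borel_measurable (N i)"
    if R[measurable]: "Measurable.pred ?P R" for R
  proof -
    have [measurable]: "(\<lambda>z. fun_upd (snd z) i (fst z)) \<in> N i \<Otimes>\<^sub>M ?Q \<rightarrow>\<^sub>M ?P"
      by (rule measurable_fun_upd[where J="set js"]) auto
    have "(\<lambda>y. \<integral>\<^sup>+\<omega>. indicator {\<omega>\<in>space ?P. R \<omega>} (fun_upd \<omega> i y) \<partial>?Q) \<in> borel_measurable (N i)"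
      by (intro Q.borel_measurable_nn_integral) (simp add: split_beta')
    then show ?thesis by (simp only: slice[OF R])
  qed
  have peel: "emeasure ?P {\<omega>\<in>space ?P. R \<omega>} = (\<integral>\<^sup>+y. ennreal (Q.prob {\<omega>\<in>space ?Q. R (fun_upd \<omega> i y)}) \<partial>N i)"
    if R[measurable]: "Measurable.pred ?P R" for R
  proof -
    have "emeasure ?P {\<omega>\<in>space ?P. R \<omega>} = (\<integral>\<^sup>+\<omega>. indicator {\<omega>\<in>space ?P. R \<omega>} \<omega> \<partial>?P)"
      by simp
    also have "\<dots> = (\<integral>\<^sup>+y. (\<integral>\<^sup>+\<omega>. indicator {\<omega>\<in>space ?P. R \<omega>} (fun_upd \<omega> i y) \<partial>?Q) \<partial>N i)"
      using i by (intro product_nn_integral_insert_rev) auto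
    finally show ?thesis by (simp only: slice[OF R])
  qed
  have upd: "map (fun_upd \<omega> i y) js = map \<omega> js" "(\<Sum>j\<in>insert i (set js). fun_upd \<omega> i y j) = y + (\<Sum>j\<in>set js. \<omega> j)"
    for \<omega> :: "'i \<Rightarrow> 'a" and y
    using i by (auto intro!: sum.cong)
  have R1: "Measurable.pred ?P (\<lambda>\<omega>. Suc p \<le> exits (2 * \<epsilon>) d (map \<omega> (i # js)))"
    using mP by measurable
  have R2: "Measurable.pred ?P (\<lambda>\<omega>. \<epsilon> < norm (d + (\<Sum>j\<in>insert i (set js). \<omega> j)))"
    by measurable
  have "ennreal (1 - \<alpha>) * emeasure ?P {\<omega>\<in>space ?P. Suc p \<le> exits (2 * \<epsilon>) d (map \<omega> (i # js))}
      = (\<integral>\<^sup>+y. ennreal (1 - \<alpha>) * ennreal (Q.prob {\<omega>\<in>space ?Q. Suc p \<le> exits (2 * \<epsilon>) d (map (fun_upd \<omega> i y) (i # js))}) \<partial>N i)"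
    unfolding peel[OF R1] by (rule nn_integral_cmult[symmetric, OF meas_slice[OF R1]])
  also have "\<dots> \<le> (\<integral>\<^sup>+y. ennreal (?c ^ p) * ennreal (Q.prob {\<omega>\<in>space ?Q. \<epsilon> < norm (d + (\<Sum>j\<in>insert i (set js). fun_upd \<omega> i y j))}) \<partial>N i)"
  proof (rule nn_integral_mono)
    fix y
    show "ennreal (1 - \<alpha>) * ennreal (Q.prob {\<omega>\<in>space ?Q. Suc p \<le> exits (2 * \<epsilon>) d (map (fun_upd \<omega> i y) (i # js))})
      \<le> ennreal (?c ^ p) * ennreal (Q.prob {\<omega>\<in>space ?Q. \<epsilon> < norm (d + (\<Sum>j\<in>insert i (set js). fun_upd \<omega> i y j))})"
      unfolding upd list.map fun_upd_same using key[of y] assms(4) c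
      by (simp only: ennreal_mult'[symmetric] zero_le_power measure_nonneg ennreal_leI diff_ge_0_iff_ge less_imp_le)
  qed
  also have "\<dots> = ennreal (?c ^ p) * emeasure ?P {\<omega>\<in>space ?P. \<epsilon> < norm (d + (\<Sum>j\<in>insert i (set js). \<omega> j))}"
    unfolding peel[OF R2] by (rule nn_integral_cmult[OF meas_slice[OF R2]])
  finally have "ennreal ((1 - \<alpha>) * P.prob {\<omega>\<in>space ?P. Suc p \<le> exits (2 * \<epsilon>) d (map \<omega> (i # js))})
    \<le> ennreal (?c ^ p * P.prob {\<omega>\<in>space ?P. \<epsilon> < norm (d + (\<Sum>j\<in>insert i (set js). \<omega> j))})"
    using assms(4) c by (simp only: P.emeasure_eq_measure ennreal_mult'[symmetric] zero_le_power measure_nonneg)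
  then show ?case
    using assms(4) c by (simp only: list.set ennreal_le_iff mult_nonneg_nonneg zero_le_power measure_nonneg)
qed

text \<open>The same count read off the values of a path instead of its increments, with reference
  value \<open>r\<close>; values are what chains of large jumps are compared with.\<close>

fun resets :: "real \<Rightarrow> 'a::real_normed_vector \<Rightarrow> 'a list \<Rightarrow> nat" where
  "resets e r [] = 0"
| "resets e r (z # zs) = (if e < norm (z - r) then Suc (resets e z zs) else resets e r zs)"

lemma resets_eq_exits:
  "k \<le> n \<Longrightarrow> resets e r (map z [Suc k..<Suc n]) = exits e (z k - r) (map (\<lambda>i. z (Suc i) - z i) [k..<n])"
proof (induction "n - k" arbitrary: k r)
  case (Suc m)
  then have k: "k < n" "m = n - Suc k" by auto
  have "[Suc k..<Suc n] = Suc k # [Suc (Suc k)..<Suc n]" "[k..<n] = k # [Suc k..<n]"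
    using k by (auto simp: upt_conv_Cons simp del: upt_Suc)
  moreover have "resets e r' (map z [Suc (Suc k)..<Suc n])
      = exits e (z (Suc k) - r') (map (\<lambda>i. z (Suc i) - z i) [Suc k..<n])" for r'
    using Suc.hyps(1)[of "Suc k" r'] k by simp
  ultimately show ?case by (simp del: upt_Suc)
qed simp

text \<open>Two values more than \<open>2 * e\<close> apart cannot both lie within \<open>e\<close>
  of one reference value, so every jump of the chain forces a reset. The first chain element may
  come without one, hence \<open>Suc\<close>; the second statement, where a previous element
  \<open>v\<close> is already near \<open>r\<close>, is the form that the induction needs.\<close>

lemma chain_le_resets:
  fixes zs :: "'a::real_normed_vector list"
  assumes "0 \<le> e"
  shows "subseq ws zs \<Longrightarrow> successively (\<lambda>x y. 2 * e < dist x y) ws \<Longrightarrow> length ws \<le> Suc (resets e r zs)"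
    and "subseq ws zs \<Longrightarrow> successively (\<lambda>x y. 2 * e < dist x y) (v # ws) \<Longrightarrow> dist v r \<le> e \<Longrightarrow>
      length ws \<le> resets e r zs"
proof (induction zs arbitrary: ws r v)
  case (Cons z zs)
  {
    case 1
    consider "subseq ws zs" | ws' where "ws = z # ws'" "subseq ws' zs"
      using 1(1) by (cases rule: list_emb.cases) auto
    then show ?case
    proof cases
      case 1
      then show ?thesis using Cons.IH(1)[OF 1 \<open>successively _ ws\<close>] by (auto intro: le_SucI)
    next
      case 2
      then show ?thesis
        using Cons.IH(2)[OF 2(2), of z z] Cons.IH(2)[OF 2(2), of z r] 1(2) \<open>0 \<le> e\<close>
        by (auto simp: dist_norm)
    qed
  next
    case 2
    consider "subseq ws zs" | ws' where "ws = z # ws'" "subseq ws' zs"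
      using 2(1) by (cases rule: list_emb.cases) auto
    then show ?case
    proof cases
      case 1
      have "successively (\<lambda>x y. 2 * e < dist x y) ws" using 2(2) by (cases ws) auto
      then show ?thesis using Cons.IH(1)[OF 1, of z] Cons.IH(2)[OF 1 2(2,3)] by auto
    next
      case ws: 2
      have "2 * e < dist v z" "successively (\<lambda>x y. 2 * e < dist x y) (z # ws')" using 2(2) ws by auto
      moreover from this(1) have "e < norm (z - r)"
        using 2(3) dist_triangle[of v z r] by (simp add: dist_norm norm_minus_commute)
      ultimately show ?thesis using Cons.IH(2)[OF ws(2), of z z] ws \<open>0 \<le> e\<close> by auto
    qed
  }
qed (auto dest: list_emb_Nil2)

section \<open>One-sided limits along rational times\<close>

text \<open>\<open>p\<close> counts the jumps, so there are \<open>Suc p\<close> times.\<close>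

definition oscillates :: "real \<Rightarrow> nat \<Rightarrow> real set \<Rightarrow> (real \<Rightarrow> 'a::metric_space) \<Rightarrow> bool" where
  "oscillates e p S z \<longleftrightarrow> (\<exists>ts. length ts = Suc p \<and> sorted_wrt (<) ts \<and> set ts \<subseteq> S \<and>
     successively (\<lambda>s t. e < dist (z s) (z t)) ts)"

lemma oscillates_mono: "oscillates e p S z \<Longrightarrow> S \<subseteq> S' \<Longrightarrow> oscillates e p S' z"
  unfolding oscillates_def by blast

lemma cauchy_filter_convergesE:
  fixes z :: "'b \<Rightarrow> 'a::complete_space"
  assumes "F \<noteq> bot"
    and "\<And>e. e > 0 \<Longrightarrow> \<exists>P. eventually P F \<and> (\<forall>u v. P u \<and> P v \<longrightarrow> dist (z u) (z v) < e)"
  obtains l where "(z \<longlongrightarrow> l) F"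
proof -
  have "cauchy_filter (filtermap z F)"
    using assms(2) by (simp add: cauchy_filter_metric_filtermap)
  moreover have "filtermap z F \<noteq> bot" using assms(1) by (simp add: filtermap_bot_iff)
  ultimately obtain l where "filtermap z F \<le> nhds l"
    using cauchy_filter_complete_converges[of "filtermap z F" UNIV] complete_UNIV by auto
  then show ?thesis using that by (simp add: filterlim_def)
qed

definition rat_times :: "real set" where
  "rat_times = \<rat> \<inter> {0..}"

lemma rat_times_between:
  assumes "0 \<le> s" "s < t"
  obtains u where "u \<in> rat_times" "s < u" "u < t"
  using Rats_dense_in_real[OF assms(2)] assms(1) by (auto simp: rat_times_def)

lemma at_within_rat_times_ne_bot:
  "0 \<le> t \<Longrightarrow> at t within (rat_times \<inter> {t<..}) \<noteq> bot"
  "0 < t \<Longrightarrow> at t within (rat_times \<inter> {..<t}) \<noteq> bot"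
proof -
  show "at t within (rat_times \<inter> {t<..}) \<noteq> bot" if t: "0 \<le> t"
    unfolding trivial_limit_within islimpt_approachable
  proof safe
    fix e :: real assume "0 < e"
    then obtain u where "u \<in> rat_times" "t < u" "u < t + e"
      using rat_times_between[OF t, of "t + e"] by auto
    then show "\<exists>x'\<in>rat_times \<inter> {t<..}. x' \<noteq> t \<and> dist x' t < e"
      by (intro bexI[of _ u]) (auto simp: dist_real_def)
  qed
  show "at t within (rat_times \<inter> {..<t}) \<noteq> bot" if t: "0 < t"
    unfolding trivial_limit_within islimpt_approachable
  proof safe
    fix e :: real assume "0 < e"
    then obtain u where "u \<in> rat_times" "max 0 (t - e) < u" "u < t"
      using rat_times_between[of "max 0 (t - e)" t] t by auto
    then show "\<exists>x'\<in>rat_times \<inter> {..<t}. x' \<noteq> t \<and> dist x' t < e"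
      by (intro bexI[of _ u]) (auto simp: dist_real_def)
  qed
qed

text \<open>A bound on the number of \<open>e\<close>-jumps near every time is a condition on
  countably many times, and it is strong enough to yield limits from both sides.\<close>

definition regular :: "(real \<Rightarrow> 'a::metric_space) \<Rightarrow> bool" where
  "regular z \<longleftrightarrow> (\<forall>t\<ge>0. \<forall>e>0. \<exists>a b p. a < t \<and> t < b \<and> \<not> oscillates e p (rat_times \<inter> {a..b}) z)"

text \<open>If the Cauchy condition failed to the right of \<open>t\<close>, a chain of jumps could
  be extended at its front forever, each time by a point still closer to \<open>t\<close>.\<close>

lemma regular_right_limit:
  fixes z :: "real \<Rightarrow> 'a::complete_space"
  assumes "regular z" "0 \<le> t"
  obtains l where "(z \<longlongrightarrow> l) (at t within (rat_times \<inter> {t<..}))"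
proof (rule cauchy_filter_convergesE[OF at_within_rat_times_ne_bot(1)[OF assms(2)], of z])
  fix e :: real assume "0 < e"
  show "\<exists>P. eventually P (at t within (rat_times \<inter> {t<..})) \<and> (\<forall>u v. P u \<and> P v \<longrightarrow> dist (z u) (z v) < e)"
  proof (rule ccontr)
    assume no: "\<not> ?thesis"
    have step: "\<exists>u v. u \<in> rat_times \<inter> {t<..<x} \<and> v \<in> rat_times \<inter> {t<..<x} \<and> e \<le> dist (z u) (z v)" if "t < x" for x
    proof (rule ccontr)
      assume contra: "\<not> ?thesis"
      have ev: "eventually (\<lambda>u. u \<in> rat_times \<inter> {t<..<x}) (at t within (rat_times \<inter> {t<..}))"
        unfolding eventually_at using that by (intro exI[of _ "x - t"]) (auto simp: dist_real_def)
      have "\<forall>u v. u \<in> rat_times \<inter> {t<..<x} \<and> v \<in> rat_times \<inter> {t<..<x} \<longrightarrow> dist (z u) (z v) < e"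
        using contra by (auto simp: not_le)
      then show False
        by (rule notE[OF no, OF exI[of _ "\<lambda>u. u \<in> rat_times \<inter> {t<..<x}"], OF conjI[OF ev]])
    qed
    obtain a b p where ab: "a < t" "t < b" "\<not> oscillates (e / 3) p (rat_times \<inter> {a..b}) z"
      using assms(1)[unfolded regular_def, rule_format, of t "e / 3"] assms(2) \<open>0 < e\<close> by auto
    have "\<exists>ts. length ts = Suc q \<and> sorted_wrt (<) ts \<and> set ts \<subseteq> rat_times \<inter> {t<..<b} \<and>
        successively (\<lambda>s t. e / 3 < dist (z s) (z t)) ts" for q
    proof (induction q)
      case 0
      obtain u where "u \<in> rat_times \<inter> {t<..<b}" using step[OF ab(2)] by blast
      then show ?case by (intro exI[of _ "[u]"]) auto
    next
      case (Suc q)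
      then obtain ts' where ts': "length ts' = Suc q" "sorted_wrt (<) ts'" "set ts' \<subseteq> rat_times \<inter> {t<..<b}"
        "successively (\<lambda>s t. e / 3 < dist (z s) (z t)) ts'" by blast
      then obtain x ts where ts'_eq: "ts' = x # ts" by (cases ts') auto
      have ts: "length (x # ts) = Suc q" "sorted_wrt (<) (x # ts)" "set (x # ts) \<subseteq> rat_times \<inter> {t<..<b}"
        "successively (\<lambda>s t. e / 3 < dist (z s) (z t)) (x # ts)"
        using ts' by (auto simp: ts'_eq)
      obtain u v where uv: "u \<in> rat_times \<inter> {t<..<x}" "v \<in> rat_times \<inter> {t<..<x}" "e \<le> dist (z u) (z v)"
        using step[of x] ts(3) by auto
      \<comment> \<open>Of two values at distance at least \<open>e\<close>, one is more than
        \<open>e / 3\<close> away from any third.\<close>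
      have "e / 3 < dist (z u) (z x) \<or> e / 3 < dist (z v) (z x)"
        using uv(3) dist_triangle2[of "z u" "z v" "z x"] \<open>0 < e\<close> by linarith
      then obtain w where w: "w \<in> rat_times \<inter> {t<..<x}" "e / 3 < dist (z w) (z x)" using uv by blast
      then show ?case using ts by (intro exI[of _ "w # x # ts"]) auto
    qed
    from this[of p] have "oscillates (e / 3) p (rat_times \<inter> {t<..<b}) z"
      unfolding oscillates_def .
    then have "oscillates (e / 3) p (rat_times \<inter> {a..b}) z"
      by (rule oscillates_mono) (use ab in auto)
    with ab show False by blast
  qed
qed (use that in blast)

text \<open>The mirror image: the chain grows at its end, towards \<open>t\<close> from the
  left.\<close>

lemma regular_left_limit:
  fixes z :: "real \<Rightarrow> 'a::complete_space"
  assumes "regular z" "0 < t"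
  obtains l where "(z \<longlongrightarrow> l) (at t within (rat_times \<inter> {..<t}))"
proof (rule cauchy_filter_convergesE[OF at_within_rat_times_ne_bot(2)[OF assms(2)], of z])
  fix e :: real assume "0 < e"
  show "\<exists>P. eventually P (at t within (rat_times \<inter> {..<t})) \<and> (\<forall>u v. P u \<and> P v \<longrightarrow> dist (z u) (z v) < e)"
  proof (rule ccontr)
    assume no: "\<not> ?thesis"
    have step: "\<exists>u v. u \<in> rat_times \<inter> {x<..<t} \<and> v \<in> rat_times \<inter> {x<..<t} \<and> e \<le> dist (z u) (z v)" if "x < t" for x
    proof (rule ccontr)
      assume contra: "\<not> ?thesis"
      have ev: "eventually (\<lambda>u. u \<in> rat_times \<inter> {x<..<t}) (at t within (rat_times \<inter> {..<t}))"
        unfolding eventually_at using that by (intro exI[of _ "t - x"]) (auto simp: dist_real_def)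
      have "\<forall>u v. u \<in> rat_times \<inter> {x<..<t} \<and> v \<in> rat_times \<inter> {x<..<t} \<longrightarrow> dist (z u) (z v) < e"
        using contra by (auto simp: not_le)
      then show False
        by (rule notE[OF no, OF exI[of _ "\<lambda>u. u \<in> rat_times \<inter> {x<..<t}"], OF conjI[OF ev]])
    qed
    obtain a b p where ab: "a < t" "t < b" "\<not> oscillates (e / 3) p (rat_times \<inter> {a..b}) z"
      using assms(1)[unfolded regular_def, rule_format, of t "e / 3"] assms(2) \<open>0 < e\<close> by auto
    have "\<exists>ts. length ts = Suc q \<and> sorted_wrt (<) ts \<and> set ts \<subseteq> rat_times \<inter> {a<..<t} \<and>
        successively (\<lambda>s t. e / 3 < dist (z s) (z t)) ts" for q
    proof (induction q)
      case 0
      obtain u where "u \<in> rat_times \<inter> {a<..<t}" using step[OF ab(1)] by blast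
      then show ?case by (intro exI[of _ "[u]"]) auto
    next
      case (Suc q)
      then obtain ts' where ts': "length ts' = Suc q" "sorted_wrt (<) ts'" "set ts' \<subseteq> rat_times \<inter> {a<..<t}"
        "successively (\<lambda>s t. e / 3 < dist (z s) (z t)) ts'" by blast
      then obtain x ts where ts'_eq: "ts' = ts @ [x]" by (cases ts' rule: rev_cases) auto
      have ts: "length (ts @ [x]) = Suc q" "sorted_wrt (<) (ts @ [x])" "set (ts @ [x]) \<subseteq> rat_times \<inter> {a<..<t}"
        "successively (\<lambda>s t. e / 3 < dist (z s) (z t)) (ts @ [x])"
        using ts' by (auto simp: ts'_eq)
      obtain u v where uv: "u \<in> rat_times \<inter> {x<..<t}" "v \<in> rat_times \<inter> {x<..<t}" "e \<le> dist (z u) (z v)"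
        using step[of x] ts(3) by auto
      have "e / 3 < dist (z x) (z u) \<or> e / 3 < dist (z x) (z v)"
        using uv(3) dist_triangle3[of "z u" "z v" "z x"] \<open>0 < e\<close> by linarith
      then obtain w where w: "w \<in> rat_times \<inter> {x<..<t}" "e / 3 < dist (z x) (z w)" using uv by blast
      then show ?case using ts
        by (intro exI[of _ "(ts @ [x]) @ [w]"]) (auto simp: sorted_wrt_append successively_append_iff)
    qed
    from this[of p] have "oscillates (e / 3) p (rat_times \<inter> {a<..<t}) z"
      unfolding oscillates_def .
    then have "oscillates (e / 3) p (rat_times \<inter> {a..b}) z"
      by (rule oscillates_mono) (use ab in auto)
    with ab show False by blast
  qed
qed (use that in blast)

definition right_limits :: "(real \<Rightarrow> 'a::t2_space) \<Rightarrow> real \<Rightarrow> 'a" where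
  "right_limits z t = Lim (at t within (rat_times \<inter> {t<..})) z"

lemma right_limits_tendsto:
  fixes z :: "real \<Rightarrow> 'a::complete_space"
  assumes "regular z" "0 \<le> t"
  shows "(z \<longlongrightarrow> right_limits z t) (at t within (rat_times \<inter> {t<..}))"
proof -
  obtain l where "(z \<longlongrightarrow> l) (at t within (rat_times \<inter> {t<..}))"
    using regular_right_limit[OF assms] .
  then show ?thesis
    unfolding right_limits_def using tendsto_Lim[OF at_within_rat_times_ne_bot(1)[OF assms(2)]] by metis
qed

text \<open>A closed bound along rational times passes to right limits; right continuity and left
  limits both come down to this.\<close>

lemma dist_right_limits_le:
  fixes z :: "real \<Rightarrow> 'a::complete_space"
  assumes "regular z" "0 \<le> s" "s < b" "\<And>u. u \<in> rat_times \<Longrightarrow> s < u \<Longrightarrow> u < b \<Longrightarrow> dist (z u) l \<le> e"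
  shows "dist (right_limits z s) l \<le> e"
proof (rule tendsto_upperbound)
  show "((\<lambda>u. dist (z u) l) \<longlongrightarrow> dist (right_limits z s) l) (at s within (rat_times \<inter> {s<..}))"
    by (intro tendsto_intros right_limits_tendsto assms)
  show "\<forall>\<^sub>F u in at s within (rat_times \<inter> {s<..}). dist (z u) l \<le> e"
    unfolding eventually_at using assms(3,4) by (intro exI[of _ "b - s"], auto simp: dist_real_def)
  show "at s within (rat_times \<inter> {s<..}) \<noteq> bot"
    by (rule at_within_rat_times_ne_bot) fact
qed

lemma cadlag_right_limits:
  fixes z :: "real \<Rightarrow> 'a::complete_space"
  assumes "regular z"
  shows "cadlag (right_limits z)"
  unfolding cadlag_def
proof (intro conjI allI impI)
  fix t :: real assume t: "0 \<le> t"
  show "(right_limits z \<longlongrightarrow> right_limits z t) (at_right t)"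
  proof (rule tendstoI)
    fix e :: real assume "0 < e"
    then have "\<forall>\<^sub>F u in at t within (rat_times \<inter> {t<..}). dist (z u) (right_limits z t) < e / 2"
      using right_limits_tendsto[OF assms t] by (intro tendstoD) auto
    then obtain d where d: "0 < d" "\<And>u. u \<in> rat_times \<Longrightarrow> t < u \<Longrightarrow> dist u t < d \<Longrightarrow> dist (z u) (right_limits z t) < e / 2"
      unfolding eventually_at by auto
    have "dist (right_limits z s) (right_limits z t) \<le> e / 2" if "t < s" "s < t + d" for s
      using that t d(2) by (intro dist_right_limits_le[OF assms, where b="t + d"]) (auto simp: dist_real_def less_imp_le)
    then have "dist (right_limits z s) (right_limits z t) < e" if "t < s" "s < t + d" for s
      using that \<open>0 < e\<close> by fastforce
    then show "\<forall>\<^sub>F s in at_right t. dist (right_limits z s) (right_limits z t) < e"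
      unfolding eventually_at using d(1) by (intro exI[of _ d], auto simp: dist_real_def)
  qed
next
  fix t :: real assume t: "0 < t"
  obtain l where l: "(z \<longlongrightarrow> l) (at t within (rat_times \<inter> {..<t}))"
    using regular_left_limit[OF assms t] .
  have "(right_limits z \<longlongrightarrow> l) (at_left t)"
  proof (rule tendstoI)
    fix e :: real assume "0 < e"
    then have "\<forall>\<^sub>F u in at t within (rat_times \<inter> {..<t}). dist (z u) l < e / 2"
      using l by (intro tendstoD) auto
    then obtain d where d: "0 < d" "\<And>u. u \<in> rat_times \<Longrightarrow> u < t \<Longrightarrow> dist u t < d \<Longrightarrow> dist (z u) l < e / 2"
      unfolding eventually_at by auto
    have "dist (right_limits z s) l \<le> e / 2" if "max 0 (t - d) < s" "s < t" for s
      using that t d(2) by (intro dist_right_limits_le[OF assms, where b=t]) (auto simp: dist_real_def less_imp_le)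
    then have "dist (right_limits z s) l < e" if "max 0 (t - d) < s" "s < t" for s
      using that \<open>0 < e\<close> by fastforce
    \<comment> \<open>\<open>min d t\<close> keeps \<open>s\<close> positive, where right limits are
      known to exist.\<close>
    then show "\<forall>\<^sub>F s in at_left t. dist (right_limits z s) l < e"
      unfolding eventually_at using d(1) t by (intro exI[of _ "min d t"], auto simp: dist_real_def)
  qed
  then show "\<exists>l. (right_limits z \<longlongrightarrow> l) (at_left t)" ..
qed

section \<open>The cadlag version\<close>

locale increments_process = convolution_hemigroup \<mu> + prob_space M
  for \<mu> :: "real \<Rightarrow> real \<Rightarrow> 'a::{banach, second_countable_topology} measure" and M :: "'w measure" +
  fixes Z :: "real \<Rightarrow> 'w \<Rightarrow> 'a"
  assumes Z_meas: "0 \<le> s \<Longrightarrow> Z s \<in> borel_measurable M"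
    and Z_increments: "0 \<le> t 0 \<Longrightarrow> (\<And>i. i < n \<Longrightarrow> t i < t (Suc i)) \<Longrightarrow>
      distr M (PiM {..<n} (\<lambda>_. borel)) (\<lambda>\<omega>. \<lambda>i\<in>{..<n}. Z (t (Suc i)) \<omega> - Z (t i) \<omega>)
      = PiM {..<n} (\<lambda>i. \<mu> (t i) (t (Suc i)))"
begin

lemma Z_increment:
  assumes "0 \<le> s" "s < t"
  shows "distr M borel (\<lambda>\<omega>. Z t \<omega> - Z s \<omega>) = \<mu> s t"
proof -
  define \<tau> where "\<tau> i = (if i = 0 then s else t)" for i :: nat
  have meas: "(\<lambda>\<omega>. \<lambda>i\<in>{..<1}. Z (\<tau> (Suc i)) \<omega> - Z (\<tau> i) \<omega>) \<in> M \<rightarrow>\<^sub>M PiM {..<1::nat} (\<lambda>_. borel)"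
    using assms Z_meas by (intro measurable_restrict) (auto simp: \<tau>_def)
  have "distr M borel (\<lambda>\<omega>. Z t \<omega> - Z s \<omega>) = distr M borel (\<lambda>\<omega>. (\<lambda>i\<in>{..<1}. Z (\<tau> (Suc i)) \<omega> - Z (\<tau> i) \<omega>) 0)"
    by (simp add: \<tau>_def)
  also have "\<dots> = distr (distr M (PiM {..<1} (\<lambda>_. borel)) (\<lambda>\<omega>. \<lambda>i\<in>{..<1}. Z (\<tau> (Suc i)) \<omega> - Z (\<tau> i) \<omega>)) borel (\<lambda>\<omega>. \<omega> 0)"
    using meas by (subst distr_distr) (auto simp: comp_def)
  also have "\<dots> = distr (PiM {..<1} (\<lambda>i. \<mu> (\<tau> i) (\<tau> (Suc i)))) borel (\<lambda>\<omega>. \<omega> 0)"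
    using assms by (subst Z_increments) (auto simp: \<tau>_def)
  also have "\<dots> = distr (PiM {..<1} (\<lambda>i. \<mu> (\<tau> i) (\<tau> (Suc i)))) (\<mu> s t) (\<lambda>\<omega>. \<omega> 0)"
    using assms by (intro distr_cong) (auto simp: borel_probD(2)[OF borel_prob_mu])
  also have "\<dots> = distr (PiM {..<1} (\<lambda>i. \<mu> (\<tau> i) (\<tau> (Suc i)))) (\<mu> (\<tau> 0) (\<tau> (Suc 0))) (\<lambda>\<omega>. \<omega> 0)"
    by (simp add: \<tau>_def)
  also have "\<dots> = \<mu> s t"
    using assms by (subst distr_PiM_component) (auto simp: \<tau>_def intro: borel_probD(1)[OF borel_prob_mu])
  finally show ?thesis .
qed

text \<open>The increments over the sorted times of \<open>F\<close> have a product law, so the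
  bound on \<open>exits\<close> applies. The factor 4 doubles twice: jumps beyond
  \<open>4 * \<epsilon>\<close> force resets at level \<open>2 * \<epsilon>\<close>, and those are
  controlled by tails at level \<open>\<epsilon>\<close>.\<close>

lemma prob_oscillates_finite:
  assumes F: "finite F" "F \<subseteq> {a..b}" "F \<subseteq> {0..}"
    and \<alpha>: "0 \<le> \<alpha>" "\<alpha> < 1" "0 \<le> \<epsilon>"
    and small: "\<And>s t. 0 \<le> s \<Longrightarrow> a \<le> s \<Longrightarrow> s < t \<Longrightarrow> t \<le> b \<Longrightarrow> measure (\<mu> s t) {x. \<epsilon> < norm x} \<le> \<alpha>"
    and meas: "{\<omega>\<in>space M. oscillates (4 * \<epsilon>) p F (\<lambda>t. Z t \<omega>)} \<in> events"
  shows "prob {\<omega>\<in>space M. oscillates (4 * \<epsilon>) p F (\<lambda>t. Z t \<omega>)} \<le> (\<alpha> / (1 - \<alpha>)) ^ p"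
proof (cases "F = {}")
  case True
  then have empty: "{\<omega>\<in>space M. oscillates (4 * \<epsilon>) p F (\<lambda>t. Z t \<omega>)} = {}"
    by (auto simp: oscillates_def)
  show ?thesis unfolding empty using \<alpha> by simp
next
  case False
  define n where "n = card F - 1"
  have n: "card F = Suc n" using False F(1) card_gt_0_iff[of F] by (auto simp: n_def)
  define t where "t i = sorted_list_of_set F ! i" for i
  have len: "length (sorted_list_of_set F) = Suc n" using n by simp
  have t_map: "map t [0..<Suc n] = sorted_list_of_set F"
    using len by (intro nth_equalityI) (auto simp: t_def simp del: upt_Suc)
  have tF: "t i \<in> F" if "i \<le> n" for i
    using nth_mem[of i "sorted_list_of_set F"] that len F(1) by (simp add: t_def)
  have tless: "t i < t j" if "i < j" "j \<le> n" for i j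
    using strict_sorted_list_of_set[of F] that len by (auto simp: t_def sorted_wrt_iff_nth_less)
  have t0: "0 \<le> t i" if "i \<le> n" for i using tF[OF that] F(3) by auto
  define X where "X i \<omega> = Z (t (Suc i)) \<omega> - Z (t i) \<omega>" for i \<omega>
  have X[measurable]: "X i \<in> borel_measurable M" if "i < n" for i
    unfolding X_def using that by (intro borel_measurable_diff Z_meas t0) auto
  \<comment> \<open>Point masses beyond the last increment, because \<open>exits_Suc_bound\<close>
    wants a probability measure at every index.\<close>
  define N where "N i = (if i < n then \<mu> (t i) (t (Suc i)) else return borel 0)" for i
  have N: "borel_prob (N i)" for i
    using tless[of i "Suc i"] t0[of i] by (auto simp: N_def intro!: borel_prob_mu)
  note [measurable_cong] = sets_PiM_borel_prob[of _ N, OF N]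
  have law: "distr M (PiM {k..<n} (\<lambda>_. borel)) (\<lambda>\<omega>. \<lambda>i\<in>{k..<n}. X i \<omega>) = PiM {k..<n} N" for k
  proof -
    have all: "distr M (PiM {..<n} (\<lambda>_. borel)) (\<lambda>\<omega>. \<lambda>i\<in>{..<n}. X i \<omega>) = PiM {..<n} N"
      unfolding X_def using tless t0 by (subst Z_increments) (auto simp: N_def intro!: PiM_cong)
    have [measurable]: "(\<lambda>\<omega>. restrict \<omega> {k..<n}) \<in> PiM {..<n} (\<lambda>_. borel :: 'a measure) \<rightarrow>\<^sub>M PiM {k..<n} (\<lambda>_. borel)"
      by (rule measurable_restrict_subset) auto
    have [measurable]: "(\<lambda>\<omega>. \<lambda>i\<in>{..<n}. X i \<omega>) \<in> M \<rightarrow>\<^sub>M PiM {..<n} (\<lambda>_. borel)"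
      by (intro measurable_restrict X) auto
    have "distr M (PiM {k..<n} (\<lambda>_. borel)) (\<lambda>\<omega>. \<lambda>i\<in>{k..<n}. X i \<omega>)
        = distr M (PiM {k..<n} (\<lambda>_. borel)) (\<lambda>\<omega>. restrict (\<lambda>i\<in>{..<n}. X i \<omega>) {k..<n})"
      by (intro distr_cong) auto
    also have "\<dots> = distr (PiM {..<n} N) (PiM {k..<n} (\<lambda>_. borel)) (\<lambda>\<omega>. restrict \<omega> {k..<n})"
      unfolding all[symmetric] by (subst distr_distr) (auto simp: comp_def)
    also have "\<dots> = distr (PiM {..<n} N) (PiM {k..<n} N) (\<lambda>\<omega>. \<lambda>i\<in>{k..<n}. \<omega> i)"
      by (intro distr_cong) (auto simp: sets_PiM_borel_prob[of _ N, OF N])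
    also have "\<dots> = PiM {k..<n} N"
      by (intro distr_PiM_reindex[where f="\<lambda>i. i"] borel_probD(1)[OF N]) auto
    finally show ?thesis .
  qed
  have prob_PiM: "measure (PiM {k..<n} N) {\<omega>\<in>space (PiM {k..<n} N). R \<omega>} = prob {\<omega>\<in>space M. R (\<lambda>i\<in>{k..<n}. X i \<omega>)}"
    if R: "Measurable.pred (PiM {k..<n} (\<lambda>_. borel)) R" for R k
  proof -
    have "(\<lambda>\<omega>. \<lambda>i\<in>{k..<n}. X i \<omega>) \<in> M \<rightarrow>\<^sub>M PiM {k..<n} (\<lambda>_. borel)"
      by (intro measurable_restrict X) auto
    then show ?thesis
      unfolding law[symmetric] using R by (subst measure_distr) (auto intro!: arg_cong[where f=prob] simp: space_PiM)
  qed
  have telescope: "(\<Sum>i\<in>{k..<n}. X i \<omega>) = Z (t n) \<omega> - Z (t k) \<omega>" if "k \<le> n" for k \<omega>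
    unfolding X_def using sum_Suc_diff'[OF that, of "\<lambda>i. Z (t i) \<omega>"] by simp
  have tail: "measure (PiM {k..<n} N) {\<omega>\<in>space (PiM {k..<n} N). \<epsilon> < norm (\<Sum>i\<in>{k..<n}. \<omega> i)} \<le> \<alpha>" if k: "k \<le> n" for k
  proof (cases "k = n")
    case True
    then show ?thesis using \<alpha> by simp
  next
    case False
    then have k: "k < n" using k by simp
    have [measurable]: "Z (t n) \<in> borel_measurable M" "Z (t k) \<in> borel_measurable M"
      using k by (auto intro!: Z_meas t0)
    have "measure (PiM {k..<n} N) {\<omega>\<in>space (PiM {k..<n} N). \<epsilon> < norm (\<Sum>i\<in>{k..<n}. \<omega> i)}
        = prob {\<omega>\<in>space M. \<epsilon> < norm (Z (t n) \<omega> - Z (t k) \<omega>)}"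
      by (subst prob_PiM) (simp_all add: telescope less_imp_le[OF k])
    also have "\<dots> = measure (distr M borel (\<lambda>\<omega>. Z (t n) \<omega> - Z (t k) \<omega>)) {x. \<epsilon> < norm x}"
      by (subst measure_distr) (auto intro!: arg_cong[where f=prob])
    also have "\<dots> \<le> \<alpha>"
      using k tless[of k n] t0[of k] tF[of k] tF[of n] F(2) by (subst Z_increment) (auto intro!: small)
    finally show ?thesis .
  qed
  have bound: "measure (PiM {0..<n} N) {\<omega>\<in>space (PiM {0..<n} N). q \<le> exits (2 * \<epsilon>) 0 (map \<omega> [0..<n])} \<le> (\<alpha> / (1 - \<alpha>)) ^ q" for q
  proof -
    interpret Q: prob_space "PiM {0..<n} N" by (rule prob_space_PiM_borel_prob[OF N])
    show ?thesis
    proof (cases q)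
      case (Suc r)
      have "(1 - \<alpha>) * measure (PiM (set [0..<n]) N) {\<omega>\<in>space (PiM (set [0..<n]) N). Suc r \<le> exits (2 * \<epsilon>) 0 (map \<omega> [0..<n])}
        \<le> (\<alpha> / (1 - \<alpha>)) ^ r * measure (PiM (set [0..<n]) N) {\<omega>\<in>space (PiM (set [0..<n]) N). \<epsilon> < norm (0 + (\<Sum>j\<in>set [0..<n]. \<omega> j))}"
      proof (rule exits_Suc_bound[OF N _ \<alpha>(1,2,3)])
        fix ks ls assume eq: "[0..<n] = ks @ ls"
        have "length ks \<le> n" using arg_cong[OF eq, of length] by simp
        moreover have "ls = [length ks..<n]" using arg_cong[OF eq, of "drop (length ks)"] by simp
        ultimately show "measure (PiM (set ls) N) {\<omega>\<in>space (PiM (set ls) N). \<epsilon> < norm (\<Sum>j\<in>set ls. \<omega> j)} \<le> \<alpha>"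
          using tail[of "length ks"] by simp
      qed (use \<alpha> in auto)
      also have "\<dots> \<le> (\<alpha> / (1 - \<alpha>)) ^ r * \<alpha>"
        using tail[of 0] \<alpha> by (intro mult_left_mono) auto
      finally show ?thesis using \<alpha> Suc by (simp add: field_simps)
    qed (auto simp: Q.prob_le_1)
  qed
  have "p \<le> exits (2 * \<epsilon>) 0 (map (\<lambda>i. X i \<omega>) [0..<n])" if osc: "oscillates (4 * \<epsilon>) p F (\<lambda>t. Z t \<omega>)" for \<omega>
  proof -
    obtain ts where ts: "length ts = Suc p" "sorted_wrt (<) ts" "set ts \<subseteq> F"
      "successively (\<lambda>s t. 4 * \<epsilon> < dist (Z s \<omega>) (Z t \<omega>)) ts"
      using osc unfolding oscillates_def by blast
    have "ts = filter (\<lambda>x. x \<in> set ts) (sorted_list_of_set F)"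
    proof (rule sorted_distinct_set_unique)
      show "set ts = set (filter (\<lambda>x. x \<in> set ts) (sorted_list_of_set F))" using ts F(1) by auto
    qed (use ts(2) in \<open>auto simp: strict_sorted_iff sorted_filter[where f="\<lambda>x. x", simplified]\<close>)
    then have "subseq ts (map t [0..<Suc n])"
      unfolding t_map by (metis subseq_filter_left)
    then have "subseq (map (\<lambda>t. Z t \<omega>) ts) (map (\<lambda>t. Z t \<omega>) (map t [0..<Suc n]))"
      by (rule subseq_map)
    moreover have "successively (\<lambda>x y. 2 * (2 * \<epsilon>) < dist x y) (map (\<lambda>t. Z t \<omega>) ts)"
      using ts(4) by (simp add: successively_map)
    ultimately have "length (map (\<lambda>t. Z t \<omega>) ts) \<le> Suc (resets (2 * \<epsilon>) (Z (t 0) \<omega>) (map (\<lambda>t. Z t \<omega>) (map t [0..<Suc n])))"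
      using \<alpha>(3) by (intro chain_le_resets) auto
    also have "resets (2 * \<epsilon>) (Z (t 0) \<omega>) (map (\<lambda>t. Z t \<omega>) (map t [0..<Suc n]))
        = resets (2 * \<epsilon>) (Z (t 0) \<omega>) (map (\<lambda>i. Z (t i) \<omega>) [Suc 0..<Suc n])"
      using \<alpha>(3) by (simp add: upt_conv_Cons comp_def del: upt_Suc)
    also have "\<dots> = exits (2 * \<epsilon>) 0 (map (\<lambda>i. X i \<omega>) [0..<n])"
      by (subst resets_eq_exits) (auto simp: X_def)
    finally show ?thesis using ts(1) by simp
  qed
  then have "prob {\<omega>\<in>space M. oscillates (4 * \<epsilon>) p F (\<lambda>t. Z t \<omega>)}
      \<le> prob {\<omega>\<in>space M. p \<le> exits (2 * \<epsilon>) 0 (map (\<lambda>i. X i \<omega>) [0..<n])}"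
  proof (intro finite_measure_mono)
    have [measurable]: "(\<lambda>\<omega>. exits (2 * \<epsilon>) 0 (map (\<lambda>i. X i \<omega>) [0..<n])) \<in> M \<rightarrow>\<^sub>M count_space UNIV"
      by (rule measurable_exits) (auto intro: X)
    show "{\<omega>\<in>space M. p \<le> exits (2 * \<epsilon>) 0 (map (\<lambda>i. X i \<omega>) [0..<n])} \<in> events" by measurable
  qed auto
  also have "\<dots> = prob {\<omega>\<in>space M. p \<le> exits (2 * \<epsilon>) 0 (map (\<lambda>i\<in>{0..<n}. X i \<omega>) [0..<n])}"
    by (intro arg_cong[where f=prob] Collect_cong conj_cong refl arg_cong2[where f="(\<le>)"] arg_cong[where f="exits (2 * \<epsilon>) 0"] map_cong) auto
  also have "\<dots> = measure (PiM {0..<n} N) {\<omega>\<in>space (PiM {0..<n} N). p \<le> exits (2 * \<epsilon>) 0 (map \<omega> [0..<n])}"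
  proof (rule prob_PiM[symmetric])
    have [measurable]: "(\<lambda>\<omega>. exits (2 * \<epsilon>) 0 (map (\<lambda>i. \<omega> i) [0..<n])) \<in> PiM {0..<n} (\<lambda>_. borel :: 'a measure) \<rightarrow>\<^sub>M count_space UNIV"
      by (rule measurable_exits) auto
    show "Measurable.pred (PiM {0..<n} (\<lambda>_. borel :: 'a measure)) (\<lambda>\<omega>. p \<le> exits (2 * \<epsilon>) 0 (map \<omega> [0..<n]))"
      by measurable
  qed
  also have "\<dots> \<le> (\<alpha> / (1 - \<alpha>)) ^ p" by (rule bound)
  finally show ?thesis .
qed

lemma measurable_oscillates:
  assumes "countable S" "S \<subseteq> {0..}"
  shows "{\<omega>\<in>space M. oscillates e p S (\<lambda>t. Z t \<omega>)} \<in> events"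
proof -
  have chain: "Measurable.pred M (\<lambda>\<omega>. successively (\<lambda>s t. e < dist (Z s \<omega>) (Z t \<omega>)) ts)" if "set ts \<subseteq> {0..}" for ts
    using that
  proof (induction ts rule: induct_list012)
    case (3 s t ts)
    have [measurable]: "Z s \<in> borel_measurable M" "Z t \<in> borel_measurable M"
      "Measurable.pred M (\<lambda>\<omega>. successively (\<lambda>s t. e < dist (Z s \<omega>) (Z t \<omega>)) (t # ts))"
      using 3 by (auto intro: Z_meas)
    show ?case by simp
  qed simp_all
  let ?L = "{ts\<in>lists S. length ts = Suc p \<and> sorted_wrt (<) ts}"
  have L: "countable ?L" using countable_lists[OF assms(1)] by (rule countable_subset[rotated]) auto
  have "{\<omega>\<in>space M. oscillates e p S (\<lambda>t. Z t \<omega>)}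
      = (\<Union>ts\<in>?L. {\<omega>\<in>space M. successively (\<lambda>s t. e < dist (Z s \<omega>) (Z t \<omega>)) ts})"
    by (auto simp: oscillates_def)
  also have "\<dots> \<in> events"
    using chain assms(2) by (intro sets.countable_UN'[OF L]) (auto simp: pred_def)
  finally show ?thesis .
qed

text \<open>A chain is finite, so it already lies in one of the finite sets that exhaust
  \<open>S\<close>; the bound does not depend on the finite set and passes to the increasing
  union.\<close>

lemma prob_oscillates_countable:
  assumes S: "countable S" "S \<subseteq> {a..b}" "S \<subseteq> {0..}"
    and \<alpha>: "0 \<le> \<alpha>" "\<alpha> < 1" "0 \<le> \<epsilon>"
    and small: "\<And>s t. 0 \<le> s \<Longrightarrow> a \<le> s \<Longrightarrow> s < t \<Longrightarrow> t \<le> b \<Longrightarrow> measure (\<mu> s t) {x. \<epsilon> < norm x} \<le> \<alpha>"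
  shows "prob {\<omega>\<in>space M. oscillates (4 * \<epsilon>) p S (\<lambda>t. Z t \<omega>)} \<le> (\<alpha> / (1 - \<alpha>)) ^ p"
proof (cases "S = {}")
  case True
  then have empty: "{\<omega>\<in>space M. oscillates (4 * \<epsilon>) p S (\<lambda>t. Z t \<omega>)} = {}"
    by (auto simp: oscillates_def)
  show ?thesis unfolding empty using \<alpha> by simp
next
  case False
  define F where "F m = from_nat_into S ` {..m}" for m
  have F: "finite (F m)" "F m \<subseteq> S" for m
    using from_nat_into[OF False] by (auto simp: F_def)
  have mono: "F m \<subseteq> F m'" if "m \<le> m'" for m m' using that by (auto simp: F_def)
  define A where "A m = {\<omega>\<in>space M. oscillates (4 * \<epsilon>) p (F m) (\<lambda>t. Z t \<omega>)}" for m
  have A: "A m \<in> events" for m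
    unfolding A_def using F(2)[of m] S(3) F(1)[of m] by (intro measurable_oscillates) (auto intro: countable_finite)
  have "incseq A"
    unfolding A_def incseq_def using oscillates_mono[OF _ mono] by blast
  then have lim: "(\<lambda>m. prob (A m)) \<longlonglongrightarrow> prob (\<Union>m. A m)"
    using A by (intro finite_Lim_measure_incseq) auto
  have ex_F: "\<exists>m. set ts \<subseteq> F m" if "set ts \<subseteq> S" for ts
    using that
  proof (induction ts)
    case (Cons x ts)
    then obtain m where m: "set ts \<subseteq> F m" by auto
    obtain k where k: "x = from_nat_into S k" using Cons.prems from_nat_into_surj[OF S(1)] by force
    have "set (x # ts) \<subseteq> F (max m k)"
      using m mono[of m "max m k"] k by (auto simp: F_def)
    then show ?case ..
  qed simp
  have "{\<omega>\<in>space M. oscillates (4 * \<epsilon>) p S (\<lambda>t. Z t \<omega>)} \<subseteq> (\<Union>m. A m)"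
  proof safe
    fix \<omega> assume "\<omega> \<in> space M" "oscillates (4 * \<epsilon>) p S (\<lambda>t. Z t \<omega>)"
    moreover from this(2) obtain ts where "length ts = Suc p" "sorted_wrt (<) ts" "set ts \<subseteq> S"
      "successively (\<lambda>s t. 4 * \<epsilon> < dist (Z s \<omega>) (Z t \<omega>)) ts"
      unfolding oscillates_def by auto
    moreover from ex_F[OF this(3)] obtain m where "set ts \<subseteq> F m" ..
    ultimately have "\<omega> \<in> A m"
      unfolding A_def oscillates_def by auto
    then show "\<omega> \<in> (\<Union>m. A m)" by auto
  qed
  then have "{\<omega>\<in>space M. oscillates (4 * \<epsilon>) p S (\<lambda>t. Z t \<omega>)} = (\<Union>m. A m)"
    using oscillates_mono[OF _ F(2)] by (auto simp: A_def)
  moreover have "prob (\<Union>m. A m) \<le> (\<alpha> / (1 - \<alpha>)) ^ p"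
  proof (rule LIMSEQ_le_const2[OF lim], intro exI allI impI)
    fix m
    show "prob (A m) \<le> (\<alpha> / (1 - \<alpha>)) ^ p"
      unfolding A_def using F[of m] S A[of m] \<alpha> small
      by (intro prob_oscillates_finite[where a=a and b=b]) (auto simp: A_def)
  qed
  ultimately show ?thesis by simp
qed

text \<open>Tails of at most 1/3 make the ratio \<open>\<alpha> / (1 - \<alpha>)\<close> equal to
  1/2, so arbitrarily many jumps have probability below every power of 1/2.\<close>

lemma AE_not_oscillates:
  assumes S: "countable S" "S \<subseteq> {a..b}" "S \<subseteq> {0..}" and "0 \<le> \<epsilon>"
    and small: "\<And>s t. 0 \<le> s \<Longrightarrow> a \<le> s \<Longrightarrow> s < t \<Longrightarrow> t \<le> b \<Longrightarrow> measure (\<mu> s t) {x. \<epsilon> < norm x} \<le> 1 / 3"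
  shows "AE \<omega> in M. \<exists>p. \<not> oscillates (4 * \<epsilon>) p S (\<lambda>t. Z t \<omega>)"
proof -
  define B where "B = (\<Inter>p. {\<omega>\<in>space M. oscillates (4 * \<epsilon>) p S (\<lambda>t. Z t \<omega>)})"
  have B: "B \<in> events"
    unfolding B_def using measurable_oscillates[OF S(1,3)] by (intro sets.countable_INT) auto
  have "prob B \<le> (1 / 2) ^ p" for p
  proof -
    have "prob B \<le> prob {\<omega>\<in>space M. oscillates (4 * \<epsilon>) p S (\<lambda>t. Z t \<omega>)}"
      using measurable_oscillates[OF S(1,3)] by (intro finite_measure_mono) (auto simp: B_def)
    also have "\<dots> \<le> (1 / 3 / (1 - 1 / 3)) ^ p"
      using assms by (intro prob_oscillates_countable[where a=a and b=b]) auto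
    finally show ?thesis by simp
  qed
  then have "prob B \<le> 0"
    using LIMSEQ_le_const[OF LIMSEQ_realpow_zero[of "1 / 2 :: real"], of "prob B"] by auto
  then have "B \<in> null_sets M"
    using B by (auto simp: null_sets_def emeasure_eq_measure measure_le_0_iff)
  then show ?thesis
    by (rule AE_I') (auto simp: B_def)
qed

end

context increments_process
begin

text \<open>Only countably many null sets are collected: levels \<open>1 / (l + 1)\<close>, horizons
  \<open>K\<close> and rational end points. Each time and each \<open>e\<close> is then served by
  one of these choices.\<close>

lemma AE_regular:
  assumes stoch: "\<And>K \<epsilon> \<eta>. 0 < \<epsilon> \<Longrightarrow> 0 < \<eta> \<Longrightarrow>
    \<exists>\<delta>>0. \<forall>s t. 0 \<le> s \<and> s \<le> t \<and> t \<le> K \<and> t - s \<le> \<delta> \<longrightarrow> measure (\<mu> s t) {x. \<epsilon> < norm x} \<le> \<eta>"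
  shows "AE \<omega> in M. regular (\<lambda>t. Z t \<omega>)"
proof -
  \<comment> \<open>A quarter of the level, since the oscillation estimate controls jumps four times
    as large as the tails.\<close>
  have "\<forall>l K :: nat. \<exists>\<delta>>0. \<forall>s t. 0 \<le> s \<and> s \<le> t \<and> t \<le> real K \<and> t - s \<le> \<delta> \<longrightarrow>
      measure (\<mu> s t) {x. inverse (real (Suc l)) / 4 < norm x} \<le> 1 / 3"
    by (intro allI stoch) auto
  then obtain \<delta> :: "nat \<Rightarrow> nat \<Rightarrow> real" where \<delta>: "\<And>l K. 0 < \<delta> l K"
    "\<And>l K s t. 0 \<le> s \<Longrightarrow> s \<le> t \<Longrightarrow> t \<le> real K \<Longrightarrow> t - s \<le> \<delta> l K \<Longrightarrow>
      measure (\<mu> s t) {x. inverse (real (Suc l)) / 4 < norm x} \<le> 1 / 3"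
    by metis
  have "AE \<omega> in M. b \<le> real K \<and> b - a \<le> \<delta> l K \<longrightarrow>
      (\<exists>p. \<not> oscillates (inverse (real (Suc l))) p (rat_times \<inter> {a..b}) (\<lambda>t. Z t \<omega>))" for l K a b
  proof (cases "b \<le> real K \<and> b - a \<le> \<delta> l K")
    case True
    have "AE \<omega> in M. \<exists>p. \<not> oscillates (4 * (inverse (real (Suc l)) / 4)) p (rat_times \<inter> {a..b}) (\<lambda>t. Z t \<omega>)"
    proof (rule AE_not_oscillates[where a=a and b=b])
      show "countable (rat_times \<inter> {a..b})"
        using countable_rat by (rule countable_subset[rotated]) (auto simp: rat_times_def)
      show "measure (\<mu> s t) {x. inverse (real (Suc l)) / 4 < norm x} \<le> 1 / 3"
        if "0 \<le> s" "a \<le> s" "s < t" "t \<le> b" for s t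
        using that True by (intro \<delta>(2)[of s t K l]) auto
    qed (auto simp: rat_times_def)
    then show ?thesis by auto
  qed auto
  then have "AE \<omega> in M. \<forall>l K. \<forall>a\<in>\<rat>. \<forall>b\<in>\<rat>. b \<le> real K \<and> b - a \<le> \<delta> l K \<longrightarrow>
      (\<exists>p. \<not> oscillates (inverse (real (Suc l))) p (rat_times \<inter> {a..b}) (\<lambda>t. Z t \<omega>))"
    by (simp add: AE_all_countable AE_ball_countable countable_rat)
  then show ?thesis
  proof (rule AE_mp, intro AE_I2 impI)
    fix \<omega>
    assume *: "\<forall>l K. \<forall>a\<in>\<rat>. \<forall>b\<in>\<rat>. b \<le> real K \<and> b - a \<le> \<delta> l K \<longrightarrow>
      (\<exists>p. \<not> oscillates (inverse (real (Suc l))) p (rat_times \<inter> {a..b}) (\<lambda>t. Z t \<omega>))"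
    show "regular (\<lambda>t. Z t \<omega>)"
      unfolding regular_def
    proof (intro allI impI)
      fix t e :: real assume "0 \<le> t" "0 < e"
      obtain l where l: "inverse (real (Suc l)) < e" using reals_Archimedean[OF \<open>0 < e\<close>] by blast
      obtain K :: nat where K: "t + 1 < real K" using reals_Archimedean2 by blast
      \<comment> \<open>Both end points stay within \<open>d\<close> of \<open>t\<close>, so the
        interval is no longer than \<open>\<delta> l K\<close> and ends before \<open>t + 1\<close>,
        hence before \<open>K\<close>.\<close>
      define d where "d = min 1 (\<delta> l K / 2)"
      have d: "0 < d" "d \<le> 1" "2 * d \<le> \<delta> l K" using \<delta>(1)[of l K] by (auto simp: d_def)
      obtain a where a: "a \<in> \<rat>" "t - d < a" "a < t" using Rats_dense_in_real[of "t - d" t] d by auto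
      obtain b where b: "b \<in> \<rat>" "t < b" "b < t + d" using Rats_dense_in_real[of t "t + d"] d by auto
      have "b \<le> real K \<and> b - a \<le> \<delta> l K" using a b K d by linarith
      then obtain p where "\<not> oscillates (inverse (real (Suc l))) p (rat_times \<inter> {a..b}) (\<lambda>t. Z t \<omega>)"
        using * a(1) b(1) by blast
      moreover have "oscillates (inverse (real (Suc l))) p (rat_times \<inter> {a..b}) (\<lambda>t. Z t \<omega>)"
        if "oscillates e p (rat_times \<inter> {a..b}) (\<lambda>t. Z t \<omega>)"
        using that l unfolding oscillates_def by (auto elim!: successively_mono intro: less_trans)
      ultimately show "\<exists>a b p. a < t \<and> t < b \<and> \<not> oscillates e p (rat_times \<inter> {a..b}) (\<lambda>t. Z t \<omega>)"
        using a b by blast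
    qed
  qed
qed

text \<open>For each \<open>t\<close>, rational times \<open>d n\<close> decreasing in distance to
  \<open>t\<close> from the right are chosen so fast that Borel-Cantelli gives almost sure
  convergence of \<open>Z (d n)\<close> to \<open>Z t\<close>. The same sequence converges to the
  right limit, so the two agree almost surely, and it also exhibits \<open>Y t\<close> as a
  measurable limit.\<close>

lemma cadlag_modification:
  assumes stoch: "\<And>K \<epsilon> \<eta>. 0 < \<epsilon> \<Longrightarrow> 0 < \<eta> \<Longrightarrow>
    \<exists>\<delta>>0. \<forall>s t. 0 \<le> s \<and> s \<le> t \<and> t \<le> K \<and> t - s \<le> \<delta> \<longrightarrow> measure (\<mu> s t) {x. \<epsilon> < norm x} \<le> \<eta>"
  obtains Y where "\<And>t. 0 \<le> t \<Longrightarrow> Y t \<in> borel_measurable M"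
    "\<And>\<omega>. \<omega> \<in> space M \<Longrightarrow> cadlag (\<lambda>t. Y t \<omega>)"
    "\<And>t. 0 \<le> t \<Longrightarrow> AE \<omega> in M. Y t \<omega> = Z t \<omega>"
proof -
  obtain N where N: "{\<omega>\<in>space M. \<not> regular (\<lambda>t. Z t \<omega>)} \<subseteq> N" "emeasure M N = 0" "N \<in> events"
    using AE_regular[OF stoch] by (rule AE_E) auto
  \<comment> \<open>On the null set the path is replaced by the zero path, so that every path is
    cadlag and not just almost every one.\<close>
  define Y where "Y t \<omega> = (if \<omega> \<in> N then 0 else right_limits (\<lambda>t. Z t \<omega>) t)" for t \<omega>
  have reg: "regular (\<lambda>t. Z t \<omega>)" if "\<omega> \<in> space M" "\<omega> \<notin> N" for \<omega> using N that by auto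
  have AE_N: "AE \<omega> in M. \<omega> \<notin> N" using N by (auto intro: AE_not_in simp: null_sets_def)
  have *: "Y t \<in> borel_measurable M \<and> (AE \<omega> in M. Y t \<omega> = Z t \<omega>)" if t: "0 \<le> t" for t
  proof -
    have "\<exists>d. d \<in> rat_times \<and> t < d \<and> d < t + inverse (real (Suc n)) \<and>
        measure (\<mu> t d) {x. (1 / 2) ^ n < norm x} \<le> (1 / 2) ^ n" for n
    proof -
      obtain \<delta> where \<delta>: "0 < \<delta>" "\<And>s u. 0 \<le> s \<and> s \<le> u \<and> u \<le> t + 1 \<and> u - s \<le> \<delta> \<Longrightarrow>
          measure (\<mu> s u) {x. (1 / 2) ^ n < norm x} \<le> (1 / 2) ^ n"
        using stoch[of "(1 / 2) ^ n" "(1 / 2) ^ n" "t + 1"] by auto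
      define m where "m = min (inverse (real (Suc n))) \<delta>"
      have "inverse (real (Suc n)) \<le> 1" by (simp add: field_simps)
      then have m: "0 < m" "m \<le> 1" "m \<le> \<delta>" "m \<le> inverse (real (Suc n))"
        using \<delta>(1) by (auto simp: m_def)
      obtain d where "d \<in> rat_times" "t < d" "d < t + m"
        using rat_times_between[OF t, of "t + m"] m(1) by auto
      then show ?thesis using m t by (intro exI[of _ d]) (auto intro!: \<delta>(2))
    qed
    then obtain d where d: "\<And>n. d n \<in> rat_times" "\<And>n. t < d n" "\<And>n. d n < t + inverse (real (Suc n))"
      "\<And>n. measure (\<mu> t (d n)) {x. (1 / 2) ^ n < norm x} \<le> (1 / 2) ^ n" by metis
    have d0: "0 \<le> d n" for n using d(2)[of n] t by linarith
    have [measurable]: "Z (d n) \<in> borel_measurable M" "Z t \<in> borel_measurable M" for n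
      using d0 t by (auto intro: Z_meas)
    have d_lim: "d \<longlonglongrightarrow> t"
    proof (rule tendsto_sandwich[of "\<lambda>_. t" d])
      show "(\<lambda>n. t + inverse (real (Suc n))) \<longlonglongrightarrow> t"
        using tendsto_add[OF tendsto_const LIMSEQ_inverse_real_of_nat] by simp
    qed (use d(2,3) in \<open>auto intro!: less_imp_le always_eventually\<close>)
    have "filterlim d (at t within (rat_times \<inter> {t<..})) sequentially"
      unfolding filterlim_at
    proof
      show "\<forall>\<^sub>F n in sequentially. d n \<in> rat_times \<inter> {t<..} \<and> d n \<noteq> t"
        using d(1,2) by (intro always_eventually allI) (auto simp: less_le)
    qed fact
    then have lim_Y: "(\<lambda>n. Z (d n) \<omega>) \<longlonglongrightarrow> Y t \<omega>" if "\<omega> \<in> space M" "\<omega> \<notin> N" for \<omega>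
      using filterlim_compose[OF right_limits_tendsto[OF reg[OF that] t]] that by (simp add: Y_def)
    have meas: "Y t \<in> borel_measurable M"
    proof (subst measurable_cong)
      show "Y t \<omega> = (if \<omega> \<in> N then 0 else lim (\<lambda>n. Z (d n) \<omega>))" if "\<omega> \<in> space M" for \<omega>
        using lim_Y[OF that] by (auto simp: Y_def limI)
      show "(\<lambda>\<omega>. if \<omega> \<in> N then 0 else lim (\<lambda>n. Z (d n) \<omega>)) \<in> borel_measurable M"
        using N(3) by measurable
    qed
    define A where "A n = {\<omega>\<in>space M. (1 / 2) ^ n < norm (Z (d n) \<omega> - Z t \<omega>)}" for n
    have A: "A n \<in> events" for n unfolding A_def by measurable
    have "prob (A n) = measure (distr M borel (\<lambda>\<omega>. Z (d n) \<omega> - Z t \<omega>)) {x. (1 / 2) ^ n < norm x}" for n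
      unfolding A_def by (subst measure_distr) (auto intro!: arg_cong[where f=prob])
    then have "prob (A n) \<le> (1 / 2) ^ n" for n
      using d(4)[of n] by (simp only: Z_increment[OF t d(2)])
    then have "summable (\<lambda>n. prob (A n))"
      by (intro summable_comparison_test'[OF summable_geometric[of "1 / 2 :: real"], of 0]) auto
    then have "AE \<omega> in M. eventually (\<lambda>n. \<omega> \<in> space M - A n) sequentially"
      using A by (intro borel_cantelli_AE1) (auto simp: emeasure_eq_measure)
    with AE_N have "AE \<omega> in M. Y t \<omega> = Z t \<omega>"
    proof (eventually_elim, goal_cases)
      case (1 \<omega>)
      have "\<omega> \<in> space M" using eventually_happens[OF 1(2)] by auto
      from 1(2) have "eventually (\<lambda>n. norm (Z (d n) \<omega> - Z t \<omega>) \<le> (1 / 2) ^ n) sequentially"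
        by eventually_elim (auto simp: A_def)
      then have "(\<lambda>n. Z (d n) \<omega> - Z t \<omega>) \<longlonglongrightarrow> 0"
        by (rule Lim_null_comparison) (rule LIMSEQ_realpow_zero; simp)
      then have "(\<lambda>n. Z (d n) \<omega>) \<longlonglongrightarrow> Z t \<omega>" by (simp add: LIM_zero_iff)
      then show ?case
        using lim_Y[OF \<open>\<omega> \<in> space M\<close> 1(1)] LIMSEQ_unique by blast
    qed
    with meas show ?thesis by blast
  qed
  show ?thesis
  proof
    show "cadlag (\<lambda>t. Y t \<omega>)" if "\<omega> \<in> space M" for \<omega>
    proof (cases "\<omega> \<in> N")
      case True
      then show ?thesis by (auto simp: Y_def cadlag_def)
    next
      case False
      then have "(\<lambda>t. Y t \<omega>) = right_limits (\<lambda>t. Z t \<omega>)" by (simp add: Y_def fun_eq_iff)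
      then show ?thesis using cadlag_right_limits[OF reg[OF that False]] by simp
    qed
  qed (use * in auto)
qed

end

text \<open>The cadlag version differs from the coordinate process by a null set at each single
  time. Finitely many times are involved in a joint law of increments, so that law, and with it
  independence, is unchanged.\<close>

theorem (in convolution_hemigroup) cadlag_process_exists:
  assumes stoch: "\<And>K \<epsilon> \<eta>. 0 < \<epsilon> \<Longrightarrow> 0 < \<eta> \<Longrightarrow>
    \<exists>\<delta>>0. \<forall>s t. 0 \<le> s \<and> s \<le> t \<and> t \<le> K \<and> t - s \<le> \<delta> \<longrightarrow> measure (\<mu> s t) {x. \<epsilon> < norm x} \<le> \<eta>"
  obtains M :: "(real \<Rightarrow> 'a) measure" and Y :: "real \<Rightarrow> (real \<Rightarrow> 'a) \<Rightarrow> 'a" where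
    "prob_space M" "\<And>t. 0 \<le> t \<Longrightarrow> Y t \<in> borel_measurable M"
    "\<And>\<omega>. \<omega> \<in> space M \<Longrightarrow> cadlag (\<lambda>t. Y t \<omega>)"
    "independent_increments M Y"
    "\<And>t. 0 \<le> t \<Longrightarrow> distr M borel (Y t) = \<mu> 0 t"
    "AE \<omega> in M. Y 0 \<omega> = 0"
proof (rule process_exists)
  fix M :: "(real \<Rightarrow> 'a) measure" assume M: "prob_space M"
    "\<And>t. 0 \<le> t \<Longrightarrow> (\<lambda>\<omega>. \<omega> t) \<in> borel_measurable M"
    "\<And>s. 0 \<le> s \<Longrightarrow> distr M borel (\<lambda>\<omega>. \<omega> s) = \<mu> 0 s"
    "\<And>n t. 0 \<le> t 0 \<Longrightarrow> (\<And>i. i < n \<Longrightarrow> t i < t (Suc i)) \<Longrightarrow>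
      distr M (PiM {..<n} (\<lambda>_. borel)) (\<lambda>\<omega>. \<lambda>i\<in>{..<n}. \<omega> (t (Suc i)) - \<omega> (t i))
      = PiM {..<n} (\<lambda>i. \<mu> (t i) (t (Suc i)))"
  interpret prob_space M by (rule M(1))
  interpret P: increments_process \<mu> M "\<lambda>t \<omega>. \<omega> t"
    by unfold_locales (use M in auto)
  obtain Y :: "real \<Rightarrow> (real \<Rightarrow> 'a) \<Rightarrow> 'a" where Y: "\<And>t. 0 \<le> t \<Longrightarrow> Y t \<in> borel_measurable M"
    "\<And>\<omega>. \<omega> \<in> space M \<Longrightarrow> cadlag (\<lambda>t. Y t \<omega>)"
    "\<And>t. 0 \<le> t \<Longrightarrow> AE \<omega> in M. Y t \<omega> = \<omega> t"
    using P.cadlag_modification[OF stoch] by blast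
  have law: "distr M borel (Y t) = \<mu> 0 t" if "0 \<le> t" for t
    unfolding M(3)[OF that, symmetric] using that Y M(2) by (intro distr_cong_AE) auto
  show ?thesis
  proof
    show "independent_increments M Y"
      unfolding independent_increments_def
    proof (intro allI impI)
      fix n :: nat and t :: "nat \<Rightarrow> real" assume t: "0 \<le> t 0 \<and> (\<forall>i<n. t i < t (Suc i))"
      have t0: "0 \<le> t i" if "i \<le> n" for i
        using that
      proof (induction i)
        case (Suc i) then show ?case using t[THEN conjunct2, rule_format, of i] by simp
      qed (use t in simp)
      have meas: "(\<lambda>\<omega>. Y (t (Suc i)) \<omega> - Y (t i) \<omega>) \<in> borel_measurable M"
        "(\<lambda>\<omega>. \<omega> (t (Suc i)) - \<omega> (t i)) \<in> borel_measurable M" if "i < n" for i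
        using that by (auto intro!: borel_measurable_diff Y(1) M(2) t0)
      have AE: "AE \<omega> in M. Y (t (Suc i)) \<omega> - Y (t i) \<omega> = \<omega> (t (Suc i)) - \<omega> (t i)" if "i < n" for i
        using Y(3)[OF t0, of "Suc i"] Y(3)[OF t0, of i] that by auto
      show "indep_vars (\<lambda>_. borel) (\<lambda>i \<omega>. Y (t (Suc i)) \<omega> - Y (t i) \<omega>) {..<n}"
      proof (cases "n = 0")
        case True
        then show ?thesis by (simp add: indep_vars_def indep_sets_def)
      next
        case False
        have "distr M (PiM {..<n} (\<lambda>_. borel)) (\<lambda>\<omega>. \<lambda>i\<in>{..<n}. Y (t (Suc i)) \<omega> - Y (t i) \<omega>)
            = distr M (PiM {..<n} (\<lambda>_. borel)) (\<lambda>\<omega>. \<lambda>i\<in>{..<n}. \<omega> (t (Suc i)) - \<omega> (t i))"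
        proof (intro distr_cong_AE refl)
          have "AE \<omega> in M. \<forall>i\<in>{..<n}. Y (t (Suc i)) \<omega> - Y (t i) \<omega> = \<omega> (t (Suc i)) - \<omega> (t i)"
            using AE by (intro AE_finite_allI) auto
          then show "AE \<omega> in M. (\<lambda>i\<in>{..<n}. Y (t (Suc i)) \<omega> - Y (t i) \<omega>) = (\<lambda>i\<in>{..<n}. \<omega> (t (Suc i)) - \<omega> (t i))"
            by eventually_elim (auto intro!: restrict_ext)
        qed (use meas in \<open>auto intro!: measurable_restrict\<close>)
        also have "\<dots> = PiM {..<n} (\<lambda>i. \<mu> (t i) (t (Suc i)))"
          using t by (intro M(4)) auto
        also have "\<dots> = PiM {..<n} (\<lambda>i. distr M borel (\<lambda>\<omega>. Y (t (Suc i)) \<omega> - Y (t i) \<omega>))"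
        proof (intro PiM_cong refl)
          fix i assume i: "i \<in> {..<n}"
          have "distr M borel (\<lambda>\<omega>. Y (t (Suc i)) \<omega> - Y (t i) \<omega>) = distr M borel (\<lambda>\<omega>. \<omega> (t (Suc i)) - \<omega> (t i))"
            using i meas AE by (intro distr_cong_AE) auto
          also have "\<dots> = \<mu> (t i) (t (Suc i))"
            using i t t0 by (intro P.Z_increment) auto
          finally show "\<mu> (t i) (t (Suc i)) = distr M borel (\<lambda>\<omega>. Y (t (Suc i)) \<omega> - Y (t i) \<omega>)" ..
        qed
        finally show ?thesis
          using False meas by (subst indep_vars_iff_distr_eq_PiM') auto
      qed
    qed
    have "AE x in distr M borel (Y 0). x = 0"
      unfolding law[OF order_refl] mu_diag[OF order_refl] by (subst AE_return) auto
    then show "AE \<omega> in M. Y 0 \<omega> = 0"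
      using Y(1)[of 0] by (subst (asm) AE_distr_iff) auto
  qed (use Y law M(1) in auto)
qed

section \<open>Infinite divisibility\<close>

text \<open>The convolution is the average, over \<open>y\<close> distributed as
  \<open>\<beta>\<close>, of the translates of \<open>\<alpha>\<close> by \<open>y\<close>.
  Weighting the mass of \<open>A l\<close> by \<open>2 ^ Suc l\<close> and summing gives at most 1/2
  on average, so for some \<open>y\<close> the weighted sum is below 1, and this one
  \<open>y\<close> serves all \<open>l\<close>.\<close>

lemma shift_of_conv_factor:
  fixes \<alpha> \<beta> :: "'a::{banach, second_countable_topology} measure"
  assumes \<alpha>: "borel_prob \<alpha>" and \<beta>: "borel_prob \<beta>" and A: "\<And>l. A l \<in> sets borel"
    and small: "\<And>l. emeasure (measure_conv \<beta> \<alpha>) (A l) \<le> ennreal ((1 / 4) ^ Suc l / 2)"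
  obtains y where "\<And>l. emeasure (distr \<alpha> borel (\<lambda>x. x + y)) (A l) \<le> ennreal ((1 / 2) ^ Suc l)"
proof -
  interpret \<beta>: prob_space \<beta> using \<beta> by (rule borel_probD)
  note [measurable_cong] = borel_probD(2)[OF \<alpha>] borel_probD(2)[OF \<beta>]
  define h where "h l y = (\<integral>\<^sup>+x. indicator (A l) (y + x) \<partial>\<alpha>)" for l y
  have h_meas[measurable]: "h l \<in> borel_measurable borel" for l
    unfolding h_def by (rule measurable_shift_nn_integral[OF \<alpha>]) (use A in simp)
  have "(\<integral>\<^sup>+y. (\<Sum>l. ennreal (2 ^ Suc l) * h l y) \<partial>\<beta>) = (\<Sum>l. ennreal (2 ^ Suc l) * (\<integral>\<^sup>+y. h l y \<partial>\<beta>))"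
    by (subst nn_integral_suminf) (auto simp: nn_integral_cmult)
  also have "\<dots> \<le> (\<Sum>l. ennreal ((1 / 2) ^ Suc l / 2))"
  proof (intro suminf_le summableI)
    fix l
    have "(\<integral>\<^sup>+y. h l y \<partial>\<beta>) \<le> ennreal ((1 / 4) ^ Suc l / 2)"
      using small[of l] by (simp only: h_def emeasure_conv[OF \<beta> \<alpha> A])
    then have "ennreal (2 ^ Suc l) * (\<integral>\<^sup>+y. h l y \<partial>\<beta>) \<le> ennreal (2 ^ Suc l) * ennreal ((1 / 4) ^ Suc l / 2)"
      by (intro mult_left_mono) auto
    also have "\<dots> = ennreal ((1 / 2) ^ Suc l / 2)"
      by (subst ennreal_mult'[symmetric]) (auto simp: power_mult_distrib[symmetric] simp del: power_Suc)
    finally show "ennreal (2 ^ Suc l) * (\<integral>\<^sup>+y. h l y \<partial>\<beta>) \<le> ennreal ((1 / 2) ^ Suc l / 2)" .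
  qed
  also have "\<dots> = ennreal (1 / 2)"
  proof (rule suminf_ennreal_eq)
    show "(\<lambda>l. (1 / 2) ^ Suc l / 2 :: real) sums (1 / 2)"
      using sums_divide[OF power_half_series, of 2] by simp
  qed simp
  finally have le: "(\<integral>\<^sup>+y. (\<Sum>l. ennreal (2 ^ Suc l) * h l y) \<partial>\<beta>) \<le> ennreal (1 / 2)" .
  have "\<exists>y. (\<Sum>l. ennreal (2 ^ Suc l) * h l y) < 1"
  proof (rule ccontr)
    assume "\<not> ?thesis"
    then have "(\<integral>\<^sup>+y. 1 \<partial>\<beta>) \<le> (\<integral>\<^sup>+y. (\<Sum>l. ennreal (2 ^ Suc l) * h l y) \<partial>\<beta>)"
      by (intro nn_integral_mono) (auto simp: not_less)
    then have "1 \<le> ennreal (1 / 2)" using le by (auto simp: \<beta>.emeasure_space_1 intro: order_trans)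
    then have "ennreal 1 \<le> ennreal (1 / 2)" by (simp only: ennreal_1)
    then show False by (subst (asm) ennreal_le_iff) auto
  qed
  then obtain y where y: "(\<Sum>l. ennreal (2 ^ Suc l) * h l y) < 1" by blast
  show ?thesis
  proof
    fix l
    have "ennreal (2 ^ Suc l) * h l y \<le> (\<Sum>l. ennreal (2 ^ Suc l) * h l y)"
      using sum_le_suminf[OF summableI, of "{l}" "\<lambda>l. ennreal (2 ^ Suc l) * h l y"] by simp
    then have "ennreal (2 ^ Suc l) * h l y \<le> 1" using y by simp
    then have "ennreal ((1 / 2) ^ Suc l) * (ennreal (2 ^ Suc l) * h l y) \<le> ennreal ((1 / 2) ^ Suc l) * 1"
      by (rule mult_left_mono) simp
    moreover have "ennreal ((1 / 2) ^ Suc l) * ennreal (2 ^ Suc l) = 1"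
      by (subst ennreal_mult'[symmetric]) (auto simp: power_mult_distrib[symmetric] simp del: power_Suc)
    ultimately have "h l y \<le> ennreal ((1 / 2) ^ Suc l)"
      by (simp only: mult.assoc[symmetric] mult_1 mult_1_right)
    moreover have "emeasure (distr \<alpha> borel (\<lambda>x. x + y)) (A l) = h l y"
      unfolding h_def by (subst emeasure_distr_nn_integral) (auto simp: A add.commute)
    ultimately show "emeasure (distr \<alpha> borel (\<lambda>x. x + y)) (A l) \<le> ennreal ((1 / 2) ^ Suc l)" by simp
  qed
qed

text \<open>The sets \<open>V l\<close>, finite unions of balls of radius 2^(-l), are chosen for the
  common law \<open>\<rho>\<close> alone. The translation depends on \<open>n\<close>, the sets do
  not, and this gives tightness uniformly in \<open>n\<close>.\<close>

lemma conv_factors_shift_tight: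
  fixes \<alpha> \<beta> :: "'i \<Rightarrow> 'a::{banach, second_countable_topology} measure"
  assumes \<alpha>: "\<And>n. borel_prob (\<alpha> n)" and \<beta>: "\<And>n. borel_prob (\<beta> n)" and \<rho>: "borel_prob \<rho>"
    and conv: "\<And>n. measure_conv (\<alpha> n) (\<beta> n) = \<rho>"
  obtains x where "tight_along (\<lambda>n. measure_conv (\<alpha> n) (return borel (x n))) F"
proof -
  interpret \<rho>: prob_space \<rho> using \<rho> by (rule borel_probD)
  have "\<exists>S. finite S \<and> 1 - (1 / 4) ^ Suc l / 2 < measure \<rho> (\<Union>q\<in>S. ball q ((1 / 2) ^ l))" for l
    using borel_prob_finite_balls[OF \<rho>, of "(1 / 2) ^ l" "(1 / 4) ^ Suc l / 2"] by auto
  then obtain S where S: "\<And>l. finite (S l)" "\<And>l. 1 - (1 / 4) ^ Suc l / 2 < measure \<rho> (\<Union>q\<in>S l. ball q ((1 / 2) ^ l))"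
    by metis
  define V where "V l = (\<Union>q\<in>S l. ball q ((1 / 2) ^ l))" for l
  have V: "V l \<in> sets borel" for l unfolding V_def by (intro borel_open open_UN) auto
  have "emeasure \<rho> (- V l) \<le> ennreal ((1 / 4) ^ Suc l / 2)" for l
  proof -
    have "\<rho>.prob (- V l) = 1 - \<rho>.prob (V l)"
      using \<rho>.prob_compl[of "V l"] V by (simp add: borel_probD[OF \<rho>] Compl_eq_Diff_UNIV)
    then show ?thesis using S(2)[of l] by (simp add: \<rho>.emeasure_eq_measure V_def ennreal_leI)
  qed
  then have "\<exists>y. \<forall>l. emeasure (distr (\<alpha> n) borel (\<lambda>x. x + y)) (- V l) \<le> ennreal ((1 / 2) ^ Suc l)" for n
    using shift_of_conv_factor[OF \<alpha> \<beta>, of "\<lambda>l. - V l" n n] V conv conv_commute[OF \<beta> \<alpha>, of n n] by (metis borel_comp)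
  then obtain x where x: "\<And>n l. emeasure (distr (\<alpha> n) borel (\<lambda>z. z + x n)) (- V l) \<le> ennreal ((1 / 2) ^ Suc l)"
    by metis
  show ?thesis
  proof
    show "tight_along (\<lambda>n. measure_conv (\<alpha> n) (return borel (x n))) F"
      unfolding tight_along_def
    proof (intro allI impI)
      fix e :: real assume "0 < e"
      then obtain l where l: "(1 / 2) ^ l < e" using real_arch_pow_inv[of e "1 / 2"] by auto
      have "1 - e \<le> measure (measure_conv (\<alpha> n) (return borel (x n))) (\<Union>q\<in>S l. ball q e)" for n
      proof -
        let ?\<kappa> = "measure_conv (\<alpha> n) (return borel (x n))"
        have bp: "borel_prob ?\<kappa>" by (intro borel_prob_conv \<alpha> borel_prob_return)
        interpret prob_space ?\<kappa> using bp by (rule borel_probD)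
        have "emeasure ?\<kappa> (- V l) \<le> ennreal ((1 / 2) ^ Suc l)"
          using x by (simp add: conv_return_right[OF \<alpha>])
        then have "prob (- V l) \<le> (1 / 2) ^ Suc l" by (simp add: emeasure_eq_measure)
        moreover have "(1 / 2) ^ Suc l \<le> (1 / 2 :: real) ^ l" by simp
        moreover have "prob (- V l) = 1 - prob (V l)"
          using prob_compl[of "V l"] V by (simp add: borel_probD[OF bp] Compl_eq_Diff_UNIV)
        moreover have "prob (V l) \<le> prob (\<Union>q\<in>S l. ball q e)"
        proof (rule finite_measure_mono)
          show "V l \<subseteq> (\<Union>q\<in>S l. ball q e)" using l by (force simp: V_def)
          show "(\<Union>q\<in>S l. ball q e) \<in> events"
            unfolding borel_probD(2)[OF bp] by (intro borel_open open_UN) auto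
        qed
        ultimately show ?thesis using l by linarith
      qed
      then show "\<exists>S. finite S \<and> eventually (\<lambda>n. 1 - e \<le> measure (measure_conv (\<alpha> n) (return borel (x n))) (\<Union>q\<in>S. ball q e)) F"
        using S(1) by (intro exI[of _ "S l"]) auto
    qed
  qed
qed

text \<open>If \<open>\<rho>\<close> and its translate by \<open>y n\<close> both nearly live on
  finite unions of small balls, then some point lies in the first union while its translate lies in
  the second. Hence \<open>y n\<close> is close to one of finitely many differences of
  centres.\<close>

lemma tight_along_return_of_conv:
  fixes \<rho> :: "'a::{banach, second_countable_topology} measure"
  assumes \<rho>: "borel_prob \<rho>" and tight: "tight_along (\<lambda>n. measure_conv \<rho> (return borel (y n))) F"
    and c: "\<bar>c\<bar> \<le> 1"
  shows "tight_along (\<lambda>n. return borel (c *\<^sub>R y n)) F"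
  unfolding tight_along_def
proof (intro allI impI)
  fix e :: real assume "0 < e"
  interpret \<rho>: prob_space \<rho> using \<rho> by (rule borel_probD)
  \<comment> \<open>Missing masses of at most 1/3 make the two masses exceed 1 in total, so the two
    sets meet; the error \<open>2 * r\<close> in locating \<open>y n\<close> must not exceed
    \<open>e\<close>.\<close>
  define r where "r = min (e / 2) (1 / 3)"
  have r: "0 < r" "2 * r \<le> e" "r \<le> 1 / 3" using \<open>0 < e\<close> by (auto simp: r_def)
  obtain S where S: "finite S" "eventually (\<lambda>n. 1 - r \<le> measure (measure_conv \<rho> (return borel (y n))) (\<Union>q\<in>S. ball q r)) F"
    using tight r(1) unfolding tight_along_def by blast
  obtain G where G: "finite G" "1 - r < measure \<rho> (\<Union>q\<in>G. ball q r)"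
    using borel_prob_finite_balls[OF \<rho> r(1) r(1)] .
  define H where "H = (\<lambda>(a, b). c *\<^sub>R (a - b)) ` (S \<times> G)"
  have "finite H" unfolding H_def using S(1) G(1) by simp
  moreover from S(2) have "eventually (\<lambda>n. 1 - e \<le> measure (return borel (c *\<^sub>R y n)) (\<Union>q\<in>H. ball q e)) F"
  proof eventually_elim
    case (elim n)
    note [measurable_cong] = borel_probD(2)[OF \<rho>]
    let ?A = "\<Union>q\<in>G. ball q r" and ?B = "\<Union>q\<in>S. ball q r"
    let ?B' = "(\<lambda>z. z + y n) -` ?B"
    have [measurable]: "?A \<in> sets borel" "?B \<in> sets borel" by (auto intro!: borel_open open_UN)
    have B'[measurable]: "?B' \<in> sets borel"
      using measurable_sets[of "\<lambda>z. z + y n" borel borel ?B] by simp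
    have "measure (measure_conv \<rho> (return borel (y n))) ?B = \<rho>.prob ?B'"
      by (simp add: conv_return_right[OF \<rho>] measure_distr borel_probD(3)[OF \<rho>])
    then have "1 < \<rho>.prob ?A + \<rho>.prob ?B'" using elim G(2) r(3) by linarith
    moreover have "\<rho>.prob (?A \<union> ?B') = \<rho>.prob ?A + \<rho>.prob ?B'" if "?A \<inter> ?B' = {}"
      using that by (intro \<rho>.finite_measure_Union) auto
    ultimately have "?A \<inter> ?B' \<noteq> {}" using \<rho>.prob_le_1[of "?A \<union> ?B'"] by auto
    then obtain z a b where z: "b \<in> G" "dist b z < r" "a \<in> S" "dist a (z + y n) < r" by auto
    have "norm ((a - b) - y n) = norm ((a - (z + y n)) - (b - z))" by (simp add: algebra_simps)
    also have "\<dots> \<le> norm (a - (z + y n)) + norm (b - z)" by (rule norm_triangle_ineq4)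
    also have "\<dots> < 2 * r" using z by (simp add: dist_norm)
    finally have "\<bar>c\<bar> * norm ((a - b) - y n) < e"
      using c r(2) mult_right_mono[OF c norm_ge_zero[of "(a - b) - y n"]] by linarith
    then have "dist (c *\<^sub>R (a - b)) (c *\<^sub>R y n) < e"
      by (simp add: dist_norm scaleR_diff_right[symmetric])
    then have "c *\<^sub>R y n \<in> ball (c *\<^sub>R (a - b)) e" by simp
    moreover have "c *\<^sub>R (a - b) \<in> H"
      unfolding H_def using z by (intro image_eqI[of _ _ "(a, b)"]) auto
    ultimately have "c *\<^sub>R y n \<in> (\<Union>q\<in>H. ball q e)" by blast
    moreover have "(\<Union>q\<in>H. ball q e) \<in> sets borel" by (intro borel_open open_UN) auto
    ultimately show ?case using \<open>0 < e\<close> by (simp add: measure_return)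
  qed
  ultimately show "\<exists>S. finite S \<and> eventually (\<lambda>n. 1 - e \<le> measure (return borel (c *\<^sub>R y n)) (\<Union>q\<in>S. ball q e)) F"
    by blast
qed

text \<open>The law of \<open>X\<^sub>0 + S X\<^sub>1 + \<dots> + S^(m-1) X\<^sub>m\<^sub>-\<^sub>1\<close> for independent \<open>X\<^sub>i\<close> with law \<open>\<alpha>\<close>.\<close>

fun twisted_power :: "('a \<Rightarrow>\<^sub>L 'a) \<Rightarrow> nat \<Rightarrow> 'a::{banach, second_countable_topology} measure \<Rightarrow> 'a measure" where
  "twisted_power S 0 \<alpha> = return borel 0"
| "twisted_power S (Suc m) \<alpha> = measure_conv \<alpha> (distr (twisted_power S m \<alpha>) borel (blinfun_apply S))"

lemma borel_prob_distr_blinfun: "borel_prob \<mu> \<Longrightarrow> borel_prob (distr \<mu> borel (blinfun_apply S))"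
  by (rule borel_prob_distr_borel[OF _ measurable_blinfun_apply])

lemma borel_prob_twisted_power: "borel_prob \<alpha> \<Longrightarrow> borel_prob (twisted_power S m \<alpha>)"
  by (induction m) (auto intro: borel_prob_conv borel_prob_distr_blinfun)

lemma conv_interchange:
  assumes "borel_prob a" "borel_prob b" "borel_prob c" "borel_prob d"
  shows "measure_conv (measure_conv a b) (measure_conv c d) = measure_conv (measure_conv a c) (measure_conv b d)"
proof -
  have "measure_conv (measure_conv a b) (measure_conv c d) = measure_conv a (measure_conv (measure_conv b c) d)"
    using assms by (simp add: conv_assoc borel_prob_conv)
  also have "measure_conv b c = measure_conv c b" using assms by (simp add: conv_commute)
  finally show ?thesis using assms by (simp add: conv_assoc borel_prob_conv)
qed

lemma twisted_power_conv:
  assumes "borel_prob \<alpha>" "borel_prob \<beta>"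
  shows "twisted_power S m (measure_conv \<alpha> \<beta>) = measure_conv (twisted_power S m \<alpha>) (twisted_power S m \<beta>)"
proof (induction m)
  case (Suc m)
  then show ?case
    using assms
    by (simp add: distr_blinfun_conv borel_prob_twisted_power conv_interchange borel_prob_distr_blinfun)
qed simp

lemma distr_blinfun_return: "distr (return borel x) borel (blinfun_apply S) = return borel (blinfun_apply S x)"
  by (rule distr_return) auto

lemma distr_distr_blinfun:
  assumes "borel_prob \<alpha>"
  shows "distr (distr \<alpha> borel (blinfun_apply R)) borel (blinfun_apply S) = distr \<alpha> borel (blinfun_apply (S o\<^sub>L R))"
proof -
  have "blinfun_apply S \<circ> blinfun_apply R = blinfun_apply (S o\<^sub>L R)" by auto
  then show ?thesis
    by (subst distr_distr) (auto intro: measurable_borel_prob[OF assms])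
qed

lemma twisted_power_distr:
  assumes \<alpha>: "borel_prob \<alpha>" and comm: "S o\<^sub>L R = R o\<^sub>L S"
  shows "twisted_power S m (distr \<alpha> borel (blinfun_apply R)) = distr (twisted_power S m \<alpha>) borel (blinfun_apply R)"
proof (induction m)
  case 0
  show ?case by (simp add: distr_blinfun_return)
next
  case (Suc m)
  then show ?case
    using \<alpha> by (simp add: distr_distr_blinfun borel_prob_twisted_power distr_blinfun_conv borel_prob_distr_blinfun comm)
qed

text \<open>Which point results does not matter: it will be removed by a translation.\<close>

lemma twisted_power_return: "\<exists>y. twisted_power S m (return borel x) = return borel y"
proof (induction m)
  case (Suc m)
  then show ?case by (auto simp: distr_blinfun_return conv_return_return)
qed auto

lemma distr_borel_ident: "borel_prob \<alpha> \<Longrightarrow> distr \<alpha> borel (\<lambda>x. x) = \<alpha>"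
  by (simp add: distr_id2 borel_probD)

lemma distr_id_blinfun: "borel_prob \<alpha> \<Longrightarrow> distr \<alpha> borel (blinfun_apply id_blinfun) = \<alpha>"
  by (simp add: distr_borel_ident)

lemma twisted_power_id:
  assumes \<alpha>: "borel_prob \<alpha>"
  shows "twisted_power id_blinfun m \<alpha> = (measure_conv \<alpha> ^^ m) (return borel 0)"
proof (induction m)
  case (Suc m)
  have "twisted_power id_blinfun (Suc m) \<alpha> = measure_conv \<alpha> (twisted_power id_blinfun m \<alpha>)"
    using distr_id_blinfun[OF borel_prob_twisted_power[OF \<alpha>]] by simp
  then show ?case using Suc by simp
qed simp

lemma twisted_power_id_return: "twisted_power id_blinfun m (return borel x) = return borel (real m *\<^sub>R x)"
proof (induction m)
  case (Suc m)
  then show ?case by (simp add: distr_borel_ident conv_return_return algebra_simps)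
qed simp

text \<open>Each factor brings one more application of \<open>S i\<close>, which acts asymptotically
  as the identity on a convergent family of laws.\<close>

lemma bl_tendsto_twisted_power:
  fixes \<alpha> :: "'i \<Rightarrow> 'a::{banach, second_countable_topology} measure"
  assumes \<alpha>: "\<And>i. borel_prob (\<alpha> i)" "borel_prob \<alpha>'" "bl_tendsto \<alpha> \<alpha>' F"
    and S: "\<And>i. norm (S i) \<le> B" "\<And>x. ((\<lambda>i. blinfun_apply (S i) x) \<longlongrightarrow> x) F"
  shows "bl_tendsto (\<lambda>i. twisted_power (S i) m (\<alpha> i)) (twisted_power id_blinfun m \<alpha>') F"
proof (induction m)
  case 0
  show ?case by (simp add: bl_tendsto_def)
next
  case (Suc m)
  have "bl_tendsto (\<lambda>i. distr (twisted_power (S i) m (\<alpha> i)) borel (blinfun_apply (S i))) (twisted_power id_blinfun m \<alpha>') F"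
    by (rule bl_tendsto_distr_blinfun[OF _ _ Suc S]) (auto intro: borel_prob_twisted_power \<alpha>)
  then show ?case
    unfolding twisted_power.simps distr_id_blinfun[OF borel_prob_twisted_power[OF \<alpha>(2)]]
    by (intro bl_tendsto_conv \<alpha> borel_prob_distr_blinfun borel_prob_twisted_power)
qed

section \<open>Skew convolution semigroups\<close>

locale skew_convolution_semigroup =
  fixes T :: "real \<Rightarrow> 'a::{banach, second_countable_topology} \<Rightarrow>\<^sub>L 'a" and \<rho> :: "real \<Rightarrow> 'a measure"
  assumes T: "C0_semigroup T" and \<rho>: "0 \<le> t \<Longrightarrow> borel_prob (\<rho> t)"
    and weak: "weakly_tendsto \<rho> (\<rho> 0) (at_right 0)"
    and skew: "0 \<le> t \<Longrightarrow> 0 \<le> s \<Longrightarrow>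
      \<rho> (t + s) = measure_conv (\<rho> t) (distr (\<rho> s) borel (blinfun_apply (T t)))"
begin

lemma T_0: "T 0 = id_blinfun" and T_add: "0 \<le> t \<Longrightarrow> 0 \<le> s \<Longrightarrow> T (t + s) = T t o\<^sub>L T s"
  using T by (auto simp: C0_semigroup_def)

lemma T_commute: "0 \<le> t \<Longrightarrow> 0 \<le> s \<Longrightarrow> T t o\<^sub>L T s = T s o\<^sub>L T t"
  by (metis T_add add.commute)

lemma rho_0: "\<rho> 0 = return borel 0"
proof (rule conv_idempotent_eq_return)
  show "measure_conv (\<rho> 0) (\<rho> 0) = \<rho> 0"
    using skew[of 0 0] by (simp add: T_0 distr_borel_ident \<rho>)
qed (simp add: \<rho>)

sublocale convolution_hemigroup "\<lambda>s t. distr (\<rho> (t - s)) borel (blinfun_apply (T s))"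
proof
  fix s t u :: real
  show "borel_prob (distr (\<rho> (t - s)) borel (blinfun_apply (T s)))" if "0 \<le> s" "s \<le> t"
    using that by (intro borel_prob_distr_blinfun \<rho>) auto
  show "distr (\<rho> (t - t)) borel (blinfun_apply (T t)) = return borel 0"
    by (simp add: rho_0 distr_blinfun_return)
  assume st: "0 \<le> s" "s \<le> t" "t \<le> u"
  \<comment> \<open>Since T_t = T_s T_(t-s), the hemigroup law is the image under \<open>T s\<close>
    of the skew equation for the times \<open>t - s\<close> and \<open>u - t\<close>.\<close>
  have "distr (\<rho> (u - t)) borel (blinfun_apply (T t))
      = distr (distr (\<rho> (u - t)) borel (blinfun_apply (T (t - s)))) borel (blinfun_apply (T s))"
    using st T_add[of s "t - s"] by (simp add: distr_distr_blinfun \<rho>)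
  then have "measure_conv (distr (\<rho> (t - s)) borel (blinfun_apply (T s))) (distr (\<rho> (u - t)) borel (blinfun_apply (T t)))
      = distr (measure_conv (\<rho> (t - s)) (distr (\<rho> (u - t)) borel (blinfun_apply (T (t - s))))) borel (blinfun_apply (T s))"
    using st by (simp add: distr_blinfun_conv \<rho> borel_prob_distr_blinfun)
  also have "\<dots> = distr (\<rho> (u - s)) borel (blinfun_apply (T s))"
    using skew[of "t - s" "u - t"] st by simp
  finally show "measure_conv (distr (\<rho> (t - s)) borel (blinfun_apply (T s))) (distr (\<rho> (u - t)) borel (blinfun_apply (T t)))
    = distr (\<rho> (u - s)) borel (blinfun_apply (T s))" .
qed

lemma increments_small:
  assumes "0 < \<epsilon>" "0 < \<eta>"
  shows "\<exists>\<delta>>0. \<forall>s t. 0 \<le> s \<and> s \<le> t \<and> t \<le> K \<and> t - s \<le> \<delta> \<longrightarrow>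
    measure (distr (\<rho> (t - s)) borel (blinfun_apply (T s))) {x. \<epsilon> < norm x} \<le> \<eta>"
proof -
  obtain B where B: "0 < B" "\<And>t. 0 \<le> t \<Longrightarrow> t \<le> K \<Longrightarrow> norm (T t) \<le> B"
    using C0_semigroup_bounded[OF T, of K] by blast
  obtain \<delta> where \<delta>: "0 < \<delta>" "\<And>h. 0 < h \<Longrightarrow> h < \<delta> \<Longrightarrow> measure (\<rho> h) {x. \<epsilon> / B < norm x} \<le> \<eta>"
    using weakly_tendsto_return_0_small[OF \<rho> weak[unfolded rho_0], of "\<epsilon> / B" \<eta>] assms B(1) by auto
  have "measure (distr (\<rho> (t - s)) borel (blinfun_apply (T s))) {x. \<epsilon> < norm x} \<le> \<eta>"
    if st: "0 \<le> s" "s \<le> t" "t \<le> K" "t - s \<le> \<delta> / 2" for s t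
  proof (cases "s = t")
    \<comment> \<open>Weak convergence only speaks of positive time lags; for lag 0 the law is the
      point mass at 0.\<close>
    case True
    then show ?thesis using assms by (simp add: rho_0 distr_blinfun_return measure_return)
  next
    case False
    have bp: "borel_prob (\<rho> (t - s))" using st by (intro \<rho>) simp
    interpret prob_space "\<rho> (t - s)" using bp by (rule borel_probD)
    note [measurable_cong] = borel_probD(2)[OF bp]
    have "measure (distr (\<rho> (t - s)) borel (blinfun_apply (T s))) {x. \<epsilon> < norm x}
        = prob {x. \<epsilon> < norm (blinfun_apply (T s) x)}"
      by (subst measure_distr) (auto simp: borel_probD(3)[OF bp] vimage_def)
    also have "\<dots> \<le> prob {x. \<epsilon> / B < norm x}"
    proof (rule finite_measure_mono)
      show "{x. \<epsilon> < norm (blinfun_apply (T s) x)} \<subseteq> {x. \<epsilon> / B < norm x}"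
      proof safe
        fix x assume "\<epsilon> < norm (blinfun_apply (T s) x)"
        also have "\<dots> \<le> norm (T s) * norm x" by (rule norm_blinfun)
        also have "\<dots> \<le> B * norm x" using B(2)[of s] st by (intro mult_right_mono) auto
        finally show "\<epsilon> / B < norm x" using B(1) by (simp add: field_simps)
      qed
    qed (auto simp: borel_probD(2)[OF bp])
    also have "\<dots> \<le> \<eta>" using st False \<delta>(1) by (intro \<delta>(2)) auto
    finally show ?thesis .
  qed
  then show ?thesis using \<delta>(1) by (intro exI[of _ "\<delta> / 2"]) auto
qed

lemma rho_twisted_power: "0 \<le> h \<Longrightarrow> twisted_power (T h) m (\<rho> h) = \<rho> (real m * h)"
proof (induction m)
  case (Suc m)
  then show ?case using skew[of h "real m * h"] by (simp add: algebra_simps)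
qed (simp add: rho_0)

text \<open>Grouping the \<open>n * m\<close> increments over steps of length \<open>h\<close> by residue class modulo \<open>m\<close>.\<close>

lemma twisted_root_exists:
  assumes h: "0 \<le> h"
  shows "\<exists>\<alpha>. borel_prob \<alpha> \<and> twisted_power (T h) m \<alpha> = \<rho> (real n * (real m * h))"
proof (induction n)
  case 0
  have "twisted_power (T h) m (return borel 0) = return borel 0"
    by (induction m) (simp_all add: distr_blinfun_return)
  then show ?case by (intro exI[of _ "return borel 0"]) (simp add: rho_0)
next
  case (Suc n)
  then obtain \<alpha> where \<alpha>: "borel_prob \<alpha>" "twisted_power (T h) m \<alpha> = \<rho> (real n * (real m * h))" by blast
  \<comment> \<open>The class of residue 0 over one more period: a new first increment with law
    \<open>\<rho> h\<close>, followed by the old class delayed by \<open>m * h\<close>, a delay that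
    acts on laws through \<open>T (m * h)\<close>.\<close>
  define \<beta> where "\<beta> = measure_conv (\<rho> h) (distr \<alpha> borel (blinfun_apply (T (real m * h))))"
  have "twisted_power (T h) m \<beta>
      = measure_conv (\<rho> (real m * h)) (distr (\<rho> (real n * (real m * h))) borel (blinfun_apply (T (real m * h))))"
    using h \<alpha> by (simp add: \<beta>_def twisted_power_conv \<rho> borel_prob_distr_blinfun rho_twisted_power
        twisted_power_distr T_commute)
  also have "\<dots> = \<rho> (real (Suc n) * (real m * h))"
    using skew[of "real m * h" "real n * (real m * h)"] h by (simp add: algebra_simps)
  finally show ?case
    using h \<alpha> by (intro exI[of _ \<beta>]) (auto simp: \<beta>_def intro!: borel_prob_conv \<rho> borel_prob_distr_blinfun)
qed

lemma infinitely_divisible_rho: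
  assumes t: "0 \<le> t"
  shows "infinitely_divisible (\<rho> t)"
  unfolding infinitely_divisible_def
proof (intro allI impI)
  fix m :: nat assume m: "1 \<le> m"
  obtain U where U: "limit_filter U" using limit_filter_exists by blast
  \<comment> \<open>\<open>Suc n\<close> periods of \<open>m\<close> steps each fill
    \<open>[0, t]\<close>; the number of classes is fixed while the step tends to 0.\<close>
  define h where "h n = t / (real (Suc n) * real m)" for n
  have h: "0 \<le> h n" "real (Suc n) * (real m * h n) = t" for n
    using t m by (auto simp: h_def)
  have h_le: "h n \<le> t" for n
    using t m mult_mono[of 1 "real (Suc n)" 1 "real m"] by (auto simp: h_def divide_le_eq mult_le_cancel_left1)
  have "(\<lambda>n. t / real m * inverse (real (Suc n))) \<longlonglongrightarrow> t / real m * 0"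
    by (intro tendsto_intros LIMSEQ_inverse_real_of_nat)
  also have "(\<lambda>n. t / real m * inverse (real (Suc n))) = h" by (auto simp: h_def divide_simps)
  finally have h_lim: "h \<longlonglongrightarrow> 0" by simp
  have "\<exists>\<alpha>. borel_prob \<alpha> \<and> twisted_power (T (h n)) m \<alpha> = \<rho> t" for n
    using twisted_root_exists[OF h(1), of n m "Suc n"] by (simp only: h(2))
  then obtain \<alpha> where \<alpha>: "\<And>n. borel_prob (\<alpha> n)" "\<And>n. twisted_power (T (h n)) m (\<alpha> n) = \<rho> t" by metis
  obtain B where B: "\<And>s. 0 \<le> s \<Longrightarrow> s \<le> t \<Longrightarrow> norm (T s) \<le> B"
    using C0_semigroup_bounded[OF T, of t] by blast
  have T_bound: "norm (T (h n)) \<le> B" for n using B h(1) h_le by blast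
  have T_lim: "((\<lambda>n. blinfun_apply (T (h n)) x) \<longlongrightarrow> x) U" for x
  proof (rule limit_filterD(2)[OF U])
    have "continuous_on {0..} (\<lambda>t. blinfun_apply (T t) x)" using T by (auto simp: C0_semigroup_def)
    from continuous_on_tendsto_compose[OF this h_lim] h(1)
    show "(\<lambda>n. blinfun_apply (T (h n)) x) \<longlonglongrightarrow> x" by (simp add: T_0)
  qed
  \<comment> \<open>Splitting off one factor exhibits \<open>\<alpha> n\<close> as a convolution
    factor of the fixed law \<open>\<rho> t\<close>, so it is tight after a translation
    \<open>x n\<close>.\<close>
  obtain k where k: "m = Suc k" using m by (cases m) auto
  obtain x where x: "tight_along (\<lambda>n. measure_conv (\<alpha> n) (return borel (x n))) U"
  proof (rule conv_factors_shift_tight)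
    show "measure_conv (\<alpha> n) (distr (twisted_power (T (h n)) k (\<alpha> n)) borel (blinfun_apply (T (h n)))) = \<rho> t" for n
      using \<alpha>(2)[of n] by (simp add: k)
  qed (use \<alpha> \<rho> t in \<open>auto intro: borel_prob_distr_blinfun borel_prob_twisted_power\<close>)
  define \<beta> where "\<beta> n = measure_conv (\<alpha> n) (return borel (x n))" for n
  have \<beta>: "borel_prob (\<beta> n)" for n unfolding \<beta>_def by (intro borel_prob_conv \<alpha> borel_prob_return)
  have "tight_along \<beta> U" using x by (simp add: \<beta>_def[abs_def])
  then obtain \<beta>' where \<beta>': "borel_prob \<beta>'" "bl_tendsto \<beta> \<beta>' U"
    using tight_imp_bl_tendsto[of U \<beta>] U \<beta> by blast
  have pow_lim: "bl_tendsto (\<lambda>n. twisted_power (T (h n)) m (\<beta> n)) (twisted_power id_blinfun m \<beta>') U"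
    by (rule bl_tendsto_twisted_power[OF \<beta> \<beta>' T_bound T_lim])
  have "\<exists>y. \<forall>n. twisted_power (T (h n)) m (return borel (x n)) = return borel (y n)"
    by (intro choice allI twisted_power_return)
  then obtain y where y: "\<And>n. twisted_power (T (h n)) m (return borel (x n)) = return borel (y n)" by blast
  have pow: "twisted_power (T (h n)) m (\<beta> n) = measure_conv (\<rho> t) (return borel (y n))" for n
    unfolding \<beta>_def by (simp add: twisted_power_conv \<alpha> y)
  \<comment> \<open>These products converge and are translates of the single law
    \<open>\<rho> t\<close>; this controls the accumulated shifts \<open>y n\<close>, although
    nothing is known about the \<open>x n\<close>.\<close>
  have "tight_along (\<lambda>n. measure_conv (\<rho> t) (return borel (y n))) U"
    using bl_tendsto_imp_tight[OF borel_prob_twisted_power[OF \<beta>] borel_prob_twisted_power[OF \<beta>'(1)] pow_lim]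
    by (simp only: pow)
  \<comment> \<open>The correction by \<open>- y n\<close> is distributed equally over the
    \<open>m\<close> factors.\<close>
  then have "tight_along (\<lambda>n. return borel ((- 1 / real m) *\<^sub>R y n)) U"
    using m by (intro tight_along_return_of_conv[OF \<rho>[OF t]]) auto
  then obtain \<gamma> where \<gamma>: "borel_prob \<gamma>" "bl_tendsto (\<lambda>n. return borel ((- 1 / real m) *\<^sub>R y n)) \<gamma> U"
    using tight_imp_bl_tendsto[OF U] borel_prob_return by metis
  have "bl_tendsto (\<lambda>n. twisted_power id_blinfun m (return borel ((- 1 / real m) *\<^sub>R y n))) (twisted_power id_blinfun m \<gamma>) U"
    by (rule bl_tendsto_twisted_power[OF _ \<gamma>, where B="norm id_blinfun"]) auto
  then have "bl_tendsto (\<lambda>n. measure_conv (twisted_power (T (h n)) m (\<beta> n))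
      (twisted_power id_blinfun m (return borel ((- 1 / real m) *\<^sub>R y n))))
      (measure_conv (twisted_power id_blinfun m \<beta>') (twisted_power id_blinfun m \<gamma>)) U"
    using pow_lim \<beta> \<beta>' \<gamma> by (intro bl_tendsto_conv borel_prob_twisted_power) auto
  \<comment> \<open>After the correction the sequence is constant, so uniqueness of limits
    identifies \<open>\<rho> t\<close> with the \<open>m\<close>-th power of the limit.\<close>
  moreover have "measure_conv (twisted_power (T (h n)) m (\<beta> n))
      (twisted_power id_blinfun m (return borel ((- 1 / real m) *\<^sub>R y n))) = \<rho> t" for n
    unfolding pow twisted_power_id_return using m \<rho>[OF t] by (simp add: conv_assoc conv_return_return)
  moreover have "measure_conv (twisted_power id_blinfun m \<beta>') (twisted_power id_blinfun m \<gamma>)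
      = twisted_power id_blinfun m (measure_conv \<beta>' \<gamma>)"
    using \<beta>'(1) \<gamma>(1) by (simp add: twisted_power_conv)
  ultimately have "bl_tendsto (\<lambda>n. \<rho> t) (twisted_power id_blinfun m (measure_conv \<beta>' \<gamma>)) U" by simp
  moreover have "bl_tendsto (\<lambda>n. \<rho> t) (\<rho> t) U" by (simp add: bl_tendsto_def)
  ultimately have "\<rho> t = twisted_power id_blinfun m (measure_conv \<beta>' \<gamma>)"
    using \<rho>[OF t] \<beta>'(1) \<gamma>(1)
    by (intro bl_tendsto_unique[OF limit_filterD(1)[OF U]] borel_prob_twisted_power borel_prob_conv)
  then show "\<exists>\<nu>. borel_prob \<nu> \<and> \<rho> t = (measure_conv \<nu> ^^ m) (return borel 0)"
    using \<beta>'(1) \<gamma>(1) borel_prob_conv twisted_power_id by metis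
qed

end

theorem proposition4:
  fixes T :: "real \<Rightarrow> 'a::{banach, second_countable_topology} \<Rightarrow>\<^sub>L 'a"
    and \<rho> :: "real \<Rightarrow> 'a measure"
  assumes "C0_semigroup T"
    and "\<And>t. t \<ge> 0 \<Longrightarrow> borel_prob (\<rho> t)"
    and "weakly_tendsto \<rho> (\<rho> 0) (at_right 0)"
    and "\<And>t s. t \<ge> 0 \<Longrightarrow> s \<ge> 0 \<Longrightarrow>
           \<rho> (t + s) = measure_conv (\<rho> t) (distr (\<rho> s) borel (blinfun_apply (T t)))"
  shows "(\<exists>(M :: (real \<Rightarrow> 'a) measure) (Z :: real \<Rightarrow> (real \<Rightarrow> 'a) \<Rightarrow> 'a).
            prob_space M \<and>
            (\<forall>t\<ge>0. Z t \<in> borel_measurable M) \<and>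
            (\<forall>\<omega>\<in>space M. cadlag (\<lambda>t. Z t \<omega>)) \<and>
            independent_increments M Z \<and>
            (\<forall>t\<ge>0. distr M borel (Z t) = \<rho> t) \<and>
            (AE \<omega> in M. Z 0 \<omega> = 0))
         \<and> (\<forall>t\<ge>0. infinitely_divisible (\<rho> t))"
proof
  interpret skew_convolution_semigroup T \<rho>
    using assms by unfold_locales
  have law: "distr (\<rho> (t - 0)) borel (blinfun_apply (T 0)) = \<rho> t" if "0 \<le> t" for t
    using that by (simp add: T_0 distr_borel_ident \<rho>)
  show "\<exists>(M :: (real \<Rightarrow> 'a) measure) (Z :: real \<Rightarrow> (real \<Rightarrow> 'a) \<Rightarrow> 'a).
            prob_space M \<and>
            (\<forall>t\<ge>0. Z t \<in> borel_measurable M) \<and>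
            (\<forall>\<omega>\<in>space M. cadlag (\<lambda>t. Z t \<omega>)) \<and>
            independent_increments M Z \<and>
            (\<forall>t\<ge>0. distr M borel (Z t) = \<rho> t) \<and>
            (AE \<omega> in M. Z 0 \<omega> = 0)"
  proof (rule cadlag_process_exists[OF increments_small])
    fix M :: "(real \<Rightarrow> 'a) measure" and Z :: "real \<Rightarrow> (real \<Rightarrow> 'a) \<Rightarrow> 'a"
    assume "prob_space M" "\<And>t. 0 \<le> t \<Longrightarrow> Z t \<in> borel_measurable M"
      "\<And>\<omega>. \<omega> \<in> space M \<Longrightarrow> cadlag (\<lambda>t. Z t \<omega>)" "independent_increments M Z"
      "\<And>t. 0 \<le> t \<Longrightarrow> distr M borel (Z t) = distr (\<rho> (t - 0)) borel (blinfun_apply (T 0))"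
      "AE \<omega> in M. Z 0 \<omega> = 0"
    then show ?thesis
      using law by (intro exI[of _ M] exI[of _ Z]) simp
  qed
  show "\<forall>t\<ge>0. infinitely_divisible (\<rho> t)"
    using infinitely_divisible_rho by blast
qed

end
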